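(* Let $\phi$, $\phi_0$, $\phi_1$ be the flows of $\partial_tu=A_0u+A_1(u)$, $\partial_tu=A_0u$ and $\partial_tu=A_1(u)$ respectively, and assume: (1) $\phi,\phi_0,\phi_1$ are compatible with a sequence $\{\mathsf H_k\}_{k\ge0}$ of Hilbert spaces with $\mathsf H_0=\mathsf H$ and $\mathsf H_{k+1}\hookrightarrow\mathsf H_k$; (2) given $R>0$ there exists $h^*>0$ such that for every $k\ge0$ and every $u\in B_{\mathsf H}(0,R)\cap\mathsf H_k$, $\phi(t,u)$, $\phi_0(t,u)$ and $\phi_1(t,u)$ are defined (in $\mathsf H_k$) for $t\in[0,h^*]$; (3) $\phi_0$ is a quasicontraction semigroup, $\|\phi_0(h,u)\|_{\mathsf H}\le e^{\kappa_0h}\|u\|_{\mathsf H}$, and $\phi_1$ is uniformly stable on every ball $B_{\mathsf H}(0,R)$. Let $\Phi$ be either (a) the asymmetric method $\Phi(h)=\sum_{m=1}^s\gamma_m\Phi_m^{\pm}(h/m)$ (one fixed sign), where $q\in\mathbb N$, $\sum_{m=1}^s\gamma_m=1$ and $\sum_{m=1}^sm^{-k}\gamma_m=0$ for $1\le k\le q-1$; or (b) the symmetric method $\Phi(h)=\sum_{m=1}^s\gamma_m(\Phi_m^{+}(h/m)+\Phi_m^{-}(h/m))$, where $q=2n$, $n\in\mathbb N$, $\sum_{m=1}^s\gamma_m=\frac12$ and $\sum_{m=1}^sm^{-2k}\gamma_m=0$ for $1\le k\le n-1$. Let $u_0\in\mathsf H_{q+1}$ and let $u(t)=\phi(t,u_0)$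 be the maximal solution of $\partial_tu=A_0u+A_1(u)$, $u(0)=u_0$, defined on $[0,T_* )$. Then for every $T\in(0,T_* )$ there exist $h_*,\delta,\kappa,C>0$ such that if $U_0\in\mathsf H_{q+1}$ satisfies $\|u_0-U_0\|_{\mathsf H}<\delta$ and $0<h<h_*$, then the sequence $U_n=\Phi(h,U_{n-1})$ is defined for $n\le[T/h]$ and satisfies $$\|\phi(nh,u_0)-U_n\|_{\mathsf H}\le e^{\kappa nh}\|u_0-U_0\|_{\mathsf H}+C\,\frac{e^{\kappa nh}-1}{\kappa}\,h^q .$$
   Context: $\mathsf H$ is a Hilbert space, $A_0$ is a closed densely defined linear operator on $D(A_0)\subset\mathsf H$ generating a quasicontraction semigroup, and $A_1:\mathsf H\to\mathsf H$ is a smooth map with $A_1(0)=0$. Flows are (possibly only locally defined) solution maps $(t,u_0)\mapsto u(t)$ in the usual (mild) sense; in particular $\phi_0(t)=e^{tA_0}$. $[x]$ is the integer part of $x$. Notation: $\varphi(h)=\varphi(h,\cdot)$; $\Phi^+(h)=\phi_1(h)\circ\phi_0(h)$, $\Phi^-(h)=\phi_0(h)\circ\phi_1(h)$, $\Phi_1^\pm=\Phi^\pm$ and $\Phi_m^\pm(h)=\Phi^\pm(h)\circ\Phi_{m-1}^\pm(h)$ for $m\ge2$. The coefficients $\gamma_m$ are real. Compatibility: $\varphi$ is compatible with $\{\mathsf H_k\}_{k\ge0}$ if for all $k,l\ge0$, $\varphi$ is of class $C^{k,\infty}$ from $[0,h_* )\times\mathsf H_{k+l}$ to $\mathsf H_l$,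 i.e. it maps into $\mathsf H_l$ and all mixed derivatives $\partial_h^jD_u^i\varphi(h,u)[v_1,\dots,v_i]$ ($0\le j\le k$, $i\ge0$) exist in $\mathsf H_l$ and are jointly continuous in $(h,u,v_1,\dots,v_i)$, with $u,v_1,\dots,v_i\in\mathsf H_{k+l}$. For locally defined flows this is understood on the sets $[0,h^*]\times(B_{\mathsf H}(0,R)\cap\mathsf H_{k+l})$, with $h^*=h^*(R)$ as in (2). Uniform stability of $\phi_1$ on $B_{\mathsf H}(0,R)$: $$\limsup_{h\downarrow0}\frac1h\sup_{u\ne u'\in B_{\mathsf H}(0,R)}\frac{\|(\phi_1(h,u)-u)-(\phi_1(h,u')-u')\|_{\mathsf H}}{\|u-u'\|_{\mathsf H}}<\infty .$$ *)

theory Defs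
  imports "HOL-Analysis.Analysis"
begin

subsection \<open>Semigroups and unbounded operators\<close>

definition closed_densely_defined_operator ::
  "'a::real_normed_vector set \<Rightarrow> ('a \<Rightarrow> 'a) \<Rightarrow> bool" where
  "closed_densely_defined_operator D A \<longleftrightarrow>
     subspace D \<and> closure D = UNIV \<and>
     (\<forall>u\<in>D. \<forall>v\<in>D. \<forall>a b. A (a *\<^sub>R u + b *\<^sub>R v) = a *\<^sub>R A u + b *\<^sub>R A v) \<and>
     closed {(u, A u) | u. u \<in> D}"

(* Only the values S t with t >= 0 matter. *)
definition C0_semigroup :: "(real \<Rightarrow> 'a::real_normed_vector \<Rightarrow> 'a) \<Rightarrow> bool" where
  "C0_semigroup S \<longleftrightarrow>
     (\<forall>t\<ge>0. bounded_linear (S t)) \<and>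
     (\<forall>u. S 0 u = u) \<and>
     (\<forall>s\<ge>0. \<forall>t\<ge>0. \<forall>u. S (s + t) u = S s (S t u)) \<and>
     (\<forall>u. ((\<lambda>t. S t u) \<longlongrightarrow> u) (at_right 0))"

definition generates :: "'a::real_normed_vector set \<Rightarrow> ('a \<Rightarrow> 'a) \<Rightarrow> (real \<Rightarrow> 'a \<Rightarrow> 'a) \<Rightarrow> bool" where
  "generates D A S \<longleftrightarrow> C0_semigroup S \<and>
     D = {u. \<exists>w. ((\<lambda>t. (S t u - u) /\<^sub>R t) \<longlongrightarrow> w) (at_right 0)} \<and>
     (\<forall>u\<in>D. ((\<lambda>t. (S t u - u) /\<^sub>R t) \<longlongrightarrow> A u) (at_right 0))"

definition quasicontraction :: "real \<Rightarrow> (real \<Rightarrow> 'a::real_normed_vector \<Rightarrow> 'a) \<Rightarrow> bool" where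
  "quasicontraction \<kappa> S \<longleftrightarrow> (\<forall>h\<ge>0. \<forall>u. norm (S h u) \<le> exp (\<kappa> * h) * norm u)"

subsection \<open>Smooth maps\<close>

definition bounded_multilinear ::
  "nat \<Rightarrow> ('a::real_normed_vector list \<Rightarrow> 'b::real_normed_vector) \<Rightarrow> bool" where
  "bounded_multilinear i M \<longleftrightarrow>
     (\<forall>vs n. length vs = i \<longrightarrow> n < i \<longrightarrow> linear (\<lambda>x. M (vs[n := x]))) \<and>
     (\<exists>K. \<forall>vs. length vs = i \<longrightarrow> norm (M vs) \<le> K * (\<Prod>v\<leftarrow>vs. norm v))"

(* Infinitely Frechet differentiable: D i u vs is the i-th derivative of f at u applied to the
   list vs of i directions, and D (Suc i) u is the Frechet derivative of D i at u with respect to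
   the operator norm on i-linear maps. *)
definition smooth_map :: "('a::real_normed_vector \<Rightarrow> 'b::real_normed_vector) \<Rightarrow> bool" where
  "smooth_map f \<longleftrightarrow> (\<exists>D :: nat \<Rightarrow> 'a \<Rightarrow> 'a list \<Rightarrow> 'b.
     (\<forall>u. D 0 u [] = f u) \<and>
     (\<forall>i u. bounded_multilinear i (D i u)) \<and>
     (\<forall>i u. \<forall>e>0. \<exists>d>0. \<forall>w vs. norm w < d \<longrightarrow> length vs = i \<longrightarrow>
        norm (D i (u + w) vs - D i u vs - D (Suc i) u (w # vs))
          \<le> e * norm w * (\<Prod>v\<leftarrow>vs. norm v)))"

subsection \<open>Scales of Hilbert spaces\<close>

text \<open>Each space of the scale is a linear subspace of the ambient Hilbert space, carrying an inner
  product of its own.\<close>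

definition nrm :: "('a \<Rightarrow> 'a \<Rightarrow> real) \<Rightarrow> 'a \<Rightarrow> real" where
  "nrm ip u = sqrt (ip u u)"

(* The value outside X is irrelevant; it only serves to make this a global metric on X in the sense
   of the locale Metric_space, which asks for symmetry and nonnegativity off the carrier too. *)
definition nrm_dist :: "'a::real_vector set \<Rightarrow> ('a \<Rightarrow> 'a \<Rightarrow> real) \<Rightarrow> 'a \<Rightarrow> 'a \<Rightarrow> real" where
  "nrm_dist X ip u v = (if u \<in> X \<and> v \<in> X then nrm ip (u - v) else 0)"

definition hilbert_space_on :: "'a::real_vector set \<Rightarrow> ('a \<Rightarrow> 'a \<Rightarrow> real) \<Rightarrow> bool" where
  "hilbert_space_on X ip \<longleftrightarrow> subspace X \<and>
     (\<forall>u\<in>X. \<forall>v\<in>X. ip u v = ip v u) \<and>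
     (\<forall>u\<in>X. \<forall>v\<in>X. \<forall>w\<in>X. \<forall>a b. ip (a *\<^sub>R u + b *\<^sub>R v) w = a * ip u w + b * ip v w) \<and>
     (\<forall>u\<in>X. u \<noteq> 0 \<longrightarrow> ip u u > 0) \<and>
     Metric_space.mcomplete X (nrm_dist X ip)"

lemma Metric_space_nrm_dist:
  fixes X :: "'a::real_vector set"
  assumes "hilbert_space_on X ip"
  shows "Metric_space X (nrm_dist X ip)"
proof -
  have sub: "subspace X" and sym: "\<And>u v. u\<in>X \<Longrightarrow> v\<in>X \<Longrightarrow> ip u v = ip v u"
   and lin: "\<And>u v w a b. u\<in>X \<Longrightarrow> v\<in>X \<Longrightarrow> w\<in>X \<Longrightarrow> ip (a *\<^sub>R u + b *\<^sub>R v) w = a * ip u w + b * ip v w"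
   and pos: "\<And>u. u\<in>X \<Longrightarrow> u\<noteq>0 \<Longrightarrow> ip u u > 0" using assms unfolding hilbert_space_on_def by blast+
  have z: "0 \<in> X" using sub by (simp add: subspace_0)
  have ip0: "ip 0 w = 0" if "w\<in>X" for w using lin[OF z z that, of 0 0] by simp
  have nn: "ip u u \<ge> 0" if "u\<in>X" for u using pos[OF that] ip0[OF z] by (cases "u=0") auto
  have sq: "ip (u + t *\<^sub>R v) (u + t *\<^sub>R v) = ip u u + 2*t*ip u v + t^2 * ip v v" if "u\<in>X" "v\<in>X" for u v t
  proof -
    have w: "u + t *\<^sub>R v \<in> X" using sub that by (simp add: subspace_add subspace_scale)
    have "ip (u + t *\<^sub>R v) (u + t *\<^sub>R v) = ip u (u + t *\<^sub>R v) + t * ip v (u + t *\<^sub>R v)"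
      using lin[OF that(1) that(2) w, of 1 t] by simp
    also have "\<dots> = ip (u + t *\<^sub>R v) u + t * ip (u + t *\<^sub>R v) v" using sym w that by simp
    also have "\<dots> = ip u u + t * ip v u + t * (ip u v + t * ip v v)"
      using lin[OF that(1) that(2) that(1), of 1 t] lin[OF that(1) that(2) that(2), of 1 t] by simp
    finally show ?thesis using sym that by (simp add: algebra_simps power2_eq_square)
  qed
  have cs: "ip u v \<le> nrm ip u * nrm ip v" if "u\<in>X" "v\<in>X" for u v
  proof (cases "v = 0")
    case True then show ?thesis using sym[OF that] ip0 that z by (simp add: nrm_def)
  next
    case False
    have p: "ip v v > 0" using pos that False by blast
    have "0 \<le> ip u u + 2*(- ip u v / ip v v)*ip u v + (- ip u v / ip v v)^2 * ip v v"
      using sq[OF that, of "- ip u v / ip v v"] nn sub that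
      by (metis subspace_add subspace_scale)
    then have "(ip u v)^2 \<le> ip u u * ip v v" using p by (simp add: power2_eq_square field_simps)
    then show ?thesis unfolding nrm_def using real_le_rsqrt real_sqrt_mult by metis
  qed
  have tri: "nrm ip (u + v) \<le> nrm ip u + nrm ip v" if "u\<in>X" "v\<in>X" for u v
  proof -
    have "ip (u+v) (u+v) \<le> (nrm ip u + nrm ip v)^2"
      using sq[OF that, of 1] cs[OF that] nn that by (simp add: power2_sum nrm_def algebra_simps)
    then show ?thesis unfolding nrm_def by (meson add_nonneg_nonneg nn real_le_lsqrt real_sqrt_ge_zero that)
  qed
  have d: "u - v \<in> X" if "u\<in>X" "v\<in>X" for u v using sub that by (simp add: subspace_diff)
  have neg: "nrm ip (v - u) = nrm ip (u - v)" if "u\<in>X" "v\<in>X" for u v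
    using sq[OF z d[OF that], of "-1"] ip0[OF z] ip0[OF d[OF that]] by (simp add: nrm_def)
  show ?thesis
  proof
    fix x y show "0 \<le> nrm_dist X ip x y"
      using nn d by (simp add: nrm_dist_def nrm_def)
  next
    fix x y show "nrm_dist X ip x y = nrm_dist X ip y x"
      using neg by (simp add: nrm_dist_def)
  next
    fix x y assume "x\<in>X" "y\<in>X"
    then show "(nrm_dist X ip x y = 0) = (x=y)"
      using pos[OF d[of x y]] ip0[OF z] by (force simp: nrm_dist_def nrm_def)
  next
    fix x y w assume "x\<in>X" "y\<in>X" "w\<in>X"
    then show "nrm_dist X ip x w \<le> nrm_dist X ip x y + nrm_dist X ip y w"
      using tri[OF d d, of x y y w] by (simp add: nrm_dist_def)
  qed
qed

definition norm_topology :: "'a::real_vector set \<Rightarrow> ('a \<Rightarrow> 'a \<Rightarrow> real) \<Rightarrow> 'a topology" where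
  "norm_topology X ip = Metric_space.mtopology X (nrm_dist X ip)"

definition hilbert_scale ::
  "(nat \<Rightarrow> 'a::real_inner set) \<Rightarrow> (nat \<Rightarrow> 'a \<Rightarrow> 'a \<Rightarrow> real) \<Rightarrow> bool" where
  "hilbert_scale Hs ip \<longleftrightarrow>
     Hs 0 = UNIV \<and> ip 0 = inner \<and>
     (\<forall>k. hilbert_space_on (Hs k) (ip k)) \<and>
     (\<forall>k. Hs (Suc k) \<subseteq> Hs k \<and> (\<exists>K. \<forall>u\<in>Hs (Suc k). nrm (ip k) u \<le> K * nrm (ip (Suc k)) u))"

subsection \<open>Partially defined flows\<close>

text \<open>A locally defined flow is a family of partial maps; \<open>\<phi> t u = None\<close> means that \<open>\<phi>(t, u)\<close> is
  not defined.\<close>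

(* Mild solution on the closed interval [0,T] of u' = A u + F(u), u(0) = u0, where A generates S
   (Duhamel formula). *)
definition mild_solution ::
  "(real \<Rightarrow> 'a::banach \<Rightarrow> 'a) \<Rightarrow> ('a \<Rightarrow> 'a) \<Rightarrow> 'a \<Rightarrow> real \<Rightarrow> (real \<Rightarrow> 'a) \<Rightarrow> bool" where
  "mild_solution S F u0 T u \<longleftrightarrow> continuous_on {0..T} u \<and>
     (\<forall>t\<in>{0..T}. ((\<lambda>s. S (t - s) (F (u s))) has_integral (u t - S t u0)) {0..t})"

definition mild_flow ::
  "(real \<Rightarrow> 'a::banach \<Rightarrow> 'a) \<Rightarrow> ('a \<Rightarrow> 'a) \<Rightarrow> real \<Rightarrow> 'a \<rightharpoonup> 'a" where
  "mild_flow S F t u0 =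
     (if 0 \<le> t \<and> (\<exists>u. mild_solution S F u0 t u)
      then Some (THE x. \<exists>u. mild_solution S F u0 t u \<and> u t = x) else None)"

definition existence_time :: "(real \<Rightarrow> 'a \<rightharpoonup> 'a) \<Rightarrow> 'a \<Rightarrow> ereal" where
  "existence_time \<phi> u0 = (SUP t\<in>{t. \<phi> t u0 \<noteq> None}. ereal t)"

definition defined_in_scale ::
  "(nat \<Rightarrow> 'a::real_inner set) \<Rightarrow> real \<Rightarrow> real \<Rightarrow> (real \<Rightarrow> 'a \<rightharpoonup> 'a) \<Rightarrow> bool" where
  "defined_in_scale Hs hs R \<phi> \<longleftrightarrow>
     (\<forall>k. \<forall>u\<in>ball 0 R \<inter> Hs k. \<forall>t\<in>{0..hs}. \<exists>v\<in>Hs k. \<phi> t u = Some v)"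

(* D j i h u [v_i, ..., v_1] is the mixed derivative d_h^j D_u^i f(h,u)[v_1,...,v_i].  It is
   obtained from f by first differentiating i times in u, successively in the directions
   v_1, ..., v_i (a newly added direction is the head of the list), and then j times in h
   (one-sidedly at the end points of I).  All limits are taken in Y. *)
definition class_C_inf ::
  "nat \<Rightarrow> 'a::real_vector topology \<Rightarrow> 'a topology \<Rightarrow> real set \<Rightarrow> 'a set \<Rightarrow>
   (real \<Rightarrow> 'a \<Rightarrow> 'a) \<Rightarrow> bool" where
  "class_C_inf k X Y I V f \<longleftrightarrow> (\<exists>D :: nat \<Rightarrow> nat \<Rightarrow> real \<Rightarrow> 'a \<Rightarrow> 'a list \<Rightarrow> 'a.
     (\<forall>h\<in>I. \<forall>u\<in>V. D 0 0 h u [] = f h u) \<and>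
     (\<forall>h\<in>I. \<forall>u\<in>V. \<forall>v\<in>topspace X. \<forall>vs\<in>lists (topspace X).
        limitin Y (\<lambda>r. (D 0 (length vs) h (u + r *\<^sub>R v) vs - D 0 (length vs) h u vs) /\<^sub>R r)
          (D 0 (Suc (length vs)) h u (v # vs)) (at 0)) \<and>
     (\<forall>j<k. \<forall>h\<in>I. \<forall>u\<in>V. \<forall>vs\<in>lists (topspace X).
        limitin Y (\<lambda>t. (D j (length vs) t u vs - D j (length vs) h u vs) /\<^sub>R (t - h))
          (D (Suc j) (length vs) h u vs) (at h within I)) \<and>
     (\<forall>j\<le>k. \<forall>i. continuous_map
        (prod_topology (top_of_set I)
          (prod_topology (subtopology X V) (product_topology (\<lambda>_. X) {..<i})))
        Y (\<lambda>(h, u, v). D j i h u (map v [0..<i]))))"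

definition compatible ::
  "(nat \<Rightarrow> 'a::real_inner set) \<Rightarrow> (nat \<Rightarrow> 'a \<Rightarrow> 'a \<Rightarrow> real) \<Rightarrow> real \<Rightarrow> real \<Rightarrow>
   (real \<Rightarrow> 'a \<rightharpoonup> 'a) \<Rightarrow> bool" where
  "compatible Hs ip hs R \<phi> \<longleftrightarrow>
     (\<forall>k l. class_C_inf k (norm_topology (Hs (k + l)) (ip (k + l))) (norm_topology (Hs l) (ip l))
        {0..hs} (ball 0 R \<inter> Hs (k + l)) (\<lambda>h u. the (\<phi> h u)))"

definition uniformly_stable :: "real \<Rightarrow> (real \<Rightarrow> 'a::real_normed_vector \<rightharpoonup> 'a) \<Rightarrow> bool" where
  "uniformly_stable R \<phi> \<longleftrightarrow>
     Limsup (at_right 0) (\<lambda>h. ereal (1 / h) *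
       (SUP (u, u')\<in>{(u, u'). u \<in> ball 0 R \<and> u' \<in> ball 0 R \<and> u \<noteq> u'}.
          ereal (norm ((the (\<phi> h u) - u) - (the (\<phi> h u') - u')) / norm (u - u')))) < \<infinity>"

subsection \<open>Splitting methods\<close>

primrec iter :: "('a \<rightharpoonup> 'a) \<Rightarrow> nat \<Rightarrow> 'a \<rightharpoonup> 'a" where
  "iter F 0 = Some"
| "iter F (Suc n) = F \<circ>\<^sub>m iter F n"

definition partial_add :: "('b \<rightharpoonup> 'a::plus) \<Rightarrow> ('b \<rightharpoonup> 'a) \<Rightarrow> 'b \<rightharpoonup> 'a" where
  "partial_add F G u =
     (if F u \<noteq> None \<and> G u \<noteq> None then Some (the (F u) + the (G u)) else None)"

(* A combination is defined only where all its terms are, also those with coefficient 0. *)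
definition partial_combination ::
  "nat \<Rightarrow> (nat \<Rightarrow> real) \<Rightarrow> (nat \<Rightarrow> 'b \<rightharpoonup> 'a::real_vector) \<Rightarrow> 'b \<rightharpoonup> 'a" where
  "partial_combination s \<gamma> F u =
     (if \<forall>m\<in>{1..s}. F m u \<noteq> None then Some (\<Sum>m=1..s. \<gamma> m *\<^sub>R the (F m u)) else None)"

definition splitting ::
  "(real \<Rightarrow> 'a \<rightharpoonup> 'a) \<Rightarrow> (real \<Rightarrow> 'a \<rightharpoonup> 'a) \<Rightarrow> real \<Rightarrow> 'a \<rightharpoonup> 'a" where
  "splitting \<psi> \<psi>' h = \<psi> h \<circ>\<^sub>m \<psi>' h"

definition asymmetric_method ::
  "nat \<Rightarrow> (nat \<Rightarrow> real) \<Rightarrow> (real \<Rightarrow> 'a::real_vector \<rightharpoonup> 'a) \<Rightarrow> real \<Rightarrow> 'a \<rightharpoonup> 'a" where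
  "asymmetric_method s \<gamma> \<Psi> h =
     partial_combination s \<gamma> (\<lambda>m. iter (\<Psi> (h / real m)) m)"

definition symmetric_method ::
  "nat \<Rightarrow> (nat \<Rightarrow> real) \<Rightarrow> (real \<Rightarrow> 'a::real_vector \<rightharpoonup> 'a) \<Rightarrow> (real \<Rightarrow> 'a \<rightharpoonup> 'a) \<Rightarrow>
   real \<Rightarrow> 'a \<rightharpoonup> 'a" where
  "symmetric_method s \<gamma> \<Psi>p \<Psi>m h =
     partial_combination s \<gamma>
       (\<lambda>m. partial_add (iter (\<Psi>p (h / real m)) m) (iter (\<Psi>m (h / real m)) m))"

definition asymmetric_conditions :: "nat \<Rightarrow> nat \<Rightarrow> (nat \<Rightarrow> real) \<Rightarrow> bool" where
  "asymmetric_conditions q s \<gamma> \<longleftrightarrow> (\<Sum>m=1..s. \<gamma> m) = 1 \<and>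
     (\<forall>k. 1 \<le> k \<and> k \<le> q - 1 \<longrightarrow> (\<Sum>m=1..s. \<gamma> m / real m ^ k) = 0)"

definition symmetric_conditions :: "nat \<Rightarrow> nat \<Rightarrow> (nat \<Rightarrow> real) \<Rightarrow> bool" where
  "symmetric_conditions n s \<gamma> \<longleftrightarrow> (\<Sum>m=1..s. \<gamma> m) = 1 / 2 \<and>
     (\<forall>k. 1 \<le> k \<and> k \<le> n - 1 \<longrightarrow> (\<Sum>m=1..s. \<gamma> m / real m ^ (2 * k)) = 0)"

end

theory Submission
  imports Defs
begin

text \<open>Writing \<open>L a\<close> for the derivation along the vector field of a partial flow, a composition of partial
  flows expands as a series, over words in the two letters, of iterated derivations of the identity; the
  exact flow expands with coefficient \<open>1 / j!\<close> at every word of length \<open>j\<close>.  If \<open>P\<close> is the linear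
  operator that one splitting step induces on coefficient functions, \<open>P - 1\<close> shortens words, so the
  coefficient of a word of length \<open>j\<close> in the \<open>m\<close>-fold step is a polynomial in \<open>m\<close> of degree \<open>j\<close> without
  constant term and with leading coefficient \<open>1 / j!\<close>, by the binomial theorem.  With step \<open>h / m\<close> it
  becomes a polynomial in \<open>1 / m\<close>, and the order conditions on the \<open>\<gamma> m\<close> remove all but its constant
  term.  For the adjoint splitting the polynomial is the same with \<open>1 / m\<close> replaced by \<open>- 1 / m\<close>, so
  only even powers survive in the symmetric method.  This gives a local error of order \<open>q + 1\<close> in the
  weakest norm, locally uniformly for data in \<open>Hs (q + 1)\<close>, hence uniformly along the solution.
  Stability holds because each \<open>m\<close>-fold step differs from the semigroup by a map with Lipschitz constant
  of order \<open>h\<close>, and the weights of the semigroup add up to one.\<close>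

section \<open>Calculus in a scale of Hilbert spaces\<close>

text \<open>Each derivation costs one level of the scale, since time derivatives of the flows are
  available only from \<open>Hs (Suc l)\<close> to \<open>Hs l\<close>. A word of length
  \<open>j\<close> needs data in \<open>Hs j\<close>, and a remainder of order
  \<open>h ^ (q + 1)\<close> in the ambient norm uses up all of \<open>Hs (q + 1)\<close>. The
  numerical solution has no bound in that space. So the local error is evaluated at points of the
  exact solution, and stability in the ambient norm carries it forward. Balls are not compact, so
  the expansions hold near one point at a time; compactness of the time interval collects them. The
  weights \<open>\<gamma> m\<close> may be negative, and then the sum of their absolute values
  exceeds the sum of the weights: Lipschitz constants \<open>exp (\<kappa> * h)\<close> of the
  single terms do not pass to the combination. Hence the comparison with the semigroup, whose copies
  recombine to exactly one. Compatibility differentiates in \<open>u\<close> first and in time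
  afterwards, with separate witnesses at every level. From this one family of vector fields with a
  chain rule has to be made; higher time derivatives then come from the chain rule along the
  flow.\<close>

locale scale_of_spaces =
  fixes Hs :: "nat \<Rightarrow> 'a::real_inner set" and ip :: "nat \<Rightarrow> 'a \<Rightarrow> 'a \<Rightarrow> real"
  assumes scale: "hilbert_scale Hs ip"
begin

abbreviation N :: "nat \<Rightarrow> 'a \<Rightarrow> real" where
  "N k \<equiv> nrm (ip k)"

lemma hilbert: "hilbert_space_on (Hs k) (ip k)"
  using scale by (auto simp: hilbert_scale_def)

lemma subspace_Hs: "subspace (Hs k)"
  using hilbert[of k] by (auto simp: hilbert_space_on_def)

lemma Hs_simps [simp]:
  "0 \<in> Hs k"
  "u \<in> Hs k \<Longrightarrow> v \<in> Hs k \<Longrightarrow> u + v \<in> Hs k"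
  "u \<in> Hs k \<Longrightarrow> v \<in> Hs k \<Longrightarrow> u - v \<in> Hs k"
  "u \<in> Hs k \<Longrightarrow> c *\<^sub>R u \<in> Hs k"
  using subspace_Hs[of k] by (auto simp: subspace_0 subspace_add subspace_diff subspace_scale)

lemma Hs_0 [simp]: "Hs 0 = UNIV"
  using scale by (auto simp: hilbert_scale_def)

lemma N_0 [simp]: "N 0 u = norm u"
  using scale by (auto simp: hilbert_scale_def nrm_def norm_eq_sqrt_inner)

lemma Hs_antimono: "k \<le> l \<Longrightarrow> Hs l \<subseteq> Hs k"
  by (rule lift_Suc_antimono_le[of Hs]) (use scale in \<open>auto simp: hilbert_scale_def\<close>)

lemma N_mono:
  assumes "k \<le> l"
  obtains K where "K \<ge> 0" "\<And>u. u \<in> Hs l \<Longrightarrow> N k u \<le> K * N l u"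
proof -
  have "\<exists>K\<ge>0. \<forall>u\<in>Hs l. N k u \<le> K * N l u" using assms
  proof (induction l rule: dec_induct)
    case base
    then show ?case by (intro exI[of _ 1]) auto
  next
    case (step l)
    then obtain K where K: "K \<ge> 0" "\<forall>u\<in>Hs l. N k u \<le> K * N l u" by blast
    obtain K' where K': "\<forall>u\<in>Hs (Suc l). N l u \<le> K' * N (Suc l) u"
      using scale unfolding hilbert_scale_def by blast
    \<comment> \<open>The constant in the definition of a scale has no sign, so its absolute value
      is used.\<close>
    have "N k u \<le> (K * \<bar>K'\<bar>) * N (Suc l) u" if "u \<in> Hs (Suc l)" for u
    proof -
      interpret M: Metric_space "Hs (Suc l)" "nrm_dist (Hs (Suc l)) (ip (Suc l))"
        by (rule Metric_space_nrm_dist[OF hilbert])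
      have nn: "0 \<le> N (Suc l) u"
        using M.nonneg[of u 0] that by (simp add: nrm_dist_def)
      have "N l u \<le> \<bar>K'\<bar> * N (Suc l) u"
        using K' that nn by (meson abs_ge_self mult_right_mono order_trans)
      moreover have "u \<in> Hs l" using that Hs_antimono[of l "Suc l"] by auto
      ultimately show ?thesis using K by (smt (verit) mult.assoc mult_left_mono)
    qed
    then show ?case using K(1) by (intro exI[of _ "K * \<bar>K'\<bar>"]) auto
  qed
  then show ?thesis using that by blast
qed

section \<open>Inner product and norm of a single level\<close>

lemma ip_commute: "u \<in> Hs k \<Longrightarrow> v \<in> Hs k \<Longrightarrow> ip k u v = ip k v u"
  using hilbert[of k] by (auto simp: hilbert_space_on_def)

lemma ip_lin:
  "u \<in> Hs k \<Longrightarrow> v \<in> Hs k \<Longrightarrow> w \<in> Hs k \<Longrightarrow>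
    ip k (a *\<^sub>R u + b *\<^sub>R v) w = a * ip k u w + b * ip k v w"
  using hilbert[of k] by (auto simp: hilbert_space_on_def)

lemma ip_add: "u \<in> Hs k \<Longrightarrow> v \<in> Hs k \<Longrightarrow> w \<in> Hs k \<Longrightarrow> ip k (u + v) w = ip k u w + ip k v w"
  using ip_lin[of u k v w 1 1] by simp

lemma ip_scale: "u \<in> Hs k \<Longrightarrow> w \<in> Hs k \<Longrightarrow> ip k (a *\<^sub>R u) w = a * ip k u w"
  using ip_lin[of u k 0 w a 0] by simp

lemma ip_diff: "u \<in> Hs k \<Longrightarrow> v \<in> Hs k \<Longrightarrow> w \<in> Hs k \<Longrightarrow> ip k (u - v) w = ip k u w - ip k v w"
  using ip_lin[of u k v w 1 "-1"] by simp

lemma ip_nonneg: "u \<in> Hs k \<Longrightarrow> 0 \<le> ip k u u"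
  using hilbert[of k] ip_scale[of 0 k 0 0]
  by (cases "u = 0") (auto simp: hilbert_space_on_def dest!: less_imp_le)

lemma N_nonneg [simp]: "u \<in> Hs k \<Longrightarrow> 0 \<le> N k u"
  by (simp add: nrm_def ip_nonneg)

lemma N_zero [simp]: "N k 0 = 0"
  using ip_scale[of 0 k 0 0] by (simp add: nrm_def)

lemma N_sq: "u \<in> Hs k \<Longrightarrow> (N k u)\<^sup>2 = ip k u u"
  by (simp add: nrm_def ip_nonneg)

lemma N_scale: assumes "u \<in> Hs k" shows "N k (c *\<^sub>R u) = \<bar>c\<bar> * N k u"
proof -
  have "ip k (c *\<^sub>R u) (c *\<^sub>R u) = c\<^sup>2 * ip k u u"
    using assms ip_scale[of u k "c *\<^sub>R u" c] ip_commute[of u k "c *\<^sub>R u"] ip_scale[of u k u c]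
    by (simp add: power2_eq_square)
  then show ?thesis by (simp add: nrm_def real_sqrt_mult)
qed

lemma N_minus: "u \<in> Hs k \<Longrightarrow> v \<in> Hs k \<Longrightarrow> N k (u - v) = N k (v - u)"
  using N_scale[of "v - u" k "-1"] by simp

lemma N_triangle:
  assumes "u \<in> Hs k" "v \<in> Hs k"
  shows "N k (u + v) \<le> N k u + N k v"
proof -
  interpret M: Metric_space "Hs k" "nrm_dist (Hs k) (ip k)"
    by (rule Metric_space_nrm_dist[OF hilbert])
  have m: "- v \<in> Hs k" using assms(2) Hs_simps(3)[of 0 k v] by simp
  show ?thesis
    using M.triangle[of u 0 "- v"] assms m by (simp add: nrm_dist_def)
qed

text \<open>Here the inequality comes out of the triangle inequality, which the metric of the level
  already supplies: expand the square of \<open>N k (u + v)\<close>.\<close>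

lemma cauchy_schwarz:
  assumes "u \<in> Hs k" "v \<in> Hs k"
  shows "ip k u v \<le> N k u * N k v"
proof -
  have uv: "u + v \<in> Hs k" using assms by simp
  have "ip k (u + v) (u + v) = ip k u u + 2 * ip k u v + ip k v v"
    using ip_add[OF assms uv] ip_add[OF assms assms(1)] ip_add[OF assms assms(2)]
      ip_commute[OF uv assms(1)] ip_commute[OF uv assms(2)] ip_commute[OF assms] by simp
  moreover have "(N k (u + v))\<^sup>2 \<le> (N k u + N k v)\<^sup>2"
    using N_triangle[OF assms] uv by (intro power_mono) auto
  ultimately show ?thesis
    using assms uv by (simp add: N_sq power2_sum)
qed

lemma abs_ip_le: "u \<in> Hs k \<Longrightarrow> v \<in> Hs k \<Longrightarrow> \<bar>ip k u v\<bar> \<le> N k u * N k v"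
  using cauchy_schwarz[of u k v] cauchy_schwarz[of "- u" k v] ip_scale[of u k v "-1"]
    N_scale[of u k "-1"] Hs_simps(4)[of u k "-1"] by (simp add: abs_le_iff)

section \<open>Convergence and differentiation in the norm of a level\<close>

definition cv :: "nat \<Rightarrow> ('b \<Rightarrow> 'a) \<Rightarrow> 'a \<Rightarrow> 'b filter \<Rightarrow> bool" where
  "cv k f l F \<longleftrightarrow> l \<in> Hs k \<and> (\<forall>\<^sub>F x in F. f x \<in> Hs k) \<and> ((\<lambda>x. N k (f x - l)) \<longlongrightarrow> 0) F"

lemma topspace_norm_topology [simp]: "topspace (norm_topology (Hs k) (ip k)) = Hs k"
proof -
  interpret M: Metric_space "Hs k" "nrm_dist (Hs k) (ip k)"
    by (rule Metric_space_nrm_dist[OF hilbert])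
  show ?thesis by (simp add: norm_topology_def)
qed

text \<open>\<open>cv\<close> unfolds convergence in the topology of a level into a statement about
  \<open>N k\<close>. Membership of the values is required only eventually, as in
  \<open>limitin\<close>, and is kept explicit because \<open>ip k\<close> carries no information
  off \<open>Hs k\<close>.\<close>

lemma limitin_iff_cv: "limitin (norm_topology (Hs k) (ip k)) f l F \<longleftrightarrow> cv k f l F"
proof -
  interpret M: Metric_space "Hs k" "nrm_dist (Hs k) (ip k)"
    by (rule Metric_space_nrm_dist[OF hilbert])
  have "limitin M.mtopology f l F \<longleftrightarrow>
     l \<in> Hs k \<and> (\<forall>e>0. \<forall>\<^sub>F x in F. f x \<in> Hs k \<and> nrm_dist (Hs k) (ip k) (f x) l < e)"
    by (rule M.limitin_metric)
  also have "\<dots> \<longleftrightarrow> l \<in> Hs k \<and> (\<forall>e>0. \<forall>\<^sub>F x in F. f x \<in> Hs k \<and> N k (f x - l) < e)"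
    by (intro conj_cong refl all_cong1 imp_cong iffI; erule eventually_mono; auto simp: nrm_dist_def)
  also have "\<dots> \<longleftrightarrow> cv k f l F"
  proof (cases "l \<in> Hs k")
    case True
    have "(\<forall>e>0. \<forall>\<^sub>F x in F. f x \<in> Hs k \<and> N k (f x - l) < e) \<longleftrightarrow>
          (\<forall>\<^sub>F x in F. f x \<in> Hs k) \<and> (\<forall>e>0. \<forall>\<^sub>F x in F. N k (f x - l) < e)"
      by (auto simp: eventually_conj_iff intro: exI[of _ 1] zero_less_one)
    also have "\<dots> \<longleftrightarrow> (\<forall>\<^sub>F x in F. f x \<in> Hs k) \<and> (\<forall>e>0. \<forall>\<^sub>F x in F. \<bar>N k (f x - l)\<bar> < e)"
    proof (intro conj_cong refl all_cong1 imp_cong)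
      fix e :: real assume ev: "\<forall>\<^sub>F x in F. f x \<in> Hs k"
      show "(\<forall>\<^sub>F x in F. N k (f x - l) < e) = (\<forall>\<^sub>F x in F. \<bar>N k (f x - l)\<bar> < e)"
        by (rule eventually_cong, rule ev) (use True in auto)
    qed
    finally show ?thesis using True by (simp add: cv_def tendsto_iff)
  qed (auto simp: cv_def)
  finally show ?thesis by (simp add: norm_topology_def)
qed

lemma cv_in: "cv k f l F \<Longrightarrow> l \<in> Hs k" and cv_ev_in: "cv k f l F \<Longrightarrow> \<forall>\<^sub>F x in F. f x \<in> Hs k"
  by (auto simp: cv_def)

lemma cv_0: "cv 0 f l F \<longleftrightarrow> (f \<longlongrightarrow> l) F"
  by (simp add: cv_def) (metis tendsto_norm_zero_iff LIM_zero_iff)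

lemma cv_const [simp]: "cv k (\<lambda>x. l) l F \<longleftrightarrow> l \<in> Hs k"
  by (auto simp: cv_def)

lemma cv_bound:
  assumes "l \<in> Hs k" "\<forall>\<^sub>F x in F. f x \<in> Hs k \<and> N k (f x - l) \<le> g x" "(g \<longlongrightarrow> 0) F"
  shows "cv k f l F"
  unfolding cv_def
proof (intro conjI)
  show "\<forall>\<^sub>F x in F. f x \<in> Hs k" using assms(2) by (rule eventually_mono) simp
  have "\<forall>\<^sub>F x in F. norm (N k (f x - l)) \<le> g x"
    using assms(2) by (rule eventually_mono) (use assms(1) in simp)
  then show "((\<lambda>x. N k (f x - l)) \<longlongrightarrow> 0) F" using assms(3) by (rule Lim_null_comparison)
qed (use assms in auto)

lemma cv_add:
  assumes "cv k f l F" "cv k g m F"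
  shows "cv k (\<lambda>x. f x + g x) (l + m) F"
proof (rule cv_bound)
  have "\<forall>\<^sub>F x in F. f x \<in> Hs k \<and> g x \<in> Hs k" using assms by (auto simp: cv_def eventually_conj_iff)
  then show "\<forall>\<^sub>F x in F. f x + g x \<in> Hs k \<and>
      N k (f x + g x - (l + m)) \<le> N k (f x - l) + N k (g x - m)"
  proof (rule eventually_mono)
    fix x assume "f x \<in> Hs k \<and> g x \<in> Hs k"
    then show "f x + g x \<in> Hs k \<and> N k (f x + g x - (l + m)) \<le> N k (f x - l) + N k (g x - m)"
      using N_triangle[of "f x - l" k "g x - m"] assms by (auto simp: cv_def algebra_simps)
  qed
  show "((\<lambda>x. N k (f x - l) + N k (g x - m)) \<longlongrightarrow> 0) F"
    using assms by (auto simp: cv_def intro: tendsto_add_zero)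
qed (use assms in \<open>auto simp: cv_def\<close>)

lemma cv_scaleR:
  assumes "cv k f l F" "(c \<longlongrightarrow> d) F"
  shows "cv k (\<lambda>x. c x *\<^sub>R f x) (d *\<^sub>R l) F"
proof (rule cv_bound)
  show "\<forall>\<^sub>F x in F. c x *\<^sub>R f x \<in> Hs k \<and>
      N k (c x *\<^sub>R f x - d *\<^sub>R l) \<le> \<bar>c x\<bar> * N k (f x - l) + \<bar>c x - d\<bar> * N k l"
    using cv_ev_in[OF assms(1)]
  proof (rule eventually_mono)
    fix x assume x: "f x \<in> Hs k"
    have "N k (c x *\<^sub>R (f x - l) + (c x - d) *\<^sub>R l) \<le> \<bar>c x\<bar> * N k (f x - l) + \<bar>c x - d\<bar> * N k l"
      using x cv_in[OF assms(1)] N_triangle[of "c x *\<^sub>R (f x - l)" k "(c x - d) *\<^sub>R l"]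
      by (simp add: N_scale)
    then show "c x *\<^sub>R f x \<in> Hs k \<and>
       N k (c x *\<^sub>R f x - d *\<^sub>R l) \<le> \<bar>c x\<bar> * N k (f x - l) + \<bar>c x - d\<bar> * N k l"
      using x by (simp add: algebra_simps)
  qed
  have "((\<lambda>x. \<bar>c x\<bar> * N k (f x - l) + \<bar>c x - d\<bar> * N k l) \<longlongrightarrow> \<bar>d\<bar> * 0 + \<bar>d - d\<bar> * N k l) F"
    using assms by (intro tendsto_intros) (auto simp: cv_def)
  then show "((\<lambda>x. \<bar>c x\<bar> * N k (f x - l) + \<bar>c x - d\<bar> * N k l) \<longlongrightarrow> 0) F" by simp
qed (use assms in \<open>auto simp: cv_def\<close>)

lemma cv_diff: "cv k f l F \<Longrightarrow> cv k g m F \<Longrightarrow> cv k (\<lambda>x. f x - g x) (l - m) F"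
  using cv_add[of k f l F "\<lambda>x. (-1) *\<^sub>R g x" "(-1) *\<^sub>R m"] cv_scaleR[of k g m F "\<lambda>_. -1" "-1"] by simp

lemma cv_mono:
  assumes "k \<le> l" "cv l f m F" shows "cv k f m F"
proof -
  obtain K where K: "\<And>u. u \<in> Hs l \<Longrightarrow> N k u \<le> K * N l u" using N_mono[OF assms(1)] by metis
  have *: "\<forall>\<^sub>F x in F. f x \<in> Hs k \<and> N k (f x - m) \<le> K * N l (f x - m)"
    using cv_ev_in[OF assms(2)]
    by (rule eventually_mono) (use K cv_in[OF assms(2)] Hs_antimono[OF assms(1)] in auto)
  show ?thesis
    by (rule cv_bound[OF _ *])
      (use assms cv_in[OF assms(2)] Hs_antimono[OF assms(1)] in \<open>auto simp: cv_def intro: tendsto_mult_right_zero\<close>)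
qed

lemma cv_tendsto: "cv k f l F \<Longrightarrow> (f \<longlongrightarrow> l) F"
  using cv_mono[of 0 k f l F] by (simp add: cv_0)

text \<open>Both limits also hold in the ambient norm, so a limit does not depend on the level at
  which it is taken. This is what lets derivatives computed at different levels be
  identified.\<close>

lemma cv_unique: "cv k f l F \<Longrightarrow> cv j f m F \<Longrightarrow> F \<noteq> bot \<Longrightarrow> l = m"
  using cv_tendsto tendsto_unique by metis

lemma cv_cong: "\<forall>\<^sub>F x in F. f x = g x \<Longrightarrow> cv k f l F \<longleftrightarrow> cv k g l F"
  unfolding cv_def
  by (intro conj_cong refl eventually_cong tendsto_cong) (auto elim: eventually_mono)

lemma cv_compose: "cv k f l F \<Longrightarrow> filterlim g F G \<Longrightarrow> cv k (\<lambda>x. f (g x)) l G"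
  unfolding cv_def filterlim_iff by (auto simp: eventually_filtermap)

lemma cv_filter_mono: "cv k f l F \<Longrightarrow> G \<le> F \<Longrightarrow> cv k f l G"
  unfolding cv_def by (auto elim: filter_leD intro: tendsto_mono)

lemma cv_ip:
  assumes "cv k f l F" "z \<in> Hs k"
  shows "((\<lambda>x. ip k (f x) z) \<longlongrightarrow> ip k l z) F"
proof -
  have "((\<lambda>x. ip k (f x) z - ip k l z) \<longlongrightarrow> 0) F"
  proof (rule Lim_null_comparison)
    show "\<forall>\<^sub>F x in F. norm (ip k (f x) z - ip k l z) \<le> N k (f x - l) * N k z"
      using cv_ev_in[OF assms(1)]
    proof (rule eventually_mono)
      fix x assume "f x \<in> Hs k"
      then show "norm (ip k (f x) z - ip k l z) \<le> N k (f x - l) * N k z"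
        using abs_ip_le[of "f x - l" k z] ip_diff[of "f x" k l z] assms(2) cv_in[OF assms(1)] by simp
    qed
    show "((\<lambda>x. N k (f x - l) * N k z) \<longlongrightarrow> 0) F"
      using assms by (auto simp: cv_def intro: tendsto_mult_left_zero)
  qed
  then show ?thesis using LIM_zero_iff by blast
qed

definition der :: "nat \<Rightarrow> (real \<Rightarrow> 'a) \<Rightarrow> 'a \<Rightarrow> real \<Rightarrow> real set \<Rightarrow> bool" where
  "der k g g' t I \<longleftrightarrow> cv k (\<lambda>s. (g s - g t) /\<^sub>R (s - t)) g' (at t within I)"

text \<open>Apply the real mean value theorem to the pairing of \<open>g\<close> with its own increment.\<close>

lemma mean_value:
  assumes "a < b" and g: "\<And>t. t \<in> {a..b} \<Longrightarrow> g t \<in> Hs k"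
    and d: "\<And>t. t \<in> {a..b} \<Longrightarrow> der k g (g' t) t {a..b}" and X: "X \<in> Hs k"
  obtains \<xi> where "a < \<xi>" "\<xi> < b"
    "N k (g b - g a - (b - a) *\<^sub>R X) \<le> (b - a) * N k (g' \<xi> - X)"
proof -
  \<comment> \<open>The multiple of \<open>X\<close> is subtracted so that the bound measures how
    far \<open>g'\<close> is from a prescribed value, which is what limits of difference quotients
    require.\<close>
  define z where "z = g b - g a - (b - a) *\<^sub>R X"
  have z: "z \<in> Hs k" using g X \<open>a < b\<close> by (simp add: z_def)
  define p where "p t = ip k (g t - t *\<^sub>R X) z" for t
  have p': "(p has_real_derivative ip k (g' t - X) z) (at t within {a..b})" if t: "t \<in> {a..b}" for t
    unfolding has_field_derivative_iff
  proof (rule Lim_transform_eventually)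
    show "((\<lambda>s. ip k ((g s - g t) /\<^sub>R (s - t) - X) z) \<longlongrightarrow> ip k (g' t - X) z) (at t within {a..b})"
      using d[OF t] X z by (intro cv_ip cv_diff) (auto simp: der_def)
    show "\<forall>\<^sub>F s in at t within {a..b}. ip k ((g s - g t) /\<^sub>R (s - t) - X) z = (p s - p t) / (s - t)"
      unfolding eventually_at_filter
    proof (rule always_eventually, intro allI impI)
      fix s assume s: "s \<noteq> t" "s \<in> {a..b}"
      have "(1 / (s - t)) *\<^sub>R ((g s - s *\<^sub>R X) - (g t - t *\<^sub>R X)) =
          (1 / (s - t)) *\<^sub>R ((g s - g t) - (s - t) *\<^sub>R X)"
        by (simp add: algebra_simps)
      also have "\<dots> = (g s - g t) /\<^sub>R (s - t) - X"
        by (subst scaleR_right_diff_distrib) (use s in \<open>simp add: divide_inverse\<close>)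
      finally have "(g s - g t) /\<^sub>R (s - t) - X = (1 / (s - t)) *\<^sub>R ((g s - s *\<^sub>R X) - (g t - t *\<^sub>R X))"
        by simp
      then show "ip k ((g s - g t) /\<^sub>R (s - t) - X) z = (p s - p t) / (s - t)"
        using g[OF s(2)] g[OF t] X z by (simp add: p_def ip_scale ip_diff)
    qed
  qed
  have "continuous_on {a..b} p"
    unfolding continuous_on_eq_continuous_within by (blast intro: DERIV_continuous p')
  moreover have "(p has_derivative (\<lambda>h. h * ip k (g' t - X) z)) (at t)" if "a < t" "t < b" for t
    using p'[of t] that by (simp add: at_within_Icc_at has_field_derivative_def mult.commute[of _ "ip k (g' t - X) z"])
  ultimately obtain \<xi> where \<xi>: "a < \<xi>" "\<xi> < b" "p b - p a = (b - a) * ip k (g' \<xi> - X) z"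
    using mvt[OF \<open>a < b\<close>, of p "\<lambda>t h. h * ip k (g' t - X) z"] by metis
  have g'\<xi>: "g' \<xi> \<in> Hs k" using d[of \<xi>] \<xi> by (auto simp: der_def cv_def)
  have "p b - p a = ip k z z"
    using g X z \<open>a < b\<close> ip_diff[of "g b - b *\<^sub>R X" k "g a - a *\<^sub>R X" z]
    by (simp add: p_def z_def algebra_simps)
  then have "(N k z)\<^sup>2 \<le> (b - a) * N k (g' \<xi> - X) * N k z"
    using \<xi>(3) mult_left_mono[OF cauchy_schwarz[of "g' \<xi> - X" k z], of "b - a"] z g'\<xi> X \<open>a < b\<close>
    by (simp add: N_sq mult.assoc)
  then have "N k z \<le> (b - a) * N k (g' \<xi> - X)"
    using z g'\<xi> X \<open>a < b\<close> N_nonneg[OF z]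
    by (cases "N k z = 0") (auto simp: power2_eq_square dest: mult_right_le_imp_le)
  then show ?thesis using that \<xi> by (simp add: z_def)
qed

section \<open>Vector fields on the scale\<close>

abbreviation X :: "nat \<Rightarrow> 'a topology" where
  "X k \<equiv> norm_topology (Hs k) (ip k)"

lemma cv_N:
  assumes "cv k f l F" shows "((\<lambda>x. N k (f x)) \<longlongrightarrow> N k l) F"
proof -
  have "((\<lambda>x. N k (f x) - N k l) \<longlongrightarrow> 0) F"
  proof (rule Lim_null_comparison)
    show "\<forall>\<^sub>F x in F. norm (N k (f x) - N k l) \<le> N k (f x - l)"
      using cv_ev_in[OF assms]
    proof (rule eventually_mono)
      fix x assume x: "f x \<in> Hs k"
      have l: "l \<in> Hs k" using assms by (rule cv_in)
      show "norm (N k (f x) - N k l) \<le> N k (f x - l)"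
        using N_triangle[of "f x - l" k l] N_triangle[of "l - f x" k "f x"] N_minus[OF x l] x l
        by simp
    qed
  qed (use assms in \<open>simp add: cv_def\<close>)
  then show ?thesis using LIM_zero_iff by blast
qed

lemma cv_list:
  assumes "list_all2 (\<lambda>f v. cv k f v F) fs vs" "length vs = i"
  shows "limitin (product_topology (\<lambda>_. X k) {..<i})
           (\<lambda>x. \<lambda>j\<in>{..<i}. (fs ! j) x) (\<lambda>j\<in>{..<i}. vs ! j) F"
proof -
  have c: "cv k (fs ! j) (vs ! j) F" if "j < i" for j
    using assms that by (auto simp: list_all2_conv_all_nth)
  then have "\<forall>\<^sub>F x in F. \<forall>j\<in>{..<i}. (fs ! j) x \<in> Hs k"
    by (intro eventually_ball_finite) (auto intro: cv_ev_in)
  then have "\<forall>\<^sub>F x in F. (\<lambda>j\<in>{..<i}. (fs ! j) x) \<in> topspace (product_topology (\<lambda>_. X k) {..<i})"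
    by (rule eventually_mono) auto
  then show ?thesis
    unfolding limitin_componentwise using c by (auto simp: limitin_iff_cv)
qed

lemma map_nth_restrict: "length vs = i \<Longrightarrow> map (\<lambda>j\<in>{..<i}. vs ! j) [0..<i] = vs"
  by (auto intro: nth_equalityI)

lemma map_nth_restrict_fun:
  "length fs = i \<Longrightarrow> map (\<lambda>j\<in>{..<i}. (fs ! j) x) [0..<i] = map (\<lambda>f. f x) fs"
  by (auto intro: nth_equalityI)

lemma limitin_subtopology_cv:
  assumes "cv k c u F" "u \<in> V" "open V"
  shows "limitin (subtopology (X k) (V \<inter> Hs k)) c u F"
proof -
  have "\<forall>\<^sub>F x in F. c x \<in> V" using cv_tendsto[OF assms(1)] assms(2,3) by (simp add: topological_tendstoD)
  then show ?thesis
    using assms cv_ev_in[OF assms(1)] cv_in[OF assms(1)]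
    by (auto simp: limitin_subtopology limitin_iff_cv eventually_conj_iff)
qed

text \<open>\<open>B u vs\<close> stands for the iterated derivative of the field
  \<open>B u []\<close> at \<open>u\<close> in the directions \<open>vs\<close>, the newest
  direction at the head. One level is lost, as with an unbounded operator. Directional derivatives
  that are jointly continuous take the place of Frechet derivatives.\<close>

definition vector_field :: "'a set \<Rightarrow> ('a \<Rightarrow> 'a list \<Rightarrow> 'a) \<Rightarrow> bool" where
  "vector_field V B \<longleftrightarrow>
     (\<forall>l i. continuous_map
        (prod_topology (subtopology (X (Suc l)) (V \<inter> Hs (Suc l))) (product_topology (\<lambda>_. X (Suc l)) {..<i}))
        (X l) (\<lambda>(u, v). B u (map v [0..<i]))) \<and>
     (\<forall>l. \<forall>u\<in>V \<inter> Hs (Suc l). \<forall>v\<in>Hs (Suc l). \<forall>vs\<in>lists (Hs (Suc l)).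
        cv l (\<lambda>r. (B (u + r *\<^sub>R v) vs - B u vs) /\<^sub>R r) (B u (v # vs)) (at 0))"

lemma vector_field_cont:
  assumes "vector_field V B" "open V" "u \<in> V" "cv (Suc l) c u F"
    and "list_all2 (\<lambda>f v. cv (Suc l) f v F) fs vs"
  shows "cv l (\<lambda>x. B (c x) (map (\<lambda>f. f x) fs)) (B u vs) F"
proof -
  define i where "i = length vs"
  have len: "length fs = i" using assms(5) by (auto simp: i_def dest: list_all2_lengthD)
  have "limitin (X l) ((\<lambda>(u, v). B u (map v [0..<i])) \<circ> (\<lambda>x. (c x, \<lambda>j\<in>{..<i}. (fs ! j) x)))
      ((\<lambda>(u, v). B u (map v [0..<i])) (u, \<lambda>j\<in>{..<i}. vs ! j)) F"
  proof (rule continuous_map_limit)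
    show "continuous_map
        (prod_topology (subtopology (X (Suc l)) (V \<inter> Hs (Suc l))) (product_topology (\<lambda>_. X (Suc l)) {..<i}))
        (X l) (\<lambda>(u, v). B u (map v [0..<i]))"
      using assms(1) by (simp add: vector_field_def)
    show "limitin (prod_topology (subtopology (X (Suc l)) (V \<inter> Hs (Suc l)))
        (product_topology (\<lambda>_. X (Suc l)) {..<i}))
        (\<lambda>x. (c x, \<lambda>j\<in>{..<i}. (fs ! j) x)) (u, \<lambda>j\<in>{..<i}. vs ! j) F"
      using limitin_subtopology_cv[OF assms(4,3,2)] cv_list[OF assms(5), of i]
      by (simp add: limitin_pairwise o_def i_def)
  qed
  then show ?thesis
    using map_nth_restrict_fun[OF len] map_nth_restrict[of vs i] by (simp add: o_def limitin_iff_cv i_def)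
qed

lemma list_all2_cv_const:
  assumes "set vs \<subseteq> Hs k" shows "list_all2 (\<lambda>f v. cv k f v F) (map (\<lambda>v _. v) vs) vs"
  using assms by (auto simp: list_all2_conv_all_nth)

lemma vector_field_in:
  assumes "vector_field V B" "open V" "u \<in> V \<inter> Hs (Suc l)" "set vs \<subseteq> Hs (Suc l)"
  shows "B u vs \<in> Hs l"
proof (rule cv_in)
  \<comment> \<open>Over \<open>bot\<close> the limit conditions are vacuous, and \<open>cv\<close>
    retains just the membership of the limit.\<close>
  show "cv l (\<lambda>x::unit. B u (map (\<lambda>f. f x) (map (\<lambda>v _. v) vs))) (B u vs) bot"
    using assms by (intro vector_field_cont[OF assms(1,2)] list_all2_cv_const) auto
qed

lemma filterlim_affine:
  fixes \<rho> \<tau> :: real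
  assumes "\<tau> \<noteq> 0"
  shows "filterlim (\<lambda>s. (s - \<rho>) * \<tau>) (at 0) (at \<rho> within S)"
  unfolding filterlim_at
proof
  show "\<forall>\<^sub>F s in at \<rho> within S. (s - \<rho>) * \<tau> \<in> UNIV \<and> (s - \<rho>) * \<tau> \<noteq> 0"
    using assms by (auto simp: eventually_at_filter)
  have "((\<lambda>s. (s - \<rho>) * \<tau>) \<longlongrightarrow> (\<rho> - \<rho>) * \<tau>) (at \<rho> within S)" by (intro tendsto_intros)
  then show "((\<lambda>s. (s - \<rho>) * \<tau>) \<longlongrightarrow> 0) (at \<rho> within S)" by simp
qed

lemma der_line:
  assumes "cv k (\<lambda>r. (f (p + (\<rho> * \<tau> + r) *\<^sub>R v) - f (p + (\<rho> * \<tau>) *\<^sub>R v)) /\<^sub>R r) d (at 0)" "\<tau> \<noteq> 0"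
  shows "der k (\<lambda>\<rho>. f (p + (\<rho> * \<tau>) *\<^sub>R v)) (\<tau> *\<^sub>R d) \<rho> S"
proof -
  have "cv k (\<lambda>s. \<tau> *\<^sub>R ((f (p + (\<rho> * \<tau> + (s - \<rho>) * \<tau>) *\<^sub>R v) - f (p + (\<rho> * \<tau>) *\<^sub>R v)) /\<^sub>R ((s - \<rho>) * \<tau>)))
     (\<tau> *\<^sub>R d) (at \<rho> within S)"
    by (intro cv_scaleR tendsto_const cv_compose[OF assms(1)] filterlim_affine assms(2))
  then show ?thesis unfolding der_def
  proof (rule cv_cong[THEN iffD1, rotated])
    have "\<tau> *\<^sub>R ((f (p + (\<rho> * \<tau> + (s - \<rho>) * \<tau>) *\<^sub>R v) - f (p + (\<rho> * \<tau>) *\<^sub>R v)) /\<^sub>R ((s - \<rho>) * \<tau>)) =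
        (f (p + (s * \<tau>) *\<^sub>R v) - f (p + (\<rho> * \<tau>) *\<^sub>R v)) /\<^sub>R (s - \<rho>)" for s
    proof -
      have "\<rho> * \<tau> + (s - \<rho>) * \<tau> = s * \<tau>" by (simp add: algebra_simps)
      then show ?thesis using assms(2) by simp
    qed
    then show "\<forall>\<^sub>F s in at \<rho> within S.
        \<tau> *\<^sub>R ((f (p + (\<rho> * \<tau> + (s - \<rho>) * \<tau>) *\<^sub>R v) - f (p + (\<rho> * \<tau>) *\<^sub>R v)) /\<^sub>R ((s - \<rho>) * \<tau>)) =
        (f (p + (s * \<tau>) *\<^sub>R v) - f (p + (\<rho> * \<tau>) *\<^sub>R v)) /\<^sub>R (s - \<rho>)"
      by simp
  qed
qed

text \<open>Base point, direction, step and the other arguments may all vary along the filter. The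
  mean value inequality on the segment reduces the quotient to the next derivative at an
  intermediate point, and joint continuity gives its limit.\<close>

lemma vector_field_quotient:
  assumes B: "vector_field V B" and V: "open V" "convex V" and u: "u \<in> V"
    and c: "cv (Suc l) c u F" and \<tau>: "(\<tau> \<longlongrightarrow> 0) F" "\<forall>\<^sub>F x in F. \<tau> x \<noteq> 0"
    and w: "cv (Suc l) w v F" and fs: "list_all2 (\<lambda>f v. cv (Suc l) f v F) fs vs"
  shows "cv l (\<lambda>x. (B (c x + \<tau> x *\<^sub>R w x) (map (\<lambda>f. f x) fs) - B (c x) (map (\<lambda>f. f x) fs)) /\<^sub>R \<tau> x)
           (B u (v # vs)) F"
proof -
  define L where "L = B u (v # vs)"
  let ?fs = "\<lambda>x. map (\<lambda>f. f x) fs"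
  have L: "L \<in> Hs l"
    unfolding L_def
  proof (rule vector_field_in[OF B V(1)])
    show "u \<in> V \<inter> Hs (Suc l)" using u cv_in[OF c] by simp
    show "set (v # vs) \<subseteq> Hs (Suc l)"
      using cv_in[OF w] list_all2_nthD2[OF fs] cv_in by (fastforce simp: in_set_conv_nth)
  qed
  define good where "good x \<longleftrightarrow> c x \<in> V \<inter> Hs (Suc l) \<and> c x + \<tau> x *\<^sub>R w x \<in> V \<and> w x \<in> Hs (Suc l) \<and>
     ?fs x \<in> lists (Hs (Suc l)) \<and> \<tau> x \<noteq> 0" for x
  have "cv (Suc l) (\<lambda>x. c x + \<tau> x *\<^sub>R w x) (u + 0 *\<^sub>R v) F" by (intro cv_add cv_scaleR c \<tau> w)
  then have "((\<lambda>x. c x + \<tau> x *\<^sub>R w x) \<longlongrightarrow> u) F" using cv_tendsto by fastforce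
  then have "\<forall>\<^sub>F x in F. c x + \<tau> x *\<^sub>R w x \<in> V" using u V by (simp add: topological_tendstoD)
  moreover have "\<forall>\<^sub>F x in F. c x \<in> V" using cv_tendsto[OF c] u V by (simp add: topological_tendstoD)
  moreover have "\<forall>\<^sub>F x in F. \<forall>j\<in>{..<length fs}. (fs ! j) x \<in> Hs (Suc l)"
    using fs by (intro eventually_ball_finite) (auto simp: list_all2_conv_all_nth intro: cv_ev_in)
  ultimately have good: "\<forall>\<^sub>F x in F. good x"
    using cv_ev_in[OF c] cv_ev_in[OF w] \<tau>(2)
    by eventually_elim (auto simp: good_def in_set_conv_nth)
  \<comment> \<open>The intermediate parameter is provided for every \<open>x\<close>, with 0 where
    \<open>x\<close> is not good, so that it becomes a bounded function and
    \<open>\<xi> x * \<tau> x\<close> tends to 0.\<close>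
  have "\<exists>\<xi>. \<bar>\<xi>\<bar> \<le> 1 \<and> (good x \<longrightarrow> B (c x + \<tau> x *\<^sub>R w x) (?fs x) - B (c x) (?fs x) \<in> Hs l \<and>
      N l (B (c x + \<tau> x *\<^sub>R w x) (?fs x) - B (c x) (?fs x) - \<tau> x *\<^sub>R L)
        \<le> \<bar>\<tau> x\<bar> * N l (B (c x + (\<xi> * \<tau> x) *\<^sub>R w x) (w x # ?fs x) - L))" for x
  proof (cases "good x")
    case False
    then show ?thesis by (intro exI[of _ 0]) simp
  next
    case True
    define g where "g \<rho> = B (c x + (\<rho> * \<tau> x) *\<^sub>R w x) (?fs x)" for \<rho>
    define g' where "g' \<rho> = \<tau> x *\<^sub>R B (c x + (\<rho> * \<tau> x) *\<^sub>R w x) (w x # ?fs x)" for \<rho>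
    have V\<rho>: "c x + (\<rho> * \<tau> x) *\<^sub>R w x \<in> V \<inter> Hs (Suc l)" if "\<rho> \<in> {0..1}" for \<rho>
      using convexD[OF V(2), of "c x" "c x + \<tau> x *\<^sub>R w x" "1 - \<rho>" \<rho>] that True
      by (auto simp: good_def algebra_simps)
    have gin: "g \<rho> \<in> Hs l" if "\<rho> \<in> {0..1}" for \<rho>
      unfolding g_def using V\<rho>[OF that] True
      by (intro vector_field_in[OF B V(1)]) (auto simp: good_def in_lists_conv_set)
    have gin': "B (c x + (\<rho> * \<tau> x) *\<^sub>R w x) (w x # ?fs x) \<in> Hs l" if "\<rho> \<in> {0..1}" for \<rho>
      using V\<rho>[OF that] True
      by (intro vector_field_in[OF B V(1)]) (auto simp: good_def in_lists_conv_set)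
    obtain \<xi> where \<xi>: "0 < \<xi>" "\<xi> < 1" "N l (g 1 - g 0 - (1 - 0) *\<^sub>R \<tau> x *\<^sub>R L) \<le> (1 - 0) * N l (g' \<xi> - \<tau> x *\<^sub>R L)"
    proof (rule mean_value[of 0 1 g l g' "\<tau> x *\<^sub>R L"])
      fix \<rho> :: real assume \<rho>: "\<rho> \<in> {0..1}"
      have "cv l (\<lambda>r. (B ((c x + (\<rho> * \<tau> x) *\<^sub>R w x) + r *\<^sub>R w x) (?fs x) - B (c x + (\<rho> * \<tau> x) *\<^sub>R w x) (?fs x)) /\<^sub>R r)
          (B (c x + (\<rho> * \<tau> x) *\<^sub>R w x) (w x # ?fs x)) (at 0)"
        using B V\<rho>[OF \<rho>] True unfolding vector_field_def good_def by blast
      then show "der l g (g' \<rho>) \<rho> {0..1}"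
        unfolding g_def g'_def using True by (intro der_line) (auto simp: good_def algebra_simps)
    qed (use L gin in auto)
    have "g' \<xi> - \<tau> x *\<^sub>R L = \<tau> x *\<^sub>R (B (c x + (\<xi> * \<tau> x) *\<^sub>R w x) (w x # ?fs x) - L)"
      by (simp add: g'_def algebra_simps)
    then have "N l (g' \<xi> - \<tau> x *\<^sub>R L) = \<bar>\<tau> x\<bar> * N l (B (c x + (\<xi> * \<tau> x) *\<^sub>R w x) (w x # ?fs x) - L)"
      using gin'[of \<xi>] \<xi> L by (simp add: N_scale)
    then show ?thesis using \<xi> gin[of 1] gin[of 0] by (intro exI[of _ \<xi>]) (auto simp: g_def)
  qed
  then obtain \<xi> where \<xi>: "\<And>x. \<bar>\<xi> x\<bar> \<le> 1" and \<xi>2: "\<And>x. good x \<Longrightarrow> B (c x + \<tau> x *\<^sub>R w x) (?fs x) - B (c x) (?fs x) \<in> Hs l \<and>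
      N l (B (c x + \<tau> x *\<^sub>R w x) (?fs x) - B (c x) (?fs x) - \<tau> x *\<^sub>R L)
        \<le> \<bar>\<tau> x\<bar> * N l (B (c x + (\<xi> x * \<tau> x) *\<^sub>R w x) (w x # ?fs x) - L)"
    by metis
  have "((\<lambda>x. \<xi> x * \<tau> x) \<longlongrightarrow> 0) F"
  proof (rule Lim_null_comparison)
    show "\<forall>\<^sub>F x in F. norm (\<xi> x * \<tau> x) \<le> \<bar>\<tau> x\<bar>"
      using \<xi> by (auto simp: abs_mult mult_left_le_one_le)
    show "((\<lambda>x. \<bar>\<tau> x\<bar>) \<longlongrightarrow> 0) F" using \<tau>(1) by (rule tendsto_rabs_zero)
  qed
  then have "cv (Suc l) (\<lambda>x. c x + (\<xi> x * \<tau> x) *\<^sub>R w x) (u + 0 *\<^sub>R v) F" by (intro cv_add cv_scaleR c w)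
  then have "cv l (\<lambda>x. B (c x + (\<xi> x * \<tau> x) *\<^sub>R w x) (map (\<lambda>f. f x) (w # fs))) L F"
    unfolding L_def using w fs by (intro vector_field_cont[OF B V(1) u]) auto
  then have lim: "((\<lambda>x. N l (B (c x + (\<xi> x * \<tau> x) *\<^sub>R w x) (w x # ?fs x) - L)) \<longlongrightarrow> 0) F"
    by (simp add: cv_def)
  show ?thesis unfolding L_def[symmetric]
  proof (rule cv_bound[OF L _ lim])
    show "\<forall>\<^sub>F x in F. (B (c x + \<tau> x *\<^sub>R w x) (?fs x) - B (c x) (?fs x)) /\<^sub>R \<tau> x \<in> Hs l \<and>
       N l ((B (c x + \<tau> x *\<^sub>R w x) (?fs x) - B (c x) (?fs x)) /\<^sub>R \<tau> x - L)
        \<le> N l (B (c x + (\<xi> x * \<tau> x) *\<^sub>R w x) (w x # ?fs x) - L)"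
      using good
    proof (rule eventually_mono)
      fix x assume gx: "good x"
      then have \<tau>x: "\<tau> x \<noteq> 0" by (simp add: good_def)
      let ?d = "B (c x + \<tau> x *\<^sub>R w x) (?fs x) - B (c x) (?fs x)"
      have "?d /\<^sub>R \<tau> x - L = (1 / \<tau> x) *\<^sub>R (?d - \<tau> x *\<^sub>R L)"
        using \<tau>x by (simp add: scaleR_right_diff_distrib divide_inverse)
      then have "N l (?d /\<^sub>R \<tau> x - L) = N l (?d - \<tau> x *\<^sub>R L) / \<bar>\<tau> x\<bar>"
        using \<xi>2[OF gx] L N_scale[of "?d - \<tau> x *\<^sub>R L" l "1 / \<tau> x"] by simp
      then show "?d /\<^sub>R \<tau> x \<in> Hs l \<and> N l (?d /\<^sub>R \<tau> x - L)
          \<le> N l (B (c x + (\<xi> x * \<tau> x) *\<^sub>R w x) (w x # ?fs x) - L)"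
        using \<xi>2[OF gx] \<tau>x by (simp add: divide_le_eq mult.commute)
    qed
  qed
qed

lemma list_all2_cv_ev:
  assumes "list_all2 (\<lambda>f v. cv k f v F) fs vs"
  shows "\<forall>\<^sub>F x in F. set (map (\<lambda>f. f x) fs) \<subseteq> Hs k"
proof -
  have "\<exists>v. cv k f v F" if "f \<in> set fs" for f
    using list_all2_nthD[OF assms] that by (auto simp: in_set_conv_nth)
  then have "\<forall>\<^sub>F x in F. \<forall>f\<in>set fs. f x \<in> Hs k"
    by (intro eventually_ball_finite) (auto dest: cv_ev_in)
  then show ?thesis by (rule eventually_mono) auto
qed

lemma list_all2_cv_in: "list_all2 (\<lambda>f v. cv k f v F) fs vs \<Longrightarrow> set vs \<subseteq> Hs k"
  using cv_in by (fastforce simp: in_set_conv_nth list_all2_conv_all_nth)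

lemma ev_line_in:
  fixes u v :: 'a
  assumes "open V" "u \<in> V" shows "\<forall>\<^sub>F r in at (0::real). u + r *\<^sub>R v \<in> V"
proof -
  have "((\<lambda>r. u + r *\<^sub>R v) \<longlongrightarrow> u + 0 *\<^sub>R v) (at (0::real))" by (intro tendsto_intros)
  then show ?thesis using assms by (simp add: topological_tendstoD)
qed

lemma vector_field_gateaux:
  assumes "vector_field V B" "u \<in> V \<inter> Hs (Suc l)" "v \<in> Hs (Suc l)" "set vs \<subseteq> Hs (Suc l)"
  shows "cv l (\<lambda>r. (B (u + r *\<^sub>R v) vs - B u vs) /\<^sub>R r) (B u (v # vs)) (at 0)"
  using assms unfolding vector_field_def in_lists_conv_set by blast

text \<open>Going from \<open>u\<close> to \<open>u + r *\<^sub>R v\<close> and on to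
  \<open>u + r *\<^sub>R (v + w)\<close> splits the increment. The second part is a quotient at a
  moving base point, which \<open>vector_field_quotient\<close> covers.\<close>

lemma vector_field_head_add:
  assumes B: "vector_field V B" "open V" "convex V" and u: "u \<in> V \<inter> Hs 1"
    and v: "v \<in> Hs 1" "w \<in> Hs 1" "set vs \<subseteq> Hs 1"
  shows "B u ((v + w) # vs) = B u (v # vs) + B u (w # vs)"
proof -
  let ?F = "at (0::real)"
  have c: "cv 1 (\<lambda>r. u + r *\<^sub>R v) (u + 0 *\<^sub>R v) ?F"
    using u v by (intro cv_add cv_scaleR tendsto_intros) auto
  have nz: "\<forall>\<^sub>F r in ?F. r \<noteq> 0" by (simp add: eventually_at_filter)
  have k: "list_all2 (\<lambda>f v. cv 1 f v ?F) (map (\<lambda>v _. v) vs) vs" by (rule list_all2_cv_const[OF v(3)])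
  have 1: "cv 0 (\<lambda>r. (B ((u + r *\<^sub>R v) + r *\<^sub>R w) vs - B (u + r *\<^sub>R v) vs) /\<^sub>R r) (B u (w # vs)) ?F"
    using vector_field_quotient[OF B, of u 0 "\<lambda>r. u + r *\<^sub>R v" ?F "\<lambda>r. r" "\<lambda>_. w" w, OF _ _ _ _ _ k[simplified]]
      u c v nz
    by (simp add: o_def)
  have 2: "cv 0 (\<lambda>r. (B (u + r *\<^sub>R v) vs - B u vs) /\<^sub>R r) (B u (v # vs)) ?F"
    and 3: "cv 0 (\<lambda>r. (B (u + r *\<^sub>R (v + w)) vs - B u vs) /\<^sub>R r) (B u ((v + w) # vs)) ?F"
    using u v by (auto intro!: vector_field_gateaux[OF B(1)])
  have "cv 0 (\<lambda>r. (B (u + r *\<^sub>R (v + w)) vs - B u vs) /\<^sub>R r) (B u (v # vs) + B u (w # vs)) ?F"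
    using cv_add[OF 2 1] by (simp add: algebra_simps)
  then show ?thesis by (rule cv_unique[OF 3]) simp
qed

lemma vector_field_head_scaleR:
  assumes B: "vector_field V B" "open V" "convex V" and u: "u \<in> V \<inter> Hs 1"
    and v: "v \<in> Hs 1" "set vs \<subseteq> Hs 1"
  shows "B u ((a *\<^sub>R v) # vs) = a *\<^sub>R B u (v # vs)"
proof (cases "a = 0")
  case True
  then show ?thesis using vector_field_head_add[OF B u, of 0 0 vs] v by simp
next
  case False
  let ?F = "at (0::real)"
  have *: "cv 0 (\<lambda>r. (B (u + r *\<^sub>R v) vs - B u vs) /\<^sub>R r) (B u (v # vs)) ?F"
    and 2: "cv 0 (\<lambda>r. (B (u + r *\<^sub>R (a *\<^sub>R v)) vs - B u vs) /\<^sub>R r) (B u ((a *\<^sub>R v) # vs)) ?F"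
    using u v by (auto intro!: vector_field_gateaux[OF B(1)] simp del: scaleR_scaleR)
  have "filterlim (\<lambda>r. (r - 0) * a) ?F ?F" by (rule filterlim_affine[OF False])
  then have "cv 0 (\<lambda>r. a *\<^sub>R ((B (u + (r * a) *\<^sub>R v) vs - B u vs) /\<^sub>R (r * a))) (a *\<^sub>R B u (v # vs)) ?F"
    by (intro cv_scaleR tendsto_const cv_compose[OF *]) simp
  then have "cv 0 (\<lambda>r. (B (u + r *\<^sub>R (a *\<^sub>R v)) vs - B u vs) /\<^sub>R r) (a *\<^sub>R B u (v # vs)) ?F"
    using False by (simp add: field_simps)
  then show ?thesis by (rule cv_unique[OF 2]) simp
qed

text \<open>Only the head direction is handled directly. Below further directions \<open>ps\<close>
  the identity is differentiated along the first of them, so the induction needs it at all points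
  near \<open>u\<close> and not at \<open>u\<close> alone.\<close>

lemma vector_field_lin:
  assumes B: "vector_field V B" "open V" "convex V" and u: "u \<in> V \<inter> Hs 1"
    and v: "v \<in> Hs 1" "w \<in> Hs 1" "set ps \<subseteq> Hs 1" "set vs \<subseteq> Hs 1"
  shows "B u (ps @ (a *\<^sub>R v + b *\<^sub>R w) # vs) = a *\<^sub>R B u (ps @ v # vs) + b *\<^sub>R B u (ps @ w # vs)"
  using u v(3)
proof (induction ps arbitrary: u)
  case Nil
  then show ?case
    using vector_field_head_add[OF B, of u "a *\<^sub>R v" "b *\<^sub>R w" vs]
      vector_field_head_scaleR[OF B, of u v vs a] vector_field_head_scaleR[OF B, of u w vs b] v
    by simp
next
  case (Cons x ps)
  let ?F = "at (0::real)" and ?m = "ps @ (a *\<^sub>R v + b *\<^sub>R w) # vs"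
  have G: "cv 0 (\<lambda>r. (B (u + r *\<^sub>R x) ys - B u ys) /\<^sub>R r) (B u (x # ys)) ?F"
    if "set ys \<subseteq> Hs 1" for ys
    using Cons.prems that by (auto intro!: vector_field_gateaux[OF B(1)])
  have 1: "cv 0 (\<lambda>r. (B (u + r *\<^sub>R x) ?m - B u ?m) /\<^sub>R r) (B u (x # ?m)) ?F"
    using Cons.prems v by (intro G) auto
  have 2: "cv 0 (\<lambda>r. a *\<^sub>R ((B (u + r *\<^sub>R x) (ps @ v # vs) - B u (ps @ v # vs)) /\<^sub>R r) +
      b *\<^sub>R ((B (u + r *\<^sub>R x) (ps @ w # vs) - B u (ps @ w # vs)) /\<^sub>R r))
      (a *\<^sub>R B u (x # ps @ v # vs) + b *\<^sub>R B u (x # ps @ w # vs)) ?F"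
    using Cons.prems v by (intro cv_add cv_scaleR G) auto
  have "\<forall>\<^sub>F r in ?F. u + r *\<^sub>R x \<in> V" using ev_line_in[OF B(2)] Cons.prems by blast
  then have "\<forall>\<^sub>F r in ?F. (B (u + r *\<^sub>R x) ?m - B u ?m) /\<^sub>R r =
      a *\<^sub>R ((B (u + r *\<^sub>R x) (ps @ v # vs) - B u (ps @ v # vs)) /\<^sub>R r) +
      b *\<^sub>R ((B (u + r *\<^sub>R x) (ps @ w # vs) - B u (ps @ w # vs)) /\<^sub>R r)"
  proof (rule eventually_mono)
    fix r assume "u + r *\<^sub>R x \<in> V"
    then show "(B (u + r *\<^sub>R x) ?m - B u ?m) /\<^sub>R r =
      a *\<^sub>R ((B (u + r *\<^sub>R x) (ps @ v # vs) - B u (ps @ v # vs)) /\<^sub>R r) +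
      b *\<^sub>R ((B (u + r *\<^sub>R x) (ps @ w # vs) - B u (ps @ w # vs)) /\<^sub>R r)"
      using Cons.IH[of "u + r *\<^sub>R x"] Cons.IH[of u] Cons.prems by (simp add: algebra_simps)
  qed
  then have "cv 0 (\<lambda>r. (B (u + r *\<^sub>R x) ?m - B u ?m) /\<^sub>R r)
      (a *\<^sub>R B u (x # ps @ v # vs) + b *\<^sub>R B u (x # ps @ w # vs)) ?F"
    by (rule cv_cong[THEN iffD2]) (rule 2)
  then show ?case using cv_unique[OF 1] by simp
qed

text \<open>The Leibniz sum of a multilinear map: a pair holds the value and the velocity of one
  argument, and each summand puts one velocity into its slot. \<open>ps\<close> collects the slots
  already passed, with their values.\<close>

primrec leibniz :: "('a list \<Rightarrow> 'a) \<Rightarrow> 'a list \<Rightarrow> ('a \<times> 'a) list \<Rightarrow> 'a" where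
  "leibniz G ps [] = 0"
| "leibniz G ps (p # r) = G (ps @ snd p # map fst r) + leibniz G (ps @ [fst p]) r"

lemma der_cv:
  assumes "der k g g' t I" "g t \<in> Hs k" shows "cv k g (g t) (at t within I)"
proof -
  have "cv k (\<lambda>s. (s - t) *\<^sub>R ((g s - g t) /\<^sub>R (s - t)) + g t) ((t - t) *\<^sub>R g' + g t) (at t within I)"
    using assms by (intro cv_add cv_scaleR tendsto_intros) (auto simp: der_def)
  then have "cv k (\<lambda>s. (s - t) *\<^sub>R ((g s - g t) /\<^sub>R (s - t)) + g t) (g t) (at t within I)" by simp
  then show ?thesis by (rule cv_cong[THEN iffD1, rotated]) (simp add: eventually_at_filter)
qed

text \<open>The increment telescopes slot by slot: slots in \<open>ps\<close> have already moved to
  time \<open>s\<close>, later ones still sit at \<open>t\<close>. Linearity turns the increment of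
  one slot into a difference quotient, and joint continuity gives its limit.\<close>

lemma vector_field_leibniz:
  assumes B: "vector_field V B" "open V" "convex V" and u: "u \<in> V \<inter> Hs (Suc l)"
    and ps: "list_all2 (\<lambda>f v. cv (Suc l) f v (at t within I)) ps pt"
    and fs: "list_all2 (\<lambda>f f'. der (Suc l) f f' t I \<and> f t \<in> Hs (Suc l)) fs fs'"
  shows "cv l (\<lambda>s. (B u (map (\<lambda>f. f s) (ps @ fs)) - B u (map (\<lambda>f. f s) ps @ map (\<lambda>f. f t) fs)) /\<^sub>R (s - t))
          (leibniz (B u) pt (zip (map (\<lambda>f. f t) fs) fs')) (at t within I)"
  using fs ps
proof (induction fs fs' arbitrary: ps pt rule: list_all2_induct)
  case Nil
  then show ?case by simp
next
  case (Cons f fs f' fs')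
  let ?F = "at t within I"
  have cf: "cv (Suc l) f (f t) ?F" using Cons.hyps(1) der_cv by blast
  have cfs: "list_all2 (\<lambda>f v. cv (Suc l) f v ?F) fs (map (\<lambda>f. f t) fs)"
    using Cons.hyps(2) der_cv by (fastforce simp: list_all2_conv_all_nth)
  have sub: "Hs (Suc l) \<subseteq> Hs 1" by (rule Hs_antimono) simp
  have u1: "u \<in> V \<inter> Hs 1" using u sub by blast
  have 1: "cv l (\<lambda>s. (B u (map (\<lambda>f. f s) ((ps @ [f]) @ fs)) - B u (map (\<lambda>f. f s) (ps @ [f]) @ map (\<lambda>f. f t) fs)) /\<^sub>R (s - t))
          (leibniz (B u) (pt @ [f t]) (zip (map (\<lambda>f. f t) fs) fs')) ?F"
    using Cons.prems cf by (intro Cons.IH list_all2_appendI) auto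
  have "cv l (\<lambda>s. B u (map (\<lambda>f. f s) (ps @ (\<lambda>s. (f s - f t) /\<^sub>R (s - t)) # map (\<lambda>f _. f t) fs)))
      (B u (pt @ f' # map (\<lambda>f. f t) fs)) ?F"
  proof (rule vector_field_cont[OF B(1,2)])
    show "list_all2 (\<lambda>f v. cv (Suc l) f v ?F) (ps @ (\<lambda>s. (f s - f t) /\<^sub>R (s - t)) # map (\<lambda>f _. f t) fs)
        (pt @ f' # map (\<lambda>f. f t) fs)"
      using Cons.prems Cons.hyps(1) list_all2_cv_in[OF cfs]
      by (intro list_all2_appendI) (auto simp: der_def list_all2_map1 list_all2_map2 list_all2_same)
  qed (use u in auto)
  then have 2: "cv l (\<lambda>s. B u (map (\<lambda>f. f s) ps @ ((f s - f t) /\<^sub>R (s - t)) # map (\<lambda>f. f t) fs))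
      (B u (pt @ f' # map (\<lambda>f. f t) fs)) ?F" by (simp add: o_def)
  have "\<forall>\<^sub>F s in ?F. f s \<in> Hs (Suc l) \<and> set (map (\<lambda>f. f s) ps) \<subseteq> Hs (Suc l)"
    using cv_ev_in[OF cf] list_all2_cv_ev[OF Cons.prems] by eventually_elim auto
  then have ev: "\<forall>\<^sub>F s in ?F. B u (map (\<lambda>f. f s) ps @ ((f s - f t) /\<^sub>R (s - t)) # map (\<lambda>f. f t) fs) =
     (B u (map (\<lambda>f. f s) ps @ f s # map (\<lambda>f. f t) fs) - B u (map (\<lambda>f. f s) ps @ f t # map (\<lambda>f. f t) fs)) /\<^sub>R (s - t)"
  proof (rule eventually_mono)
    fix s assume s: "f s \<in> Hs (Suc l) \<and> set (map (\<lambda>f. f s) ps) \<subseteq> Hs (Suc l)"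
    have "f s \<in> Hs 1" "f t \<in> Hs 1" "set (map (\<lambda>f. f s) ps) \<subseteq> Hs 1" "set (map (\<lambda>f. f t) fs) \<subseteq> Hs 1"
      using s sub cv_in[OF cf] list_all2_cv_in[OF cfs] by blast+
    from vector_field_lin[OF B u1 this, of "inverse (s - t)" "- inverse (s - t)"]
    show "B u (map (\<lambda>f. f s) ps @ ((f s - f t) /\<^sub>R (s - t)) # map (\<lambda>f. f t) fs) =
     (B u (map (\<lambda>f. f s) ps @ f s # map (\<lambda>f. f t) fs) - B u (map (\<lambda>f. f s) ps @ f t # map (\<lambda>f. f t) fs)) /\<^sub>R (s - t)"
      by (simp add: algebra_simps)
  qed
  note 2 = 2[unfolded cv_cong[OF ev]]
  show ?case using cv_add[OF 2 1] by (simp add: algebra_simps list_all2_lengthD[OF Cons.hyps(2)])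
qed

text \<open>The increment splits in two. First the base point moves while the arguments are already
  at time \<open>s\<close>, which is a quotient with varying arguments; then the arguments move at
  the fixed base point, which gives the Leibniz sum.\<close>

lemma vector_field_chain:
  assumes B: "vector_field V B" "open V" "convex V"
    and c: "der (Suc l) c c' t I" "c t \<in> V \<inter> Hs (Suc l)"
    and fs: "list_all2 (\<lambda>f f'. der (Suc l) f f' t I \<and> f t \<in> Hs (Suc l)) fs fs'"
  shows "der l (\<lambda>s. B (c s) (map (\<lambda>f. f s) fs))
      (B (c t) (c' # map (\<lambda>f. f t) fs) + leibniz (B (c t)) [] (zip (map (\<lambda>f. f t) fs) fs')) t I"
proof -
  let ?F = "at t within I"
  have cfs: "list_all2 (\<lambda>f v. cv (Suc l) f v ?F) fs (map (\<lambda>f. f t) fs)"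
    using fs der_cv by (fastforce simp: list_all2_conv_all_nth)
  have 1: "cv l (\<lambda>s. (B u (map (\<lambda>f. f s) fs) - B u (map (\<lambda>f. f t) fs)) /\<^sub>R (s - t))
          (leibniz (B u) [] (zip (map (\<lambda>f. f t) fs) fs')) ?F" if "u \<in> V \<inter> Hs (Suc l)" for u
    using vector_field_leibniz[OF B that _ fs, of "[]" "[]"] by simp
  have st: "\<forall>\<^sub>F s in ?F. s - t \<noteq> 0" by (simp add: eventually_at_filter)
  have tt: "((\<lambda>s. s - t) \<longlongrightarrow> 0) ?F" using tendsto_diff[OF tendsto_ident_at[of t I] tendsto_const[of t]] by simp
  have "cv l (\<lambda>s. (B (c t + (s - t) *\<^sub>R ((c s - c t) /\<^sub>R (s - t))) (map (\<lambda>f. f s) fs) - B (c t) (map (\<lambda>f. f s) fs)) /\<^sub>R (s - t))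
           (B (c t) (c' # map (\<lambda>f. f t) fs)) ?F"
    using c by (intro vector_field_quotient[OF B _ _ tt st _ cfs]) (auto simp: der_def)
  then have 2: "cv l (\<lambda>s. (B (c s) (map (\<lambda>f. f s) fs) - B (c t) (map (\<lambda>f. f s) fs)) /\<^sub>R (s - t))
           (B (c t) (c' # map (\<lambda>f. f t) fs)) ?F"
    by (rule cv_cong[THEN iffD1, rotated]) (simp add: eventually_at_filter)
  show ?thesis
    unfolding der_def using cv_add[OF 2 1[OF c(2)]] by (simp add: algebra_simps)
qed

section \<open>Vector fields obtained from differentiable flows\<close>

lemma cv_continuous_map:
  fixes I :: "real set"
  assumes "continuous_map
        (prod_topology (top_of_set I)
          (prod_topology (subtopology (X k) (V \<inter> Hs k)) (product_topology (\<lambda>_. X k) {..<i})))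
        (X l) (\<lambda>(h, u, v). G h u (map v [0..<i]))"
    and "open V" "u \<in> V" "cv k c u F" "list_all2 (\<lambda>f v. cv k f v F) fs vs" "length vs = i"
    and "(\<eta> \<longlongrightarrow> h) F" "\<forall>\<^sub>F x in F. \<eta> x \<in> I" "h \<in> I"
  shows "cv l (\<lambda>x. G (\<eta> x) (c x) (map (\<lambda>f. f x) fs)) (G h u vs) F"
proof -
  have len: "length fs = i" using assms(5,6) by (auto dest: list_all2_lengthD)
  let ?v = "\<lambda>x. \<lambda>j\<in>{..<i}. (fs ! j) x"
  have "limitin (X l) ((\<lambda>(h, u, v). G h u (map v [0..<i])) \<circ> (\<lambda>x. (\<eta> x, c x, ?v x)))
      ((\<lambda>(h, u, v). G h u (map v [0..<i])) (h, u, \<lambda>j\<in>{..<i}. vs ! j)) F"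
  proof (rule continuous_map_limit[OF assms(1)])
    show "limitin (prod_topology (top_of_set I)
          (prod_topology (subtopology (X k) (V \<inter> Hs k)) (product_topology (\<lambda>_. X k) {..<i})))
        (\<lambda>x. (\<eta> x, c x, ?v x)) (h, u, \<lambda>j\<in>{..<i}. vs ! j) F"
      using limitin_subtopology_cv[OF assms(4,3,2)] cv_list[OF assms(5,6)] assms(7-9)
      by (simp add: limitin_pairwise limitin_subtopology o_def)
  qed
  then show ?thesis
    using map_nth_restrict_fun[OF len] map_nth_restrict[OF assms(6)] by (simp add: o_def limitin_iff_cv)
qed

lemma class_C0_cont:
  assumes C: "class_C_inf 0 (X l) (X l) I (V \<inter> Hs l) f" and V: "open V" "u \<in> V"
    and c: "cv l c u F" "(\<eta> \<longlongrightarrow> h) F" "\<forall>\<^sub>F x in F. \<eta> x \<in> I" "h \<in> I"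
  shows "cv l (\<lambda>x. f (\<eta> x) (c x)) (f h u) F"
proof -
  obtain D where D: "\<forall>h\<in>I. \<forall>u\<in>V \<inter> Hs l. D 0 0 h u [] = f h u"
    "\<forall>j\<le>(0::nat). \<forall>i::nat. continuous_map
        (prod_topology (top_of_set I)
          (prod_topology (subtopology (X l) (V \<inter> Hs l)) (product_topology (\<lambda>_. X l) {..<i})))
        (X l) (\<lambda>(h, u, v). D j i h u (map v [0..<i]))"
    using C unfolding class_C_inf_def by (elim exE conjE) (rule that, assumption+)
  have "cv l (\<lambda>x. D 0 0 (\<eta> x) (c x) (map (\<lambda>f. f x) [])) (D 0 0 h u []) F"
    by (rule cv_continuous_map[OF D(2)[rule_format] V c(1) _ _ c(2-4)]) auto
  moreover have "D 0 0 h u [] = f h u" using D(1) c(4) V(2) cv_in[OF c(1)] by blast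
  moreover have "\<forall>\<^sub>F x in F. D 0 0 (\<eta> x) (c x) [] = f (\<eta> x) (c x)"
    using c(3) cv_ev_in[OF c(1)] topological_tendstoD[OF cv_tendsto[OF c(1)] V]
    by eventually_elim (use D(1) in auto)
  ultimately show ?thesis by (auto dest: cv_cong[THEN iffD1, rotated])
qed

text \<open>Two applications of the mean value theorem, in \<open>u\<close> and then in \<open>h\<close>, compare the \<open>u\<close>-increment
  of the difference quotient in \<open>h\<close> with \<open>D1'\<close>.\<close>

lemma interchange_derivatives:
  fixes D0 D0' D1 D1' :: "real \<Rightarrow> 'a \<Rightarrow> 'a"
  assumes hs: "hs > 0" and V: "open V" "convex V" and u: "u \<in> V \<inter> Hs k" and v: "v \<in> Hs k"
    and D0: "\<And>h u. h \<in> {0..hs} \<Longrightarrow> u \<in> V \<inter> Hs k \<Longrightarrow> D0 h u \<in> Hs l"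
    and D0': "\<And>h u. h \<in> {0..hs} \<Longrightarrow> u \<in> V \<inter> Hs k \<Longrightarrow>
        cv l (\<lambda>r. (D0 h (u + r *\<^sub>R v) - D0 h u) /\<^sub>R r) (D0' h u) (at 0)"
    and D1: "\<And>u. u \<in> V \<inter> Hs k \<Longrightarrow> der l (\<lambda>h. D0 h u) (D1 0 u) 0 {0..hs}"
    and D1': "\<And>h u. h \<in> {0..hs} \<Longrightarrow> u \<in> V \<inter> Hs k \<Longrightarrow> der l (\<lambda>h. D0' h u) (D1' h u) h {0..hs}"
    and cont: "cv l (\<lambda>(\<eta>, r). D1' \<eta> (u + r *\<^sub>R v)) (D1' 0 u) (inf (nhds (0, 0)) (principal ({0..hs} \<times> UNIV)))"
  shows "cv l (\<lambda>r. (D1 0 (u + r *\<^sub>R v) - D1 0 u) /\<^sub>R r) (D1' 0 u) (at 0)"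
proof -
  define L where "L = D1' 0 u"
  have L: "L \<in> Hs l" using cv_in[OF cont] by (simp add: L_def)
  have D0'in: "D0' h u \<in> Hs l" if "h \<in> {0..hs}" "u \<in> V \<inter> Hs k" for h u
    using cv_in[OF D0'[OF that]] .
  have D1in: "D1 0 u \<in> Hs l" if "u \<in> V \<inter> Hs k" for u
    using D1[OF that] by (auto simp: der_def dest: cv_in)
  have D1'in: "D1' h u \<in> Hs l" if "h \<in> {0..hs}" "u \<in> V \<inter> Hs k" for h u
    using D1'[OF that] by (auto simp: der_def dest: cv_in)
  have key: "\<exists>d>0. \<forall>r. \<bar>r\<bar> < d \<longrightarrow> u + r *\<^sub>R v \<in> V \<and> N l (D1 0 (u + r *\<^sub>R v) - D1 0 u - r *\<^sub>R L) \<le> \<bar>r\<bar> * e"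
    if e: "e > 0" for e
  proof -
    have "((\<lambda>p. N l ((case p of (\<eta>, r) \<Rightarrow> D1' \<eta> (u + r *\<^sub>R v)) - L)) \<longlongrightarrow> 0)
        (inf (nhds (0, 0)) (principal ({0..hs} \<times> UNIV)))"
      using cont by (simp add: cv_def L_def)
    then have "\<forall>\<^sub>F p in inf (nhds (0::real, 0::real)) (principal ({0..hs} \<times> UNIV)).
        N l ((case p of (\<eta>, r) \<Rightarrow> D1' \<eta> (u + r *\<^sub>R v)) - L) < e"
      using e by (rule order_tendstoD)
    then obtain d1 where d1: "d1 > 0" "\<And>\<eta> r. dist (\<eta>, r) (0::real, 0::real) < d1 \<Longrightarrow> \<eta> \<in> {0..hs} \<Longrightarrow>
        N l (D1' \<eta> (u + r *\<^sub>R v) - L) < e"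
      by (auto simp: eventually_inf_principal eventually_nhds_metric)
    have "\<forall>\<^sub>F r in nhds (0::real). u + r *\<^sub>R v \<in> V"
    proof -
      have "((\<lambda>r. u + r *\<^sub>R v) \<longlongrightarrow> u + 0 *\<^sub>R v) (nhds (0::real))"
        by (intro tendsto_intros filterlim_ident)
      then show ?thesis using V u by (simp add: topological_tendstoD)
    qed
    then obtain d2 where d2: "d2 > 0" "\<And>r::real. \<bar>r\<bar> < d2 \<Longrightarrow> u + r *\<^sub>R v \<in> V"
      by (auto simp: eventually_nhds_metric dist_real_def)
    \<comment> \<open>The distance in the product is at most the sum of the coordinates, hence
      \<open>d1 / 2\<close>; the bound \<open>hs\<close> keeps the times inside the
      interval.\<close>
    define d where "d = min (min (d1 / 2) d2) hs"
    have d: "d > 0" using d1 d2 hs by (simp add: d_def)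
    have D1'e: "N l (D1' \<eta> (u + r *\<^sub>R v) - L) < e" if "0 \<le> \<eta>" "\<eta> < d" "\<bar>r\<bar> < d" for \<eta> r
    proof (rule d1(2))
      have "dist (\<eta>, r) (0::real, 0::real) \<le> \<bar>\<eta>\<bar> + \<bar>r\<bar>"
        by (simp add: dist_prod_def sqrt_sum_squares_le_sum_abs)
      then show "dist (\<eta>, r) (0::real, 0::real) < d1" using that by (simp add: d_def)
    qed (use that in \<open>auto simp: d_def\<close>)
    have "N l (D1 0 (u + r *\<^sub>R v) - D1 0 u - r *\<^sub>R L) \<le> \<bar>r\<bar> * e" if r: "\<bar>r\<bar> < d" for r
    proof -
      have ur: "u + (\<rho> * r) *\<^sub>R v \<in> V \<inter> Hs k" if "\<rho> \<in> {0..1}" for \<rho>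
      proof -
        have "\<bar>\<rho> * r\<bar> \<le> \<bar>r\<bar>" using that by (auto simp: abs_mult mult_left_le_one_le)
        then have "\<bar>\<rho> * r\<bar> < d2" using r by (simp add: d_def)
        then show ?thesis using d2(2) u v by auto
      qed
      have h: "N l ((D0 h (u + r *\<^sub>R v) - D0 0 (u + r *\<^sub>R v)) /\<^sub>R (h - 0) - (D0 h u - D0 0 u) /\<^sub>R (h - 0) - r *\<^sub>R L) \<le> \<bar>r\<bar> * e"
        if h: "0 < h" "h < d" for h
      proof (cases "r = 0")
        case True
        then show ?thesis by simp
      next
        case False
        define g where "g \<rho> = (D0 h (u + (\<rho> * r) *\<^sub>R v) - D0 0 (u + (\<rho> * r) *\<^sub>R v)) /\<^sub>R h" for \<rho>
        define g' where "g' \<rho> = r *\<^sub>R ((D0' h (u + (\<rho> * r) *\<^sub>R v) - D0' 0 (u + (\<rho> * r) *\<^sub>R v)) /\<^sub>R h)" for \<rho>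
        have hin: "h \<in> {0..hs}" "(0::real) \<in> {0..hs}" using h by (auto simp: d_def)
        obtain \<xi> where \<xi>: "0 < \<xi>" "\<xi> < 1" "N l (g 1 - g 0 - (1 - 0) *\<^sub>R r *\<^sub>R L) \<le> (1 - 0) * N l (g' \<xi> - r *\<^sub>R L)"
        proof (rule mean_value[of 0 1 g l g' "r *\<^sub>R L"])
          fix \<rho> :: real assume \<rho>: "\<rho> \<in> {0..1}"
          show "g \<rho> \<in> Hs l" unfolding g_def using D0 ur[OF \<rho>] hin by (intro Hs_simps) auto
          have "cv l (\<lambda>q. ((D0 h (u + (\<rho> * r + q) *\<^sub>R v) - D0 h (u + (\<rho> * r) *\<^sub>R v)) /\<^sub>R q -
              (D0 0 (u + (\<rho> * r + q) *\<^sub>R v) - D0 0 (u + (\<rho> * r) *\<^sub>R v)) /\<^sub>R q) /\<^sub>R h)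
              ((D0' h (u + (\<rho> * r) *\<^sub>R v) - D0' 0 (u + (\<rho> * r) *\<^sub>R v)) /\<^sub>R h) (at 0)"
            using D0'[OF hin(1) ur[OF \<rho>]] D0'[OF hin(2) ur[OF \<rho>]]
            by (intro cv_scaleR cv_diff tendsto_const) (auto simp: algebra_simps)
          then have "cv l (\<lambda>q. ((D0 h (u + (\<rho> * r + q) *\<^sub>R v) - D0 0 (u + (\<rho> * r + q) *\<^sub>R v)) /\<^sub>R h -
              (D0 h (u + (\<rho> * r) *\<^sub>R v) - D0 0 (u + (\<rho> * r) *\<^sub>R v)) /\<^sub>R h) /\<^sub>R q)
              ((D0' h (u + (\<rho> * r) *\<^sub>R v) - D0' 0 (u + (\<rho> * r) *\<^sub>R v)) /\<^sub>R h) (at 0)"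
            by (simp add: algebra_simps)
          then show "der l g (g' \<rho>) \<rho> {0..1}"
            unfolding g_def g'_def
            by (rule der_line[of l "\<lambda>p. (D0 h p - D0 0 p) /\<^sub>R h"]) (rule False)
        qed (use L in auto)
        let ?p = "u + (\<xi> * r) *\<^sub>R v"
        have p: "?p \<in> V \<inter> Hs k" using ur \<xi> by simp
        obtain \<eta> where \<eta>: "0 < \<eta>" "\<eta> < h"
          "N l (D0' h ?p - D0' 0 ?p - (h - 0) *\<^sub>R L) \<le> (h - 0) * N l (D1' \<eta> ?p - L)"
        proof (rule mean_value[of 0 h "\<lambda>h. D0' h ?p" l "\<lambda>h. D1' h ?p" L])
          fix t assume t: "t \<in> {0..h}"
          have th: "{0..h} \<subseteq> {0..hs}" using hin by auto
          show "der l (\<lambda>h. D0' h ?p) (D1' t ?p) t {0..h}"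
            using D1'[of t ?p] p t th unfolding der_def
            by (meson at_le cv_filter_mono subsetD)
        qed (use h L p hin D0'in in auto)
        have "\<bar>\<xi> * r\<bar> \<le> \<bar>r\<bar>" using \<xi> by (auto simp: abs_mult mult_left_le_one_le)
        then have "N l (D1' \<eta> ?p - L) < e" using \<eta> h r by (intro D1'e) auto
        then have *: "N l (D0' h ?p - D0' 0 ?p - h *\<^sub>R L) \<le> h * e"
          using \<eta>(3) h by (smt (verit) mult_left_mono)
        have "g' \<xi> - r *\<^sub>R L = (r / h) *\<^sub>R (D0' h ?p - D0' 0 ?p - h *\<^sub>R L)"
          using h by (simp add: g'_def algebra_simps divide_inverse)
        then have "N l (g' \<xi> - r *\<^sub>R L) = \<bar>r\<bar> / h * N l (D0' h ?p - D0' 0 ?p - h *\<^sub>R L)"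
          using D0'in hin p L h by (simp add: N_scale)
        also have "\<dots> \<le> \<bar>r\<bar> / h * (h * e)" using * h by (intro mult_left_mono) auto
        finally have "N l (g 1 - g 0 - r *\<^sub>R L) \<le> \<bar>r\<bar> * e" using \<xi>(3) h by simp
        then show ?thesis using h by (simp add: g_def)
      qed
      \<comment> \<open>The bound is uniform in \<open>h\<close>, so it survives the limit in which
        \<open>h\<close> tends to 0 and the quotients become values of \<open>D1 0\<close>.\<close>
      have lim: "cv l (\<lambda>h. (D0 h (u + r *\<^sub>R v) - D0 0 (u + r *\<^sub>R v)) /\<^sub>R (h - 0) - (D0 h u - D0 0 u) /\<^sub>R (h - 0) - r *\<^sub>R L)
           (D1 0 (u + r *\<^sub>R v) - D1 0 u - r *\<^sub>R L) (at 0 within {0..hs})"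
        using D1[of "u + r *\<^sub>R v"] D1[of u] ur[of 1] u L unfolding der_def by (intro cv_diff) auto
      have "at 0 within {0..hs} \<noteq> (bot::real filter)" using hs by (simp add: at_within_Icc_at_right)
      moreover have "\<forall>\<^sub>F h in at 0 within {0..hs}. h < d"
        using d by (intro eventually_at_ball'[THEN eventually_mono, of d 0]) (auto simp: dist_real_def)
      then have "\<forall>\<^sub>F x in at 0 within {0..hs}. N l ((D0 x (u + r *\<^sub>R v) - D0 0 (u + r *\<^sub>R v)) /\<^sub>R (x - 0) - (D0 x u - D0 0 u) /\<^sub>R (x - 0) - r *\<^sub>R L) \<le> \<bar>r\<bar> * e"
        using h by (auto simp: eventually_at_filter elim!: eventually_mono)
      ultimately show ?thesis
        using tendsto_upperbound[OF cv_N[OF lim], of "\<bar>r\<bar> * e"] by simp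
    qed
    moreover have "u + r *\<^sub>R v \<in> V" if "\<bar>r\<bar> < d" for r using d2(2) that by (simp add: d_def)
    ultimately show ?thesis using d by blast
  qed
  have in': "(D1 0 (u + r *\<^sub>R v) - D1 0 u) /\<^sub>R r \<in> Hs l" if "u + r *\<^sub>R v \<in> V" for r
    using that u v D1in by (intro Hs_simps) auto
  show ?thesis
    unfolding cv_def L_def[symmetric]
  proof (intro conjI L)
    show "\<forall>\<^sub>F r in at 0. (D1 0 (u + r *\<^sub>R v) - D1 0 u) /\<^sub>R r \<in> Hs l"
      using ev_line_in[OF V(1), of u v] u in' by (auto elim: eventually_mono)
    show "((\<lambda>r. N l ((D1 0 (u + r *\<^sub>R v) - D1 0 u) /\<^sub>R r - L)) \<longlongrightarrow> 0) (at 0)"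
    proof (rule tendstoI)
      fix e :: real assume "e > 0"
      then obtain d where d: "d > 0" "\<And>r. \<bar>r\<bar> < d \<Longrightarrow> u + r *\<^sub>R v \<in> V \<and>
           N l (D1 0 (u + r *\<^sub>R v) - D1 0 u - r *\<^sub>R L) \<le> \<bar>r\<bar> * (e / 2)"
        using key[of "e / 2"] by auto
      have "dist (N l ((D1 0 (u + r *\<^sub>R v) - D1 0 u) /\<^sub>R r - L)) 0 < e" if r: "r \<noteq> 0" "dist r 0 < d" for r
      proof -
        have V': "u + r *\<^sub>R v \<in> V" and le: "N l (D1 0 (u + r *\<^sub>R v) - D1 0 u - r *\<^sub>R L) \<le> \<bar>r\<bar> * (e / 2)"
          using d(2)[of r] r by auto
        have "(D1 0 (u + r *\<^sub>R v) - D1 0 u) /\<^sub>R r - L = inverse r *\<^sub>R (D1 0 (u + r *\<^sub>R v) - D1 0 u - r *\<^sub>R L)"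
          using r by (simp add: scaleR_right_diff_distrib)
        moreover have "D1 0 (u + r *\<^sub>R v) - D1 0 u - r *\<^sub>R L \<in> Hs l" using D1in u v V' L by auto
        ultimately have "N l ((D1 0 (u + r *\<^sub>R v) - D1 0 u) /\<^sub>R r - L) = N l (D1 0 (u + r *\<^sub>R v) - D1 0 u - r *\<^sub>R L) / \<bar>r\<bar>"
          by (simp add: N_scale divide_inverse)
        also have "\<dots> \<le> e / 2" using le r by (simp add: divide_le_eq mult.commute)
        finally show ?thesis using \<open>e > 0\<close> in'[OF V'] L by simp
      qed
      then show "\<forall>\<^sub>F r in at 0. dist (N l ((D1 0 (u + r *\<^sub>R v) - D1 0 u) /\<^sub>R r - L)) 0 < e"
        using d(1) by (auto simp: eventually_at)
    qed
  qed
qed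

text \<open>The class differentiates in \<open>u\<close> first and in \<open>h\<close> afterwards,
  whereas the field is the derivative in \<open>h\<close> at 0 and is then differentiated in
  \<open>u\<close>; \<open>interchange_derivatives\<close> reverses the order. Differentiability at
  every time is recorded so that right derivatives of the flow can later be recognised as full
  ones.\<close>

lemma class_C1_vector_field:
  assumes hs: "hs > 0" and V: "open V" "convex V"
    and C: "\<And>l. class_C_inf 1 (X (Suc l)) (X l) {0..hs} (V \<inter> Hs (Suc l)) f"
  obtains B where "vector_field V B"
    "\<And>l u. u \<in> V \<inter> Hs (Suc l) \<Longrightarrow> der l (\<lambda>h. f h u) (B u []) 0 {0..hs}"
    "\<And>l u t. u \<in> V \<inter> Hs (Suc l) \<Longrightarrow> t \<in> {0..hs} \<Longrightarrow> \<exists>d. der l (\<lambda>h. f h u) d t {0..hs}"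
proof -
  let ?I = "{0..hs}"
  define P where "P l D \<longleftrightarrow>
     (\<forall>h\<in>?I. \<forall>u\<in>V \<inter> Hs (Suc l). D 0 0 h u [] = f h u) \<and>
     (\<forall>h\<in>?I. \<forall>u\<in>V \<inter> Hs (Suc l). \<forall>v\<in>Hs (Suc l). \<forall>vs\<in>lists (Hs (Suc l)).
        cv l (\<lambda>r. (D 0 (length vs) h (u + r *\<^sub>R v) vs - D 0 (length vs) h u vs) /\<^sub>R r)
          (D 0 (Suc (length vs)) h u (v # vs)) (at 0)) \<and>
     (\<forall>j<1. \<forall>h\<in>?I. \<forall>u\<in>V \<inter> Hs (Suc l). \<forall>vs\<in>lists (Hs (Suc l)).
        cv l (\<lambda>t. (D j (length vs) t u vs - D j (length vs) h u vs) /\<^sub>R (t - h))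
          (D (Suc j) (length vs) h u vs) (at h within ?I)) \<and>
     (\<forall>j\<le>1. \<forall>i. continuous_map
        (prod_topology (top_of_set ?I)
          (prod_topology (subtopology (X (Suc l)) (V \<inter> Hs (Suc l))) (product_topology (\<lambda>_. X (Suc l)) {..<i})))
        (X l) (\<lambda>(h, u, v). D j i h u (map v [0..<i])))"
    for l and D :: "nat \<Rightarrow> nat \<Rightarrow> real \<Rightarrow> 'a \<Rightarrow> 'a list \<Rightarrow> 'a"
  have "\<forall>l. \<exists>D. P l D" 
    unfolding P_def by (rule allI) (rule C[unfolded class_C_inf_def limitin_iff_cv topspace_norm_topology])
  then obtain D where P: "\<And>l. P l (D l)" by metis
  have D0: "D l 0 0 h u [] = f h u" if "h \<in> ?I" "u \<in> V \<inter> Hs (Suc l)" for l h u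
    using P[of l, unfolded P_def, THEN conjunct1] that by blast
  have Du: "cv l (\<lambda>r. (D l 0 (length vs) h (u + r *\<^sub>R v) vs - D l 0 (length vs) h u vs) /\<^sub>R r)
      (D l 0 (Suc (length vs)) h u (v # vs)) (at 0)"
    if "h \<in> ?I" "u \<in> V \<inter> Hs (Suc l)" "v \<in> Hs (Suc l)" "set vs \<subseteq> Hs (Suc l)" for l h u v vs
    using P[of l, unfolded P_def, THEN conjunct2, THEN conjunct1] that
    unfolding in_lists_conv_set by blast
  have Dh: "der l (\<lambda>t. D l 0 (length vs) t u vs) (D l 1 (length vs) h u vs) h ?I"
    if "h \<in> ?I" "u \<in> V \<inter> Hs (Suc l)" "set vs \<subseteq> Hs (Suc l)" for l h u vs
    using P[of l, unfolded P_def, THEN conjunct2, THEN conjunct2, THEN conjunct1, rule_format, of 0] that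
    by (auto simp: subset_iff in_lists_conv_set der_def)
  have Dc: "continuous_map
        (prod_topology (top_of_set ?I)
          (prod_topology (subtopology (X (Suc l)) (V \<inter> Hs (Suc l))) (product_topology (\<lambda>_. X (Suc l)) {..<i})))
        (X l) (\<lambda>(h, u, v). D l j i h u (map v [0..<i]))" if "j \<le> 1" for l i j
    using P[of l, unfolded P_def, THEN conjunct2, THEN conjunct2, THEN conjunct2] that by blast
  have sub: "Hs (Suc l) \<subseteq> Hs (Suc 0)" for l by (rule Hs_antimono) simp
  \<comment> \<open>Every level \<open>l\<close> comes with its own witness \<open>D l\<close>. They
    agree because they start from the same \<open>f\<close> and every further derivative is also a
    limit in the ambient norm.\<close>
  have agree0: "D l 0 (length vs) h u vs = D 0 0 (length vs) h u vs"
    if "h \<in> ?I" "u \<in> V \<inter> Hs (Suc l)" "set vs \<subseteq> Hs (Suc l)" for l h u vs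
    using that(2,3)
  proof (induction vs arbitrary: u)
    case Nil
    then show ?case using D0[OF that(1)] sub[of l] by auto
  next
    case (Cons v vs)
    have 1: "cv l (\<lambda>r. (D l 0 (length vs) h (u + r *\<^sub>R v) vs - D l 0 (length vs) h u vs) /\<^sub>R r)
      (D l 0 (Suc (length vs)) h u (v # vs)) (at 0)"
      using Cons.prems by (intro Du that) auto
    have 2: "cv 0 (\<lambda>r. (D 0 0 (length vs) h (u + r *\<^sub>R v) vs - D 0 0 (length vs) h u vs) /\<^sub>R r)
      (D 0 0 (Suc (length vs)) h u (v # vs)) (at 0)"
      using Cons.prems sub[of l] by (intro Du that) auto
    have "\<forall>\<^sub>F r in at 0. (D l 0 (length vs) h (u + r *\<^sub>R v) vs - D l 0 (length vs) h u vs) /\<^sub>R r =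
        (D 0 0 (length vs) h (u + r *\<^sub>R v) vs - D 0 0 (length vs) h u vs) /\<^sub>R r"
    proof (rule eventually_mono[OF ev_line_in[OF V(1)]])
      show "u \<in> V" using Cons.prems by blast
      fix r assume "u + r *\<^sub>R v \<in> V"
      then show "(D l 0 (length vs) h (u + r *\<^sub>R v) vs - D l 0 (length vs) h u vs) /\<^sub>R r =
        (D 0 0 (length vs) h (u + r *\<^sub>R v) vs - D 0 0 (length vs) h u vs) /\<^sub>R r"
        using Cons.IH[of "u + r *\<^sub>R v"] Cons.IH[of u] Cons.prems by simp
    qed
    then have "cv l (\<lambda>r. (D 0 0 (length vs) h (u + r *\<^sub>R v) vs - D 0 0 (length vs) h u vs) /\<^sub>R r)
      (D l 0 (Suc (length vs)) h u (v # vs)) (at 0)"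
      by (rule cv_cong[THEN iffD1]) (rule 1)
    from cv_unique[OF this 2] show ?case by simp
  qed
  \<comment> \<open>The witness of level 0 defines the field; \<open>agree1\<close> carries it to
    every level.\<close>
  define B where "B u vs = D 0 1 (length vs) 0 u vs" for u vs
  have nb: "at 0 within ?I \<noteq> (bot::real filter)" using hs by (simp add: at_within_Icc_at_right)
  have h0: "0 \<in> ?I" using hs by simp
  have agree1: "D l 1 (length vs) 0 u vs = B u vs"
    if "u \<in> V \<inter> Hs (Suc l)" "set vs \<subseteq> Hs (Suc l)" for l u vs
  proof -
    have 1: "cv l (\<lambda>t. (D l 0 (length vs) t u vs - D l 0 (length vs) 0 u vs) /\<^sub>R (t - 0))
        (D l 1 (length vs) 0 u vs) (at 0 within ?I)"
      using Dh[OF h0 that] by (simp add: der_def)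
    have 2: "cv 0 (\<lambda>t. (D 0 0 (length vs) t u vs - D 0 0 (length vs) 0 u vs) /\<^sub>R (t - 0))
        (D 0 1 (length vs) 0 u vs) (at 0 within ?I)"
      using Dh[OF h0, of u 0 vs] that sub[of l] by (auto simp: der_def)
    have "cv l (\<lambda>t. (D 0 0 (length vs) t u vs - D 0 0 (length vs) 0 u vs) /\<^sub>R (t - 0))
        (D l 1 (length vs) 0 u vs) (at 0 within ?I)"
      by (rule cv_cong[THEN iffD1, OF _ 1])
        (use agree0[OF _ that] h0 in \<open>auto simp: eventually_at_filter\<close>)
    from cv_unique[OF this 2 nb] show ?thesis by (simp add: B_def)
  qed
  have Dcv: "cv l (\<lambda>x. D l 1 (length vs) (\<eta> x) (c x) (map (\<lambda>f. f x) fs)) (D l 1 (length vs) h u vs) F"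
    if "u \<in> V" "cv (Suc l) c u F" "list_all2 (\<lambda>f v. cv (Suc l) f v F) fs vs"
      "(\<eta> \<longlongrightarrow> h) F" "\<forall>\<^sub>F x in F. \<eta> x \<in> ?I" "h \<in> ?I"
    for l u c vs fs \<eta> h and F :: "(real \<times> real) filter"
    by (rule cv_continuous_map[OF Dc V(1) that(1-3) refl that(4-6)]) simp
  have "vector_field V B"
    unfolding vector_field_def
  proof (intro conjI allI ballI)
    fix l i
    have "continuous_map
        (prod_topology (subtopology (X (Suc l)) (V \<inter> Hs (Suc l))) (product_topology (\<lambda>_. X (Suc l)) {..<i}))
        (X l) ((\<lambda>(h, u, v). D l 1 i h u (map v [0..<i])) \<circ> (\<lambda>p. (0, p)))"
      by (rule continuous_map_compose[OF _ Dc])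
        (intro continuous_map_pairedI continuous_map_const[THEN iffD2] continuous_map_id[unfolded id_def], use h0 in simp_all)
    then show "continuous_map
        (prod_topology (subtopology (X (Suc l)) (V \<inter> Hs (Suc l))) (product_topology (\<lambda>_. X (Suc l)) {..<i}))
        (X l) (\<lambda>(u, v). B u (map v [0..<i]))"
    proof (rule continuous_map_eq)
      fix p assume p: "p \<in> topspace (prod_topology (subtopology (X (Suc l)) (V \<inter> Hs (Suc l)))
          (product_topology (\<lambda>_. X (Suc l)) {..<i}))"
      obtain u v where uv: "p = (u, v)" by (cases p)
      have "D l 1 (length (map v [0..<i])) 0 u (map v [0..<i]) = B u (map v [0..<i])"
        using p by (intro agree1) (auto simp: uv PiE_iff)
      then show "((\<lambda>(h, u, v). D l 1 i h u (map v [0..<i])) \<circ> (\<lambda>p. (0, p))) p =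
          (case p of (u, v) \<Rightarrow> B u (map v [0..<i]))"
        by (simp add: uv)
    qed
  next
    fix l u v vs assume u: "u \<in> V \<inter> Hs (Suc l)" and v: "v \<in> Hs (Suc l)" and "vs \<in> lists (Hs (Suc l))"
    then have vs: "set vs \<subseteq> Hs (Suc l)" unfolding in_lists_conv_set by blast
    let ?n = "length vs"
    have "cv l (\<lambda>r. (D l 1 ?n 0 (u + r *\<^sub>R v) vs - D l 1 ?n 0 u vs) /\<^sub>R r) (D l 1 (Suc ?n) 0 u (v # vs)) (at 0)"
    proof (rule interchange_derivatives[OF hs V u v, where ?D0.0 = "\<lambda>h u. D l 0 ?n h u vs"
          and ?D1' = "\<lambda>h u. D l 1 (Suc ?n) h u (v # vs)" and ?D0' = "\<lambda>h u. D l 0 (Suc ?n) h u (v # vs)"])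
      fix h u assume h: "h \<in> ?I" and u: "u \<in> V \<inter> Hs (Suc l)"
      have "cv l (\<lambda>x::real\<times>real. D l 0 ?n h u (map (\<lambda>f. f x) (map (\<lambda>v _. v) vs))) (D l 0 ?n h u vs) bot"
        by (rule cv_continuous_map[OF Dc V(1), where i = ?n and \<eta>="\<lambda>_. h"])
          (use h u vs list_all2_cv_const[OF vs, of bot] in auto)
      then show "D l 0 ?n h u vs \<in> Hs l" by (rule cv_in)
      show "cv l (\<lambda>r. (D l 0 ?n h (u + r *\<^sub>R v) vs - D l 0 ?n h u vs) /\<^sub>R r) (D l 0 (Suc ?n) h u (v # vs)) (at 0)"
        by (rule Du[OF h u v vs])
      show "der l (\<lambda>h. D l 0 (Suc ?n) h u (v # vs)) (D l 1 (Suc ?n) h u (v # vs)) h ?I"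
        using Dh[OF h u, of "v # vs"] v vs by simp
    next
      fix u assume "u \<in> V \<inter> Hs (Suc l)"
      from Dh[OF h0 this vs] show "der l (\<lambda>h. D l 0 ?n h u vs) (D l 1 ?n 0 u vs) 0 ?I" .
    next
      let ?F = "inf (nhds (0::real, 0::real)) (principal (?I \<times> UNIV))"
      have t: "((\<lambda>p. p) \<longlongrightarrow> (0::real, 0::real)) ?F" by (rule tendsto_mono[OF inf_le1]) (rule filterlim_ident)
      have "cv l (\<lambda>p. D l 1 (length (v # vs)) (fst p) (u + snd p *\<^sub>R v) (map (\<lambda>f. f p) (map (\<lambda>v _. v) (v # vs))))
          (D l 1 (length (v # vs)) 0 u (v # vs)) ?F"
      proof (rule Dcv)
        have "cv (Suc l) (\<lambda>x. u + snd x *\<^sub>R v) (u + 0 *\<^sub>R v) ?F"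
          using u v tendsto_snd[OF t] by (intro cv_add cv_scaleR) auto
        then show "cv (Suc l) (\<lambda>x. u + snd x *\<^sub>R v) u ?F" by simp
        show "(fst \<longlongrightarrow> 0) ?F" using tendsto_fst[OF t] by simp
        show "\<forall>\<^sub>F x in ?F. fst x \<in> ?I" by (auto simp: eventually_inf_principal intro!: always_eventually)
        show "list_all2 (\<lambda>f v. cv (Suc l) f v ?F) (map (\<lambda>v _. v) (v # vs)) (v # vs)"
          using v vs by (intro list_all2_cv_const) auto
      qed (use u h0 in auto)
      then show "cv l (\<lambda>(\<eta>, r). D l 1 (Suc ?n) \<eta> (u + r *\<^sub>R v) (v # vs)) (D l 1 (Suc ?n) 0 u (v # vs)) ?F"
        by (simp add: case_prod_unfold o_def)
    qed
    then have *: "cv l (\<lambda>r. (D l 1 ?n 0 (u + r *\<^sub>R v) vs - D l 1 ?n 0 u vs) /\<^sub>R r) (B u (v # vs)) (at 0)"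
      using agree1[OF u, of "v # vs"] v vs by simp
    show "cv l (\<lambda>r. (B (u + r *\<^sub>R v) vs - B u vs) /\<^sub>R r) (B u (v # vs)) (at 0)"
    proof (rule cv_cong[THEN iffD1, OF _ *], rule eventually_mono[OF ev_line_in[OF V(1)]])
      show "u \<in> V" using u by blast
      fix r assume "u + r *\<^sub>R v \<in> V"
      then show "(D l 1 ?n 0 (u + r *\<^sub>R v) vs - D l 1 ?n 0 u vs) /\<^sub>R r = (B (u + r *\<^sub>R v) vs - B u vs) /\<^sub>R r"
        using agree1[of "u + r *\<^sub>R v" l vs] agree1[of u l vs] u v vs by simp
    qed
  qed
  moreover have d: "der l (\<lambda>h. f h u) (D l 1 0 t u []) t ?I" if "u \<in> V \<inter> Hs (Suc l)" "t \<in> ?I" for l u t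
    using Dh[OF that(2,1), of "[]"] D0[OF _ that(1)] that(2)
    by (auto simp: der_def eventually_at_filter elim!: cv_cong[THEN iffD1, rotated])
  moreover have "der l (\<lambda>h. f h u) (B u []) 0 ?I" if "u \<in> V \<inter> Hs (Suc l)" for l u
    using d[OF that h0] agree1[OF that, of "[]"] by simp
  ultimately show thesis using that by blast
qed

section \<open>Differentiation rules and Taylor polynomials\<close>

lemma der_mono: "k \<le> l \<Longrightarrow> der l f d t I \<Longrightarrow> der k f d t I"
  unfolding der_def by (rule cv_mono)

lemma der_add: "der l f d t I \<Longrightarrow> der l g e t I \<Longrightarrow> der l (\<lambda>s. f s + g s) (d + e) t I"
  unfolding der_def using cv_add[of l "\<lambda>s. (f s - f t) /\<^sub>R (s - t)" d "at t within I" "\<lambda>s. (g s - g t) /\<^sub>R (s - t)" e]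
  by (simp add: algebra_simps)

lemma leibniz_lin:
  assumes B: "vector_field V B" "open V" "convex V" and u: "u \<in> V \<inter> Hs 1"
    and fs: "\<And>f. f \<in> set fs \<Longrightarrow> v f \<in> Hs 1 \<and> p f \<in> Hs 1 \<and> r f \<in> Hs 1" and "set ps \<subseteq> Hs 1"
  shows "leibniz (B u) ps (zip (map v fs) (map (\<lambda>f. x *\<^sub>R p f + y *\<^sub>R r f) fs)) =
    x *\<^sub>R leibniz (B u) ps (zip (map v fs) (map p fs)) + y *\<^sub>R leibniz (B u) ps (zip (map v fs) (map r fs))"
  using assms(5,6)
proof (induction fs arbitrary: ps)
  case (Cons f fs)
  have "B u (ps @ (x *\<^sub>R p f + y *\<^sub>R r f) # map v fs) = x *\<^sub>R B u (ps @ p f # map v fs) + y *\<^sub>R B u (ps @ r f # map v fs)"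
    using Cons.prems by (intro vector_field_lin[OF B u]) auto
  moreover have "leibniz (B u) (ps @ [v f]) (zip (map v fs) (map (\<lambda>f. x *\<^sub>R p f + y *\<^sub>R r f) fs)) =
    x *\<^sub>R leibniz (B u) (ps @ [v f]) (zip (map v fs) (map p fs)) + y *\<^sub>R leibniz (B u) (ps @ [v f]) (zip (map v fs) (map r fs))"
    using Cons.prems by (intro Cons.IH) auto
  moreover have "map fst (zip (map v fs) (map g fs)) = map v fs" for g :: "_ \<Rightarrow> 'a" by simp
  ultimately show ?case by (simp add: algebra_simps)
qed simp

lemma der_diff: "der l f d t I \<Longrightarrow> der l g e t I \<Longrightarrow> der l (\<lambda>s. f s - g s) (d - e) t I"
  unfolding der_def using cv_diff[of l "\<lambda>s. (f s - f t) /\<^sub>R (s - t)" d "at t within I" "\<lambda>s. (g s - g t) /\<^sub>R (s - t)" e]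
  by (simp add: algebra_simps)

lemma der_const: "der l (\<lambda>s. v) 0 t I"
  by (simp add: der_def)

lemma der_sum: "(\<And>i. i \<in> K \<Longrightarrow> der l (f i) (d i) t I) \<Longrightarrow> der l (\<lambda>s. \<Sum>i\<in>K. f i s) (\<Sum>i\<in>K. d i) t I"
  by (induction K rule: infinite_finite_induct) (auto intro: der_add der_const)

lemma der_scaleR_left:
  assumes "(r has_real_derivative r') (at t within I)" "v \<in> Hs l"
  shows "der l (\<lambda>s. r s *\<^sub>R v) (r' *\<^sub>R v) t I"
proof -
  have "cv l (\<lambda>s. ((r s - r t) / (s - t)) *\<^sub>R v) (r' *\<^sub>R v) (at t within I)"
    using assms by (intro cv_scaleR) (auto simp: has_field_derivative_iff)
  then show ?thesis
    unfolding der_def by (simp add: divide_inverse mult.commute scaleR_left_diff_distrib[symmetric])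
qed

lemma der_taylor_polynomial:
  assumes "\<And>i. i < Suc k \<Longrightarrow> v i \<in> Hs l"
  shows "der l (\<lambda>s. \<Sum>i<Suc k. (s ^ i / fact i) *\<^sub>R v i) (\<Sum>i<k. (t ^ i / fact i) *\<^sub>R v (Suc i)) t I"
proof -
  have 1: "der l (\<lambda>s. (s ^ Suc i / fact (Suc i)) *\<^sub>R v (Suc i)) ((t ^ i / fact i) *\<^sub>R v (Suc i)) t I"
    if "i < k" for i
  proof (rule der_scaleR_left)
    have "((\<lambda>s. s ^ Suc i) has_real_derivative real (Suc i) * (1 * t ^ i)) (at t within I)"
      using DERIV_power[OF DERIV_ident, where n = "Suc i" and x = t and s = I] by simp
    from DERIV_cdivide[OF this, of "fact (Suc i)"]
    show "((\<lambda>s. s ^ Suc i / fact (Suc i)) has_real_derivative t ^ i / fact i) (at t within I)"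
      by (simp add: fact_Suc nonzero_divide_eq_eq mult.commute del: power_Suc of_nat_Suc)
  qed (use assms that in auto)
  have "der l (\<lambda>s. v 0 + (\<Sum>i<k. (s ^ Suc i / fact (Suc i)) *\<^sub>R v (Suc i)))
      (0 + (\<Sum>i<k. (t ^ i / fact i) *\<^sub>R v (Suc i))) t I"
    by (intro der_add der_const der_sum 1) auto
  then show ?thesis by (simp only: sum.lessThan_Suc_shift) simp
qed

text \<open>The filter of pairs \<open>(h, u)\<close> where \<open>h\<close> decreases to 0, the
  value 0 included, and \<open>u\<close> tends to \<open>p\<close> in the norm of level
  \<open>k\<close>. A bound that holds eventually here has one constant for all \<open>u\<close>
  near \<open>p\<close>, which is the uniformity that continuity gives without compact
  balls.\<close>

definition germ :: "nat \<Rightarrow> 'a \<Rightarrow> (real \<times> 'a) filter" where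
  "germ k p = (INF d\<in>{0<..}. principal ({0..d} \<times> {u \<in> Hs k. N k (u - p) < d}))"

lemma eventually_germ:
  "eventually P (germ k p) \<longleftrightarrow>
     (\<exists>d>0. \<forall>h u. 0 \<le> h \<longrightarrow> h \<le> d \<longrightarrow> u \<in> Hs k \<longrightarrow> N k (u - p) < d \<longrightarrow> P (h, u))"
proof -
  have "eventually P (germ k p) \<longleftrightarrow>
     (\<exists>d\<in>{0<..}. eventually P (principal ({0..d} \<times> {u \<in> Hs k. N k (u - p) < d})))"
    unfolding germ_def
  proof (rule eventually_INF_base)
    fix a b :: real assume "a \<in> {0<..}" "b \<in> {0<..}"
    then show "\<exists>x\<in>{0<..}. principal ({0..x} \<times> {u \<in> Hs k. N k (u - p) < x}) \<le>
        inf (principal ({0..a} \<times> {u \<in> Hs k. N k (u - p) < a})) (principal ({0..b} \<times> {u \<in> Hs k. N k (u - p) < b}))"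
      by (intro bexI[of _ "min a b"]) auto
  qed auto
  also have "\<dots> \<longleftrightarrow> (\<exists>d>0. \<forall>h u. 0 \<le> h \<longrightarrow> h \<le> d \<longrightarrow> u \<in> Hs k \<longrightarrow> N k (u - p) < d \<longrightarrow> P (h, u))"
    unfolding eventually_principal by fastforce
  finally show ?thesis .
qed

text \<open>The base sets of \<open>germ\<close> are closed under decreasing \<open>h\<close>. The
  mean value theorem on \<open>{0..h}\<close> needs its hypotheses on that whole interval.\<close>

lemma eventually_germ_initial:
  assumes "eventually P (germ k p)"
  shows "eventually (\<lambda>(h, u). \<forall>t\<in>{0..h}. P (t, u)) (germ k p)"
proof -
  obtain d where "d > 0" "\<And>h u. 0 \<le> h \<Longrightarrow> h \<le> d \<Longrightarrow> u \<in> Hs k \<Longrightarrow> N k (u - p) < d \<Longrightarrow> P (h, u)"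
    using assms unfolding eventually_germ by blast
  then show ?thesis unfolding eventually_germ by (intro exI[of _ d]) auto
qed

lemma fst_germ: "(fst \<longlongrightarrow> 0) (germ k p)"
  unfolding tendsto_iff eventually_germ
proof (intro allI impI)
  fix e :: real assume "e > 0"
  then show "\<exists>d>0. \<forall>h u. 0 \<le> h \<longrightarrow> h \<le> d \<longrightarrow> u \<in> Hs k \<longrightarrow> N k (u - p) < d \<longrightarrow> dist (fst (h, u)) 0 < e"
    by (intro exI[of _ "e / 2"]) auto
qed

lemma snd_germ: "p \<in> Hs k \<Longrightarrow> cv k snd p (germ k p)"
  unfolding cv_def tendsto_iff eventually_germ by (auto intro: exI[of _ 1])

lemma eventually_germ_le: "hs > 0 \<Longrightarrow> eventually (\<lambda>(h, u). h \<in> {0..hs}) (germ k p)"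
  unfolding eventually_germ by (intro exI[of _ hs]) auto

lemma filterlim_germ:
  assumes "cv k f p F" "(\<eta> \<longlongrightarrow> 0) F" "\<forall>\<^sub>F x in F. 0 \<le> \<eta> x"
  shows "filterlim (\<lambda>x. (\<eta> x, f x)) (germ k p) F"
  unfolding filterlim_iff
proof (intro allI impI)
  fix P assume "eventually P (germ k p)"
  then obtain d where d: "d > 0" "\<And>h u. 0 \<le> h \<Longrightarrow> h \<le> d \<Longrightarrow> u \<in> Hs k \<Longrightarrow> N k (u - p) < d \<Longrightarrow> P (h, u)"
    unfolding eventually_germ by blast
  have "\<forall>\<^sub>F x in F. N k (f x - p) < d" using assms(1) d(1) unfolding cv_def by (auto dest: order_tendstoD)
  moreover have "\<forall>\<^sub>F x in F. \<eta> x < d" using order_tendstoD(2)[OF assms(2) d(1)] .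
  ultimately show "\<forall>\<^sub>F x in F. P (\<eta> x, f x)"
    using assms(3) cv_ev_in[OF assms(1)] by eventually_elim (use d in auto)
qed

end

section \<open>Word series of splitting methods\<close>

definition run :: "bool \<Rightarrow> bool list \<Rightarrow> nat" where
  "run a w = length (takeWhile ((=) a) w)"

text \<open>Precomposing with the partial flow of \<open>a\<close> prepends \<open>i\<close> copies of \<open>a\<close> to a word, with weight
  \<open>t ^ i / i!\<close>.\<close>

definition flow_series :: "bool \<Rightarrow> real \<Rightarrow> (bool list \<Rightarrow> real) \<Rightarrow> bool list \<Rightarrow> real" where
  "flow_series a t c w = (\<Sum>i\<le>run a w. t ^ i / fact i * c (drop i w))"

lemma run_drop: "i \<le> run a w \<Longrightarrow> run a (drop i w) = run a w - i"
proof (induction w arbitrary: i)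
  case (Cons b w)
  then show ?case by (cases i) (auto simp: run_def split: if_splits)
qed (simp add: run_def)

lemma run_le: "run a w \<le> length w"
  by (simp add: run_def length_takeWhile_le)

lemma run_eq_replicate: "i \<le> run a w \<longleftrightarrow> i \<le> length w \<and> take i w = replicate i a"
proof (induction w arbitrary: i)
  case (Cons b w)
  then show ?case by (cases i) (auto simp: run_def)
qed (simp add: run_def)

lemma flow_series_cong:
  "(\<And>v. length v \<le> length w \<Longrightarrow> c v = d v) \<Longrightarrow> flow_series a t c w = flow_series a t d w"
  by (simp add: flow_series_def)

lemma flow_series_sum:
  "flow_series a t (\<lambda>w. \<Sum>k\<in>K. f k * c k w) = (\<lambda>w. \<Sum>k\<in>K. f k * flow_series a t (c k) w)"
  unfolding flow_series_def sum_distrib_left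
  by (rule ext, subst sum.swap) (simp add: mult_ac)

text \<open>Dropping \<open>j\<close> letters after \<open>i\<close> letters has weight
  \<open>(- t) ^ i * t ^ j / (fact i * fact j)\<close>. For \<open>i + j = n\<close> these weights
  add up to \<open>(- t + t) ^ n / fact n\<close>, which vanishes unless \<open>n = 0\<close>.
  Formally, the step \<open>- t\<close> undoes the step \<open>t\<close>.\<close>

lemma flow_series_inverse: "flow_series a (- t) (flow_series a t c) w = c w"
proof -
  let ?r = "run a w"
  let ?f = "\<lambda>i j. (- t) ^ i / fact i * (t ^ j / fact j * c (drop (i + j) w))"
  have "flow_series a (- t) (flow_series a t c) w = (\<Sum>i\<le>?r. \<Sum>j\<le>?r - i. ?f i j)"
    unfolding flow_series_def
    by (rule sum.cong[OF refl]) (simp add: run_drop sum_distrib_left add.commute)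
  also have "\<dots> = (\<Sum>(i, j)\<in>{(i, j). i + j \<le> ?r}. ?f i j)"
    by (subst sum.Sigma) (auto intro!: sum.cong)
  also have "\<dots> = (\<Sum>n\<le>?r. \<Sum>i\<le>n. ?f i (n - i))"
    by (rule sum.triangle_reindex_eq)
  also have "\<dots> = (\<Sum>n\<le>?r. (- t + t) ^ n / fact n * c (drop n w))"
  proof (rule sum.cong[OF refl])
    fix n
    have "(\<Sum>i\<le>n. ?f i (n - i)) = (\<Sum>i\<le>n. real (n choose i) * (- t) ^ i * t ^ (n - i)) / fact n * c (drop n w)"
      unfolding sum_divide_distrib sum_distrib_right
      by (rule sum.cong[OF refl]) (simp add: binomial_fact)
    also have "(\<Sum>i\<le>n. real (n choose i) * (- t) ^ i * t ^ (n - i)) = (- t + t) ^ n"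
      by (rule binomial_ring[symmetric])
    finally show "(\<Sum>i\<le>n. ?f i (n - i)) = (- t + t) ^ n / fact n * c (drop n w)" .
  qed
  also have "\<dots> = c w"
    by (subst sum.atMost_shift) (simp add: power_0_left)
  finally show ?thesis .
qed

text \<open>The substitution of \<open>- h\<close> for \<open>h\<close> in a word series, since a
  word of length \<open>j\<close> is paired with \<open>h ^ j\<close>.\<close>

definition twist :: "(bool list \<Rightarrow> real) \<Rightarrow> bool list \<Rightarrow> real" where
  "twist c w = (- 1) ^ length w * c w"

lemma flow_series_twist: "flow_series a t (twist c) w = twist (flow_series a (- t) c) w"
  unfolding flow_series_def twist_def sum_distrib_left
proof (rule sum.cong[OF refl])
  fix i assume "i \<in> {..run a w}"
  then have "i \<le> length w" using run_le le_trans by blast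
  then have "(- 1 :: real) ^ length w = (- 1) ^ i * (- 1) ^ (length w - i)"
    by (simp flip: power_add)
  then have "(- 1 :: real) ^ length w * (- t) ^ i = (- 1) ^ (length w - i) * t ^ i"
    by (simp add: power_minus[of t])
  then show "t ^ i / fact i * ((- 1) ^ length (drop i w) * c (drop i w)) =
      (- 1) ^ length w * ((- t) ^ i / fact i * c (drop i w))"
    by (simp add: mult_ac)
qed

text \<open>A term that drops more than \<open>length w - n\<close> letters evaluates
  \<open>c\<close> on a word where it vanishes. Up to length \<open>n\<close> this leaves the
  undropped term, and at length \<open>Suc n\<close> one more, present exactly if the first letter
  belongs to this flow.\<close>

lemma flow_series_low:
  assumes "\<And>v. length v < n \<Longrightarrow> c v = 0"
  shows "length w \<le> n \<Longrightarrow> flow_series a t c w = c w"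
    and "length w = Suc n \<Longrightarrow> flow_series a t c w = c w + (if hd w = a then t * c (tl w) else 0)"
proof -
  assume w: "length w \<le> n"
  have "(\<Sum>i\<le>run a w. t ^ i / fact i * c (drop i w)) = (\<Sum>i\<in>{0}. t ^ i / fact i * c (drop i w))"
    using w run_le[of a w] by (intro sum.mono_neutral_right) (auto intro!: assms)
  then show "flow_series a t c w = c w" by (simp add: flow_series_def)
next
  assume w: "length w = Suc n"
  then obtain b v where bv: "w = b # v" by (cases w) auto
  have "(\<Sum>i\<le>run a w. t ^ i / fact i * c (drop i w)) =
      (\<Sum>i\<in>(if hd w = a then {0, 1} else {0}). t ^ i / fact i * c (drop i w))"
    using w run_le[of a w] by (intro sum.mono_neutral_right) (auto simp: bv run_def intro!: assms)
  then show "flow_series a t c w = c w + (if hd w = a then t * c (tl w) else 0)"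
    by (auto simp: flow_series_def bv)
qed

section \<open>Powers of one splitting step\<close>

definition empty_word :: "bool list \<Rightarrow> real" where
  "empty_word w = (if w = [] then 1 else 0)"

text \<open>The effect on coefficients of precomposing with the flow of \<open>a\<close> after the
  flow of \<open>b\<close>. Precomposition stacks outwards, so the flow that meets the data first,
  that of \<open>b\<close>, is the outer operator.\<close>

definition step_series :: "bool \<Rightarrow> bool \<Rightarrow> (bool list \<Rightarrow> real) \<Rightarrow> bool list \<Rightarrow> real" where
  "step_series a b c = flow_series b 1 (flow_series a 1 c)"

definition step_diff :: "bool \<Rightarrow> bool \<Rightarrow> (bool list \<Rightarrow> real) \<Rightarrow> bool list \<Rightarrow> real" where
  "step_diff a b c w = step_series a b c w - c w"

text \<open>The power \<open>(1 + step_diff a b) ^ x\<close> applied to the identity method. The sum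
  is finite because powers beyond \<open>length w\<close> vanish at \<open>w\<close>, and it makes
  sense for every real \<open>x\<close>; negative \<open>x\<close> will describe the adjoint
  splitting.\<close>

definition binomial_series :: "bool \<Rightarrow> bool \<Rightarrow> real \<Rightarrow> bool list \<Rightarrow> real" where
  "binomial_series a b x w = (\<Sum>k\<le>length w. (x gchoose k) * (step_diff a b ^^ k) empty_word w)"

lemma step_series_cong:
  "(\<And>v. length v \<le> length w \<Longrightarrow> c v = d v) \<Longrightarrow> step_series a b c w = step_series a b d w"
  unfolding step_series_def by (intro flow_series_cong) (meson flow_series_cong le_trans)

lemma step_series_sum:
  "step_series a b (\<lambda>w. \<Sum>k\<in>K. f k * c k w) w = (\<Sum>k\<in>K. f k * step_series a b (c k) w)"
  unfolding step_series_def by (simp add: flow_series_sum)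

text \<open>With \<open>a \<noteq> b\<close> the first letter of a word belongs to exactly one of
  the two flows. At the first length where anything can change, precisely one of them strips that
  letter, with weight 1.\<close>

lemma step_diff_low:
  assumes "a \<noteq> b" and c: "\<And>v. length v < n \<Longrightarrow> c v = 0"
  shows "length w \<le> n \<Longrightarrow> step_diff a b c w = 0"
    and "length w = Suc n \<Longrightarrow> step_diff a b c w = c (tl w)"
proof -
  have d: "flow_series a 1 c v = 0" if "length v < n" for v
    using flow_series_low(1)[of n c v a 1] c that by simp
  note 1 = flow_series_low[of n c, OF c] and 2 = flow_series_low[of n "flow_series a 1 c", OF d]
  show "length w \<le> n \<Longrightarrow> step_diff a b c w = 0"
    by (simp add: step_diff_def step_series_def 1 2)
  assume w: "length w = Suc n"
  have "step_series a b c w = flow_series a 1 c w + (if hd w = b then flow_series a 1 c (tl w) else 0)"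
    using flow_series_low(2)[of n "flow_series a 1 c" w b 1] d w by (simp add: step_series_def)
  moreover have "flow_series a 1 c w = c w + (if hd w = a then c (tl w) else 0)"
    using flow_series_low(2)[of n c w a 1] c w by simp
  moreover have "flow_series a 1 c (tl w) = c (tl w)"
    using flow_series_low(1)[of n c "tl w" a 1] c w by simp
  moreover have "hd w = a \<longleftrightarrow> hd w \<noteq> b" using assms(1) by (cases "hd w"; cases a; cases b) auto
  ultimately show "step_diff a b c w = c (tl w)"
    by (cases "hd w = b") (simp_all add: step_diff_def)
qed

lemma step_diff_funpow_0:
  assumes "a \<noteq> b"
  shows "length w < k \<Longrightarrow> (step_diff a b ^^ k) empty_word w = 0"
proof (induction k arbitrary: w)
  case (Suc k)
  then show ?case using step_diff_low(1)[OF assms, of k "(step_diff a b ^^ k) empty_word" w] by simp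
qed simp

text \<open>Each application strips one letter with weight 1, so the \<open>k\<close>-th power
  arrives at the empty word. Together with the leading coefficient of \<open>x gchoose k\<close>
  this produces the coefficient \<open>1 / fact k\<close> of the exact flow.\<close>

lemma step_diff_funpow_1:
  assumes "a \<noteq> b"
  shows "length w = k \<Longrightarrow> (step_diff a b ^^ k) empty_word w = 1"
proof (induction k arbitrary: w)
  case 0
  then show ?case by (simp add: empty_word_def)
next
  case (Suc k)
  then show ?case
    using step_diff_low(2)[OF assms, of k "(step_diff a b ^^ k) empty_word" w]
      step_diff_funpow_0[OF assms, of _ k] by simp
qed

lemma binomial_series_0: "binomial_series a b 0 = empty_word"
proof
  fix w
  have "(\<Sum>k\<le>length w. (0 gchoose k) * (step_diff a b ^^ k) empty_word w) =
      (\<Sum>k\<in>{0}. (0 gchoose k) * (step_diff a b ^^ k) empty_word w)"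
    by (rule sum.mono_neutral_right) (auto simp: gbinomial_0_left)
  then show "binomial_series a b 0 w = empty_word w" by (simp add: binomial_series_def)
qed

text \<open>Pascal's rule for generalized binomial coefficients: multiplying
  \<open>(1 + step_diff a b) ^ x\<close> by one more factor raises the exponent by 1.\<close>

lemma step_binomial_series:
  assumes "a \<noteq> b"
  shows "step_series a b (binomial_series a b x) = binomial_series a b (x + 1)"
proof
  fix w :: "bool list"
  let ?n = "length w" and ?q = "\<lambda>k. (step_diff a b ^^ k) empty_word"
  \<comment> \<open>The step evaluates its argument on words no longer than \<open>w\<close>. One
    common truncation therefore replaces the one that depends on the word, and linearity
    applies.\<close>
  have "step_series a b (binomial_series a b x) w =
      step_series a b (\<lambda>w. \<Sum>k\<le>?n. (x gchoose k) * ?q k w) w"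
  proof (rule step_series_cong)
    fix v :: "bool list" assume "length v \<le> ?n"
    then show "binomial_series a b x v = (\<Sum>k\<le>?n. (x gchoose k) * ?q k v)"
      unfolding binomial_series_def
      by (intro sum.mono_neutral_left) (auto simp: step_diff_funpow_0[OF assms])
  qed
  also have "\<dots> = (\<Sum>k\<le>?n. (x gchoose k) * step_series a b (?q k) w)" by (rule step_series_sum)
  also have "\<dots> = (\<Sum>k\<le>?n. (x gchoose k) * (?q k w + ?q (Suc k) w))"
    by (simp add: step_diff_def)
  also have "\<dots> = (\<Sum>k\<le>?n. (x gchoose k) * ?q k w) + (\<Sum>k\<le>?n. (x gchoose k) * ?q (Suc k) w)"
    by (simp only: distrib_left sum.distrib)
  also have "(\<Sum>k\<le>?n. (x gchoose k) * ?q (Suc k) w) = (\<Sum>k<?n. (x gchoose k) * ?q (Suc k) w)"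
    by (rule sum.mono_neutral_right)
      (use step_diff_funpow_0[OF assms, of w "Suc (length w)"] in \<open>auto simp: not_less simp del: funpow.simps\<close>)
  also have "(\<Sum>k\<le>?n. (x gchoose k) * ?q k w) = ?q 0 w + (\<Sum>k<?n. (x gchoose Suc k) * ?q (Suc k) w)"
    by (subst sum.atMost_shift) simp
  also have "?q 0 w + (\<Sum>k<?n. (x gchoose Suc k) * ?q (Suc k) w) + (\<Sum>k<?n. (x gchoose k) * ?q (Suc k) w) =
      ?q 0 w + (\<Sum>k<?n. ((x + 1) gchoose Suc k) * ?q (Suc k) w)"
    by (simp only: gbinomial_Suc_Suc distrib_right sum.distrib)
  also have "\<dots> = binomial_series a b (x + 1) w"
    unfolding binomial_series_def by (subst sum.atMost_shift) simp
  finally show "step_series a b (binomial_series a b x) w = binomial_series a b (x + 1) w" .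
qed

lemma funpow_step_series:
  assumes "a \<noteq> b"
  shows "(step_series a b ^^ m) empty_word = binomial_series a b (real m)"
proof (induction m)
  case (Suc m)
  then show ?case using step_binomial_series[OF assms, of "real m"] by (simp add: add.commute)
qed (simp add: binomial_series_0)

text \<open>A twist turns a flow of step 1 into one of step -1. The inner operator of
  \<open>step_series b a\<close> belongs to \<open>b\<close>, which is the outer one in
  \<open>step_series a b\<close>, so the two pairs cancel from the inside out.\<close>

lemma step_series_twist: "step_series b a (twist (step_series a b c)) = twist c"
proof
  fix w
  have *: "flow_series d 1 (twist c) = twist (flow_series d (- 1) c)" for d c
    by (rule ext) (rule flow_series_twist)
  have i: "flow_series d (- 1) (flow_series d 1 c) = c" for d c
    by (rule ext) (rule flow_series_inverse)
  show "step_series b a (twist (step_series a b c)) w = twist c w"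
    unfolding step_series_def * i ..
qed

text \<open>Formally, the adjoint method is the inverse of the method with the opposite step.\<close>

lemma funpow_step_series_adjoint:
  assumes "a \<noteq> b"
  shows "(step_series b a ^^ m) empty_word = twist (binomial_series a b (- real m))"
proof (induction m)
  case 0
  then show ?case by (auto simp: binomial_series_0 twist_def empty_word_def)
next
  case (Suc m)
  have "binomial_series a b (- real m) = step_series a b (binomial_series a b (- real (Suc m)))"
    using step_binomial_series[OF assms, of "- real (Suc m)"] by simp
  then show ?case using Suc step_series_twist[of b a] by simp
qed

section \<open>Polynomials in the number of steps and the order conditions\<close>

lemma gbinomial_poly:
  "\<exists>P. degree P \<le> k \<and> coeff P k = 1 / fact k \<and> (\<forall>x::real. poly P x = x gchoose k)"
proof (induction k)
  case 0
  then show ?case by (intro exI[of _ 1]) auto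
next
  case (Suc k)
  then obtain P where P: "degree P \<le> k" "coeff P k = 1 / fact k" "\<And>x::real. poly P x = x gchoose k" by blast
  define Q where "Q = smult (1 / real (Suc k)) ([:- real k, 1:] * P)"
  have "poly Q x = x gchoose Suc k" for x
    using gbinomial_mult_1[of x k] by (simp add: Q_def P(3) field_simps)
  moreover have "degree Q \<le> Suc k"
    using P(1) degree_mult_le[of "[:- real k, 1:]" P] by (simp add: Q_def)
  moreover have "coeff Q (Suc k) = 1 / fact (Suc k)"
    using P(1,2) by (simp add: Q_def coeff_pCons coeff_eq_0)
  ultimately show ?case by blast
qed

text \<open>Only \<open>k = length w\<close> reaches the top degree, where the operator power is 1
  and the binomial polynomial has leading coefficient \<open>1 / fact (length w)\<close>. At
  \<open>x = 0\<close> the series is that of the identity, so nonempty words have no constant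
  term.\<close>

lemma binomial_series_poly:
  assumes "a \<noteq> b"
  obtains p where "\<And>x. binomial_series a b x w = (\<Sum>i\<le>length w. p i * x ^ i)"
    "p (length w) = 1 / fact (length w)" "w \<noteq> [] \<Longrightarrow> p 0 = 0"
proof -
  let ?n = "length w"
  obtain P where P: "\<And>k. degree (P k) \<le> k" "\<And>k. coeff (P k) k = 1 / fact k"
    "\<And>k x::real. poly (P k) x = x gchoose k"
    using gbinomial_poly by metis
  define q where "q k = (step_diff a b ^^ k) empty_word w" for k
  define R where "R = (\<Sum>k\<le>?n. smult (q k) (P k))"
  have R: "poly R x = binomial_series a b x w" for x
    by (simp add: R_def binomial_series_def poly_sum P(3) q_def mult.commute)
  have deg: "degree R \<le> ?n"
    unfolding R_def using P(1) by (intro degree_sum_le) (auto intro: order_trans[OF degree_smult_le] order_trans[OF P(1)])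
  have "coeff R ?n = (\<Sum>k\<le>?n. q k * coeff (P k) ?n)" by (simp add: R_def coeff_sum)
  also have "\<dots> = (\<Sum>k\<in>{?n}. q k * coeff (P k) ?n)"
  proof (rule sum.mono_neutral_right)
    have "coeff (P k) ?n = 0" if "k < ?n" for k
      using P(1)[of k] that by (intro coeff_eq_0) auto
    then show "\<forall>k\<in>{..?n} - {?n}. q k * coeff (P k) ?n = 0" by auto
  qed auto
  also have "\<dots> = 1 / fact ?n" using step_diff_funpow_1[OF assms refl, of w] by (simp add: q_def P(2))
  finally have top: "coeff R ?n = 1 / fact ?n" .
  have "poly R x = (\<Sum>i\<le>?n. coeff R i * x ^ i)" for x
    unfolding poly_altdef using deg by (intro sum.mono_neutral_left) (auto simp: coeff_eq_0)
  moreover have "coeff R 0 = 0" if "w \<noteq> []"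
    using R[of 0] that by (simp add: poly_0_coeff_0 binomial_series_0 empty_word_def)
  ultimately show ?thesis using that[of "coeff R"] R top by metis
qed

lemma asymmetric_series:
  assumes "a \<noteq> b" and \<gamma>: "asymmetric_conditions q s \<gamma>" and w: "length w \<le> q"
  shows "(\<Sum>m=1..s. \<gamma> m * ((step_series a b ^^ m) empty_word w / real m ^ length w)) = 1 / fact (length w)"
proof -
  let ?n = "length w"
  obtain p where p: "\<And>x. binomial_series a b x w = (\<Sum>i\<le>?n. p i * x ^ i)"
    "p ?n = 1 / fact ?n" "w \<noteq> [] \<Longrightarrow> p 0 = 0"
    using binomial_series_poly[OF assms(1), of w] by blast
  have "(\<Sum>m=1..s. \<gamma> m * ((step_series a b ^^ m) empty_word w / real m ^ ?n)) =
      (\<Sum>m=1..s. \<Sum>i\<le>?n. p i * (\<gamma> m / real m ^ (?n - i)))"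
  proof (rule sum.cong[OF refl])
    fix m assume "m \<in> {1..s}"
    then have m: "real m ^ ?n = real m ^ i * real m ^ (?n - i)" "real m \<noteq> 0" if "i \<le> ?n" for i
      using that by (auto simp flip: power_add)
    have "\<gamma> m * ((step_series a b ^^ m) empty_word w / real m ^ ?n) =
        (\<Sum>i\<le>?n. \<gamma> m * (p i * real m ^ i / real m ^ ?n))"
      by (simp add: funpow_step_series[OF assms(1)] p(1) sum_distrib_left sum_divide_distrib)
    also have "\<dots> = (\<Sum>i\<le>?n. p i * (\<gamma> m / real m ^ (?n - i)))"
      by (rule sum.cong[OF refl]) (use m in auto)
    finally show "\<gamma> m * ((step_series a b ^^ m) empty_word w / real m ^ ?n) =
       (\<Sum>i\<le>?n. p i * (\<gamma> m / real m ^ (?n - i)))" .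
  qed
  also have "\<dots> = (\<Sum>i\<le>?n. p i * (\<Sum>m=1..s. \<gamma> m / real m ^ (?n - i)))"
    by (subst sum.swap) (simp add: sum_distrib_left)
  also have "\<dots> = (\<Sum>i\<in>{?n}. p i * (\<Sum>m=1..s. \<gamma> m / real m ^ (?n - i)))"
  proof (rule sum.mono_neutral_right)
    show "\<forall>i\<in>{..?n} - {?n}. p i * (\<Sum>m=1..s. \<gamma> m / real m ^ (?n - i)) = 0"
    proof
      fix i assume i: "i \<in> {..?n} - {?n}"
      show "p i * (\<Sum>m=1..s. \<gamma> m / real m ^ (?n - i)) = 0"
      proof (cases "i = 0")
        case True
        then show ?thesis using p(3) i by auto
      next
        case False
        \<comment> \<open>The index \<open>i = 0\<close> has gone with the constant term. So
          \<open>length w - i\<close> lies between 1 and \<open>q - 1\<close> even for words of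
          length \<open>q\<close>, which is the range of the conditions.\<close>
        then have "1 \<le> ?n - i" "?n - i \<le> q - 1" using i w by auto
        then show ?thesis using \<gamma> by (simp add: asymmetric_conditions_def)
      qed
    qed
  qed auto
  also have "\<dots> = 1 / fact ?n" using \<gamma> p(2) by (simp add: asymmetric_conditions_def)
  finally show ?thesis .
qed

lemma symmetric_series:
  assumes "a \<noteq> b" and \<gamma>: "symmetric_conditions n s \<gamma>" and w: "length w \<le> 2 * n"
  shows "(\<Sum>m=1..s. \<gamma> m * (((step_series a b ^^ m) empty_word w + (step_series b a ^^ m) empty_word w)
            / real m ^ length w)) = 1 / fact (length w)"
proof -
  let ?n = "length w"
  obtain p where p: "\<And>x. binomial_series a b x w = (\<Sum>i\<le>?n. p i * x ^ i)"
    "p ?n = 1 / fact ?n" "w \<noteq> [] \<Longrightarrow> p 0 = 0"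
    using binomial_series_poly[OF assms(1), of w] by blast
  \<comment> \<open>The twist contributes \<open>(- 1) ^ length w\<close> and the argument
    \<open>- m\<close> contributes \<open>(- 1) ^ i\<close>. The factor vanishes for odd
    \<open>length w - i\<close>, and in the top degree it is 2, matching the weight sum
    \<open>1 / 2\<close>.\<close>
  let ?e = "\<lambda>i. 1 + (- 1) ^ (?n + i)"
  have "(\<Sum>m=1..s. \<gamma> m * (((step_series a b ^^ m) empty_word w + (step_series b a ^^ m) empty_word w)
            / real m ^ ?n)) =
      (\<Sum>m=1..s. \<Sum>i\<le>?n. p i * ?e i * (\<gamma> m / real m ^ (?n - i)))"
  proof (rule sum.cong[OF refl])
    fix m assume "m \<in> {1..s}"
    then have m: "real m ^ ?n = real m ^ i * real m ^ (?n - i)" "real m \<noteq> 0" if "i \<le> ?n" for i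
      using that by (auto simp flip: power_add)
    have "(step_series a b ^^ m) empty_word w + (step_series b a ^^ m) empty_word w =
        (\<Sum>i\<le>?n. p i * ?e i * real m ^ i)"
      by (simp add: funpow_step_series[OF assms(1)] funpow_step_series_adjoint[OF assms(1)] twist_def p(1)
          sum_distrib_left power_minus[of "real m"] power_add algebra_simps sum.distrib)
    then have "\<gamma> m * (((step_series a b ^^ m) empty_word w + (step_series b a ^^ m) empty_word w) / real m ^ ?n) =
        (\<Sum>i\<le>?n. \<gamma> m * (p i * ?e i * real m ^ i / real m ^ ?n))"
      by (simp only: sum_distrib_left sum_divide_distrib)
    also have "\<dots> = (\<Sum>i\<le>?n. p i * ?e i * (\<gamma> m / real m ^ (?n - i)))"
      by (rule sum.cong[OF refl]) (use m in auto)
    finally show "\<gamma> m * (((step_series a b ^^ m) empty_word w + (step_series b a ^^ m) empty_word w) / real m ^ ?n) =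
       (\<Sum>i\<le>?n. p i * ?e i * (\<gamma> m / real m ^ (?n - i)))" .
  qed
  also have "\<dots> = (\<Sum>i\<le>?n. p i * ?e i * (\<Sum>m=1..s. \<gamma> m / real m ^ (?n - i)))"
    by (subst sum.swap) (simp add: sum_distrib_left)
  also have "\<dots> = (\<Sum>i\<in>{?n}. p i * ?e i * (\<Sum>m=1..s. \<gamma> m / real m ^ (?n - i)))"
  proof (rule sum.mono_neutral_right)
    show "\<forall>i\<in>{..?n} - {?n}. p i * ?e i * (\<Sum>m=1..s. \<gamma> m / real m ^ (?n - i)) = 0"
    proof
      fix i assume i: "i \<in> {..?n} - {?n}"
      show "p i * ?e i * (\<Sum>m=1..s. \<gamma> m / real m ^ (?n - i)) = 0"
      proof (cases "i = 0 \<or> odd (?n + i)")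
        case True
        then show ?thesis using p(3) i by auto
      next
        case False
        then have "even (?n - i)" using i by auto
        then obtain k where k: "?n - i = 2 * k" by blast
        then have "1 \<le> k" "k \<le> n - 1" using i w False by auto
        then show ?thesis using \<gamma> by (simp add: symmetric_conditions_def k)
      qed
    qed
  qed auto
  also have "\<dots> = 1 / fact ?n" using \<gamma> p(2) by (simp add: symmetric_conditions_def flip: mult_2)
  finally show ?thesis .
qed

section \<open>Taylor expansion along flows and their compositions\<close>

locale vector_fields = scale_of_spaces Hs ip
  for Hs :: "nat \<Rightarrow> 'a::real_inner set" and ip +
  fixes V :: "'a set" and B :: "bool \<Rightarrow> 'a \<Rightarrow> 'a list \<Rightarrow> 'a"
  assumes B: "vector_field V (B a)" and V: "open V" "convex V"
begin

text \<open>The functions obtained from the identity by repeated differentiation along the fields;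
  the index counts the levels of the scale that are lost.\<close>

inductive differential :: "nat \<Rightarrow> ('a \<Rightarrow> 'a) \<Rightarrow> bool" where
  ident: "differential 0 (\<lambda>u. u)"
| zero: "differential n (\<lambda>u. 0)"
| add: "differential n f \<Longrightarrow> differential n g \<Longrightarrow> differential n (\<lambda>u. f u + g u)"
| weaken: "differential n f \<Longrightarrow> differential (Suc n) f"
| field: "(\<And>f. f \<in> set fs \<Longrightarrow> differential n f) \<Longrightarrow> differential (Suc n) (\<lambda>u. B a u (map (\<lambda>f. f u) fs))"

lemma differential_cv:
  assumes "differential n f" "u \<in> V" "cv (n + l) c u F"
  shows "cv l (\<lambda>x. f (c x)) (f u) F"
  using assms(1,3)
proof (induction arbitrary: l rule: differential.induct)
  case (zero n)
  then show ?case by simp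
next
  case (add n f g)
  then show ?case by (intro cv_add) auto
next
  case (weaken n f)
  have "cv (n + l) c u F" by (rule cv_mono[OF _ weaken.prems]) simp
  then show ?case by (rule weaken.IH)
next
  case (field fs n a)
  have "cv l (\<lambda>x. B a (c x) (map (\<lambda>f. f x) (map (\<lambda>f x. f (c x)) fs))) (B a u (map (\<lambda>f. f u) fs)) F"
  proof (rule vector_field_cont[OF B V(1) assms(2)])
    show "cv (Suc l) c u F" by (rule cv_mono[OF _ field.prems]) simp
    show "list_all2 (\<lambda>f v. cv (Suc l) f v F) (map (\<lambda>f x. f (c x)) fs) (map (\<lambda>f. f u) fs)"
      using field.IH[of _ "Suc l"] field.prems by (auto simp: list_all2_map1 list_all2_map2 list_all2_same)
  qed
  then show ?case by (simp add: o_def)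
qed simp

lemma differential_in:
  assumes "differential n f" "u \<in> V \<inter> Hs (n + l)" shows "f u \<in> Hs l"
  using differential_cv[OF assms(1), of u l "\<lambda>_::unit. u" bot] assms(2) by (auto dest: cv_in)

lemma differential_leibniz:
  assumes "\<And>f. f \<in> set ps \<Longrightarrow> differential n f" "\<And>f. f \<in> set fs \<Longrightarrow> differential n f \<and> differential n (h f)"
  shows "differential (Suc n) (\<lambda>u. leibniz (B a u) (map (\<lambda>f. f u) ps) (zip (map (\<lambda>f. f u) fs) (map (\<lambda>f. h f u) fs)))"
  using assms
proof (induction fs arbitrary: ps)
  case Nil
  then show ?case by (simp add: zero)
next
  case (Cons f fs)
  have 1: "differential (Suc n) (\<lambda>u. B a u (map (\<lambda>f. f u) (ps @ h f # fs)))"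
    using Cons.prems by (intro field) auto
  have 2: "differential (Suc n) (\<lambda>u. leibniz (B a u) (map (\<lambda>f. f u) (ps @ [f])) (zip (map (\<lambda>f. f u) fs) (map (\<lambda>f. h f u) fs)))"
    using Cons.prems by (intro Cons.IH) auto
  have "map fst (zip (map (\<lambda>f. f u) fs) (map (\<lambda>f. h f u) fs)) = map (\<lambda>f. f u) fs" for u
    by simp
  then show ?case using add[OF 1 2] by simp
qed

text \<open>Both derivations are tested at once, along curves whose velocity is any combination of
  the two fields. The weights \<open>(1, 0)\<close> and \<open>(0, 1)\<close> belong to the partial
  flows, \<open>(1, 1)\<close> to the full flow.\<close>

definition is_derivative :: "nat \<Rightarrow> ('a \<Rightarrow> 'a) \<Rightarrow> (bool \<Rightarrow> 'a \<Rightarrow> 'a) \<Rightarrow> bool" where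
  "is_derivative n f g \<longleftrightarrow>
     (\<forall>l c x y t I. c t \<in> V \<inter> Hs (Suc (n + l)) \<longrightarrow>
        der (n + l) c (x *\<^sub>R B False (c t) [] + y *\<^sub>R B True (c t) []) t I \<longrightarrow>
        der l (\<lambda>s. f (c s)) (x *\<^sub>R g False (c t) + y *\<^sub>R g True (c t)) t I)"

text \<open>Induction over the construction of \<open>f\<close>. The derivative of a
  \<open>field\<close> term is again a sum of such terms, one for the moving base point and one for
  each argument, and costs one more level.\<close>

lemma differential_derivative:
  assumes "differential n f"
  shows "\<exists>g. (\<forall>b. differential (Suc n) (g b)) \<and> is_derivative n f g"
  using assms
proof (induction rule: differential.induct)
  case ident
  have "differential (Suc 0) (\<lambda>u. B b u [])" for b using field[of "[]" 0 b] by simp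
  then show ?case by (intro exI[of _ "\<lambda>b u. B b u []"]) (simp add: is_derivative_def)
next
  case (zero n)
  show ?case
    by (intro exI[of _ "\<lambda>b u. 0"]) (simp add: is_derivative_def differential.zero der_def)
next
  case (add n f f')
  then obtain g g' where "\<forall>b. differential (Suc n) (g b)" "\<forall>b. differential (Suc n) (g' b)"
    and g: "is_derivative n f g" "is_derivative n f' g'" by blast
  moreover have "is_derivative n (\<lambda>u. f u + f' u) (\<lambda>b u. g b u + g' b u)"
    unfolding is_derivative_def
  proof (intro allI impI)
    fix l c x y t I assume "c t \<in> V \<inter> Hs (Suc (n + l))"
      "der (n + l) c (x *\<^sub>R B False (c t) [] + y *\<^sub>R B True (c t) []) t I"
    then have "der l (\<lambda>s. f (c s)) (x *\<^sub>R g False (c t) + y *\<^sub>R g True (c t)) t I"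
      "der l (\<lambda>s. f' (c s)) (x *\<^sub>R g' False (c t) + y *\<^sub>R g' True (c t)) t I"
      using g unfolding is_derivative_def by blast+
    from der_add[OF this]
    show "der l (\<lambda>s. f (c s) + f' (c s)) (x *\<^sub>R (g False (c t) + g' False (c t)) + y *\<^sub>R (g True (c t) + g' True (c t))) t I"
      by (simp add: algebra_simps)
  qed
  ultimately show ?case by (intro exI[of _ "\<lambda>b u. g b u + g' b u"]) (simp add: differential.add)
next
  case (weaken n f)
  then obtain g where g: "\<forall>b. differential (Suc n) (g b)" "is_derivative n f g" by blast
  have "is_derivative (Suc n) f g"
    unfolding is_derivative_def
  proof (intro allI impI)
    fix l c x y t I assume ct: "c t \<in> V \<inter> Hs (Suc (Suc n + l))"
      and c: "der (Suc n + l) c (x *\<^sub>R B False (c t) [] + y *\<^sub>R B True (c t) []) t I"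
    have "der (n + l) c (x *\<^sub>R B False (c t) [] + y *\<^sub>R B True (c t) []) t I"
      by (rule der_mono[OF _ c]) simp
    moreover have "c t \<in> V \<inter> Hs (Suc (n + l))" using ct Hs_antimono[of "Suc (n + l)" "Suc (Suc n + l)"] by auto
    ultimately show "der l (\<lambda>s. f (c s)) (x *\<^sub>R g False (c t) + y *\<^sub>R g True (c t)) t I"
      using g(2) unfolding is_derivative_def by blast
  qed
  then show ?case using g(1) differential.weaken by blast
next
  case (field fs n a)
  then obtain G where G: "\<And>f b. f \<in> set fs \<Longrightarrow> differential (Suc n) (G f b)" "\<And>f. f \<in> set fs \<Longrightarrow> is_derivative n f (G f)"
    by metis
  define g where "g b u = B a u (B b u [] # map (\<lambda>f. f u) fs) +
      leibniz (B a u) [] (zip (map (\<lambda>f. f u) fs) (map (\<lambda>f. G f b u) fs))" for b u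
  have "differential (Suc (Suc n)) (g b)" for b
  proof -
    have A: "differential (Suc n) (\<lambda>u. B b u [])" using differential.field[of "[]" n b] by simp
    have "differential (Suc (Suc n)) (\<lambda>u. B a u (map (\<lambda>f. f u) ((\<lambda>u. B b u []) # fs)))"
      by (rule differential.field) (use A field.hyps differential.weaken in auto)
    moreover have "differential (Suc (Suc n)) (\<lambda>u. leibniz (B a u) (map (\<lambda>f. f u) [])
         (zip (map (\<lambda>f. f u) fs) (map (\<lambda>f. (\<lambda>f. G f b) f u) fs)))"
      using field.hyps G(1) differential.weaken by (intro differential_leibniz) auto
    ultimately show ?thesis unfolding g_def using differential.add by force
  qed
  moreover have "is_derivative (Suc n) (\<lambda>u. B a u (map (\<lambda>f. f u) fs)) g"
    unfolding is_derivative_def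
  proof (intro allI impI)
    fix l c x y t I assume ct: "c t \<in> V \<inter> Hs (Suc (Suc n + l))"
      and c: "der (Suc n + l) c (x *\<^sub>R B False (c t) [] + y *\<^sub>R B True (c t) []) t I"
    let ?u = "c t"
    define c' where "c' = x *\<^sub>R B False ?u [] + y *\<^sub>R B True ?u []"
    have c1: "der (Suc l) c c' t I" unfolding c'_def by (rule der_mono[OF _ c]) simp
    have sub: "?u \<in> V \<inter> Hs k" if "k \<le> Suc (Suc n + l)" for k using ct Hs_antimono[OF that] by auto
    have fin: "f ?u \<in> Hs (Suc l)" if "f \<in> set fs" for f
      using differential_in[OF field.hyps(1)[OF that], of ?u "Suc l"] sub[of "n + Suc l"] by simp
    have d: "list_all2 (\<lambda>f f'. der (Suc l) f f' t I \<and> f t \<in> Hs (Suc l)) (map (\<lambda>f s. f (c s)) fs)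
        (map (\<lambda>f. x *\<^sub>R G f False ?u + y *\<^sub>R G f True ?u) fs)"
    proof (unfold list_all2_map1 list_all2_map2 list_all2_same, intro ballI conjI)
      fix f assume f: "f \<in> set fs"
      have "c t \<in> V \<inter> Hs (Suc (n + Suc l))" "der (n + Suc l) c (x *\<^sub>R B False ?u [] + y *\<^sub>R B True ?u []) t I"
        using ct c by simp_all
      then show "der (Suc l) (\<lambda>s. f (c s)) (x *\<^sub>R G f False ?u + y *\<^sub>R G f True ?u) t I"
        using G(2)[OF f] unfolding is_derivative_def by blast
    qed (rule fin)
    have h: "Hs (Suc l) \<subseteq> Hs 1" by (rule Hs_antimono) simp
    have A: "B b ?u [] \<in> Hs 1" for b
      using vector_field_in[OF B V(1), of ?u 1 "[]" b] sub[of 2] by (simp add: numeral_2_eq_2)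
    have Gin: "G f b ?u \<in> Hs 1" if "f \<in> set fs" for f b
      using differential_in[OF G(1)[OF that], of ?u 1 b] sub[of "Suc n + 1"] by simp
    have "der l (\<lambda>s. B a (c s) (map (\<lambda>f. f s) (map (\<lambda>f s. f (c s)) fs)))
        (B a ?u (c' # map (\<lambda>f. f t) (map (\<lambda>f s. f (c s)) fs)) + leibniz (B a ?u) []
          (zip (map (\<lambda>f. f t) (map (\<lambda>f s. f (c s)) fs)) (map (\<lambda>f. x *\<^sub>R G f False ?u + y *\<^sub>R G f True ?u) fs))) t I"
      by (rule vector_field_chain[OF B V c1 _ d]) (rule sub, simp)
    moreover have "B a ?u (c' # map (\<lambda>f. f ?u) fs) =
        x *\<^sub>R B a ?u (B False ?u [] # map (\<lambda>f. f ?u) fs) + y *\<^sub>R B a ?u (B True ?u [] # map (\<lambda>f. f ?u) fs)"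
      using vector_field_lin[OF B V, of ?u "B False ?u []" "B True ?u []" "[]" "map (\<lambda>f. f ?u) fs" a x y]
        sub[of 1] A fin h by (auto simp: c'_def)
    moreover have "leibniz (B a ?u) [] (zip (map (\<lambda>f. f ?u) fs) (map (\<lambda>f. x *\<^sub>R G f False ?u + y *\<^sub>R G f True ?u) fs)) =
        x *\<^sub>R leibniz (B a ?u) [] (zip (map (\<lambda>f. f ?u) fs) (map (\<lambda>f. G f False ?u) fs)) +
        y *\<^sub>R leibniz (B a ?u) [] (zip (map (\<lambda>f. f ?u) fs) (map (\<lambda>f. G f True ?u) fs))"
      using Gin fin h by (intro leibniz_lin[OF B V sub]) auto
    ultimately show "der l (\<lambda>s. B a (c s) (map (\<lambda>f. f (c s)) fs)) (x *\<^sub>R g False ?u + y *\<^sub>R g True ?u) t I"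
      by (simp add: g_def o_def algebra_simps)
  qed
  ultimately show ?case by blast
qed

text \<open>A choice is made because one function may arise from several constructions in
  \<open>differential\<close>. Later arguments go through \<open>Lie_props\<close>, which holds for
  any admissible choice.\<close>

definition Lie :: "nat \<Rightarrow> ('a \<Rightarrow> 'a) \<Rightarrow> bool \<Rightarrow> 'a \<Rightarrow> 'a" where
  "Lie n f = (SOME g. (\<forall>b. differential (Suc n) (g b)) \<and> is_derivative n f g)"

text \<open>The head of a word is the derivation applied last; it belongs to the flow that acts first on the
  data.\<close>

primrec Lie_word :: "bool list \<Rightarrow> 'a \<Rightarrow> 'a" where
  "Lie_word [] = (\<lambda>u. u)"
| "Lie_word (a # w) = Lie (length w) (Lie_word w) a"

lemma Lie_props:
  assumes "differential n f"
  shows "differential (Suc n) (Lie n f b)" "is_derivative n f (Lie n f)"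
  using someI_ex[OF differential_derivative[OF assms]] unfolding Lie_def by blast+

lemma differential_Lie_word: "differential (length w) (Lie_word w)"
  by (induction w) (auto intro: ident Lie_props)

lemma Lie_word_der:
  assumes "c t \<in> V \<inter> Hs (Suc (length w + l))"
    and "der (length w + l) c (x *\<^sub>R B False (c t) [] + y *\<^sub>R B True (c t) []) t I"
  shows "der l (\<lambda>s. Lie_word w (c s)) (x *\<^sub>R Lie_word (False # w) (c t) + y *\<^sub>R Lie_word (True # w) (c t)) t I"
  using Lie_props(2)[OF differential_Lie_word, of w] assms unfolding is_derivative_def by simp

end

section \<open>Taylor expansion along a flow\<close>

context vector_fields
begin

text \<open>\<open>x\<close> and \<open>y\<close> are the weights of \<open>B False\<close> and
  \<open>B True\<close> in the equation that the flow solves. Continuity near time 0 is asked at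
  every level without loss, the equation with loss of one level and as long as the solution stays in
  \<open>V\<close>, where the fields live.\<close>

definition local_flow :: "real \<Rightarrow> (real \<Rightarrow> 'a \<Rightarrow> 'a) \<Rightarrow> real \<Rightarrow> real \<Rightarrow> bool" where
  "local_flow hs \<psi> x y \<longleftrightarrow> hs > 0 \<and> (\<forall>u\<in>V. \<psi> 0 u = u) \<and>
     (\<forall>k. \<forall>p\<in>V \<inter> Hs k. cv k (\<lambda>(h, u). \<psi> h u) p (germ k p)) \<and>
     (\<forall>l. \<forall>u\<in>V \<inter> Hs (Suc l). \<forall>t\<in>{0..hs}. \<psi> t u \<in> V \<longrightarrow>
        der l (\<lambda>t. \<psi> t u) (x *\<^sub>R B False (\<psi> t u) [] + y *\<^sub>R B True (\<psi> t u) []) t {0..hs})"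

lemma local_flow_germ:
  assumes "local_flow hs \<psi> x y" "p \<in> V \<inter> Hs k"
  shows "filterlim (\<lambda>(h, u). (h, \<psi> h u)) (germ k p) (germ k p)"
proof -
  have "cv k (\<lambda>z. \<psi> (fst z) (snd z)) p (germ k p)"
    using assms by (auto simp: local_flow_def case_prod_unfold)
  moreover have "\<forall>\<^sub>F z in germ k p. 0 \<le> fst z" using eventually_germ_le[of 1 k p] by (auto elim: eventually_mono)
  ultimately show ?thesis using filterlim_germ[OF _ fst_germ] by (simp add: case_prod_unfold)
qed

text \<open>Induction on \<open>k\<close>: the time derivative of the remainder of
  \<open>f 0\<close> is the remainder of the shifted sequence, and the mean value inequality gains
  one power of \<open>h\<close>. The base case is boundedness near \<open>p\<close>, which follows
  from continuity.\<close>

lemma local_flow_taylor: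
  assumes \<psi>: "local_flow hs \<psi> x y" and p: "p \<in> V \<inter> Hs Q"
    and f: "\<And>j. j \<le> k \<Longrightarrow> ((\<lambda>(h, u). f j u) \<longlongrightarrow> f j p) (germ Q p)"
    and f': "\<And>j u t. j < k \<Longrightarrow> u \<in> V \<inter> Hs Q \<Longrightarrow> t \<in> {0..hs} \<Longrightarrow> \<psi> t u \<in> V \<inter> Hs Q \<Longrightarrow>
      der 0 (\<lambda>t. f j (\<psi> t u)) (f (Suc j) (\<psi> t u)) t {0..hs}"
  shows "\<exists>C. \<forall>\<^sub>F (h, u) in germ Q p. norm (f 0 (\<psi> h u) - (\<Sum>i<k. (h ^ i / fact i) *\<^sub>R f i u)) \<le> C * h ^ k"
  using f f'
proof (induction k arbitrary: f)
  case 0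
  have "((\<lambda>z. f 0 (snd (case z of (h, u) \<Rightarrow> (h, \<psi> h u)))) \<longlongrightarrow> f 0 p) (germ Q p)"
    using filterlim_compose[OF 0(1)[of 0] local_flow_germ[OF \<psi> p]] by (simp add: case_prod_unfold)
  then have "((\<lambda>z. norm (f 0 (\<psi> (fst z) (snd z)))) \<longlongrightarrow> norm (f 0 p)) (germ Q p)"
    by (intro tendsto_norm) (simp add: case_prod_unfold)
  then have "\<forall>\<^sub>F z in germ Q p. norm (f 0 (\<psi> (fst z) (snd z))) < norm (f 0 p) + 1"
    by (rule order_tendstoD) simp
  then show ?case by (intro exI[of _ "norm (f 0 p) + 1"]) (auto elim: eventually_mono)
next
  case (Suc k)
  have "\<exists>C. \<forall>\<^sub>F (h, u) in germ Q p. norm (f (Suc 0) (\<psi> h u) - (\<Sum>i<k. (h ^ i / fact i) *\<^sub>R f (Suc i) u)) \<le> C * h ^ k"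
    by (rule Suc.IH) (use Suc.prems in auto)
  then obtain C where C: "\<forall>\<^sub>F (h, u) in germ Q p. norm (f (Suc 0) (\<psi> h u) - (\<Sum>i<k. (h ^ i / fact i) *\<^sub>R f (Suc i) u)) \<le> C * h ^ k"
    by blast
  have hs: "hs > 0" and \<psi>0: "\<And>u. u \<in> V \<Longrightarrow> \<psi> 0 u = u" using \<psi> by (auto simp: local_flow_def)
  have psi_in: "\<forall>\<^sub>F z in germ Q p. \<psi> (fst z) (snd z) \<in> V \<inter> Hs Q"
  proof -
    have c: "cv Q (\<lambda>z. \<psi> (fst z) (snd z)) p (germ Q p)"
      using \<psi> p by (auto simp: local_flow_def case_prod_unfold)
    show ?thesis using cv_ev_in[OF c] topological_tendstoD[OF cv_tendsto[OF c] V(1)] p by (simp add: eventually_conj_iff)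
  qed
  have u_in: "\<forall>\<^sub>F z in germ Q p. snd z \<in> V \<inter> Hs Q"
    using cv_ev_in[OF snd_germ] topological_tendstoD[OF cv_tendsto[OF snd_germ] V(1)] p by (simp add: eventually_conj_iff)
  have "\<forall>\<^sub>F z in germ Q p. norm (f 0 (\<psi> (fst z) (snd z)) - (\<Sum>i<Suc k. (fst z ^ i / fact i) *\<^sub>R f i (snd z))) \<le> \<bar>C\<bar> * fst z ^ Suc k"
    \<comment> \<open>Both the shorter remainder bound and membership in \<open>V\<close> must hold
      at all times up to \<open>h\<close>, not at \<open>h\<close> alone.\<close>
    using eventually_germ_initial[OF C] eventually_germ_initial[OF psi_in] u_in eventually_germ_le[OF hs]
  proof eventually_elim
    case (elim z)
    obtain h u where z: "z = (h, u)" by (cases z)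
    have h: "0 \<le> h" "h \<le> hs" and u: "u \<in> V \<inter> Hs Q"
      and pin: "\<And>t. t \<in> {0..h} \<Longrightarrow> \<psi> t u \<in> V \<inter> Hs Q"
      and le: "\<And>t. t \<in> {0..h} \<Longrightarrow> norm (f (Suc 0) (\<psi> t u) - (\<Sum>i<k. (t ^ i / fact i) *\<^sub>R f (Suc i) u)) \<le> C * t ^ k"
      using elim by (auto simp: z)
    define g where "g t = f 0 (\<psi> t u) - (\<Sum>i<Suc k. (t ^ i / fact i) *\<^sub>R f i u)" for t
    define g' where "g' t = f (Suc 0) (\<psi> t u) - (\<Sum>i<k. (t ^ i / fact i) *\<^sub>R f (Suc i) u)" for t
    have g0: "g 0 = 0"
      using u \<psi>0 by (simp add: g_def sum.lessThan_Suc_shift del: sum.lessThan_Suc)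
    show ?case
    proof (cases "h = 0")
      case True
      then show ?thesis using g0 by (simp add: z g_def)
    next
      case False
      obtain \<xi> where \<xi>: "0 < \<xi>" "\<xi> < h" "N 0 (g h - g 0 - (h - 0) *\<^sub>R 0) \<le> (h - 0) * N 0 (g' \<xi> - 0)"
      proof (rule mean_value[of 0 h g 0 g' 0])
        fix t assume t: "t \<in> {0..h}"
        have "der 0 (\<lambda>t. f 0 (\<psi> t u)) (f (Suc 0) (\<psi> t u)) t {0..hs}"
          using t h pin[OF t] u by (intro Suc.prems(2)) auto
        then have "der 0 g (g' t) t {0..hs}"
          unfolding g_def g'_def by (intro der_diff der_taylor_polynomial) auto
        moreover have "{0..h} \<subseteq> {0..hs}" using h by auto
        ultimately show "der 0 g (g' t) t {0..h}"
          unfolding der_def by (meson at_le cv_filter_mono)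
      qed (use h False in auto)
      then have "norm (g h) \<le> h * norm (g' \<xi>)" by (simp add: g0)
      also have "\<dots> \<le> h * (\<bar>C\<bar> * h ^ k)"
      proof (intro mult_left_mono)
        have "norm (g' \<xi>) \<le> C * \<xi> ^ k" unfolding g'_def using \<xi> by (intro le) auto
        also have "\<dots> \<le> \<bar>C\<bar> * h ^ k" using \<xi> by (intro mult_mono power_mono) auto
        finally show "norm (g' \<xi>) \<le> \<bar>C\<bar> * h ^ k" .
      qed (use h in auto)
      finally show ?thesis by (simp add: z g_def mult_ac)
    qed
  qed
  then show ?case by (intro exI[of _ "\<bar>C\<bar>"]) (simp add: case_prod_unfold)
qed

lemma Lie_word_germ:
  assumes "length w \<le> Q" "p \<in> V \<inter> Hs Q"
  shows "((\<lambda>(h, u). Lie_word w u) \<longlongrightarrow> Lie_word w p) (germ Q p)"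
proof -
  have "cv (length w + 0) snd p (germ Q p)"
    using assms by (intro cv_mono[of "length w + 0" Q] snd_germ) auto
  from differential_cv[OF differential_Lie_word _ this] assms(2)
  show ?thesis by (simp add: cv_0 case_prod_unfold)
qed

lemma local_flow_Lie_word:
  assumes \<psi>: "local_flow hs \<psi> x y" and w: "length w < Q"
    and u: "u \<in> V \<inter> Hs Q" "t \<in> {0..hs}" "\<psi> t u \<in> V \<inter> Hs Q"
  shows "der 0 (\<lambda>t. Lie_word w (\<psi> t u)) (x *\<^sub>R Lie_word (False # w) (\<psi> t u) + y *\<^sub>R Lie_word (True # w) (\<psi> t u)) t {0..hs}"
proof (rule Lie_word_der)
  have le: "Suc (length w + 0) \<le> Q" using w by simp
  then have u': "u \<in> V \<inter> Hs (Suc (length w + 0))" and "\<psi> t u \<in> V \<inter> Hs (Suc (length w + 0))"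
    using u Hs_antimono[OF le] by blast+
  then show "\<psi> t u \<in> V \<inter> Hs (Suc (length w + 0))" by blast
  show "der (length w + 0) (\<lambda>t. \<psi> t u) (x *\<^sub>R B False (\<psi> t u) [] + y *\<^sub>R B True (\<psi> t u) []) t {0..hs}"
    using \<psi> u u' unfolding local_flow_def by blast
qed

section \<open>Truncated word series\<close>

definition words :: "nat \<Rightarrow> bool list set" where
  "words n = {w. length w < n}"

lemma finite_words: "finite (words n)"
  unfolding words_def using finite_lists_length_le[of "UNIV :: bool set" n] by (rule finite_subset[rotated]) auto

text \<open>The word has already used \<open>length w\<close> of the \<open>Q\<close> levels, so the
  expansion stops after \<open>Q - length w\<close> terms. Multiplied by
  \<open>h ^ length w\<close>, the remainders of all words have the common order
  \<open>Q\<close>.\<close>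

lemma flow_taylor_word:
  assumes \<psi>: "local_flow hs \<psi> (if a then 0 else 1) (if a then 1 else 0)" and p: "p \<in> V \<inter> Hs Q"
    and w: "w \<in> words Q"
  shows "\<exists>C. \<forall>\<^sub>F (h, u) in germ Q p. norm (Lie_word w (\<psi> h u) -
     (\<Sum>i<Q - length w. (h ^ i / fact i) *\<^sub>R Lie_word (replicate i a @ w) u)) \<le> C * h ^ (Q - length w)"
proof -
  have wl: "length w < Q" using w by (simp add: words_def)
  have "\<exists>C. \<forall>\<^sub>F (h, u) in germ Q p. norm (Lie_word (replicate 0 a @ w) (\<psi> h u) -
     (\<Sum>i<Q - length w. (h ^ i / fact i) *\<^sub>R Lie_word (replicate i a @ w) u)) \<le> C * h ^ (Q - length w)"
  proof (rule local_flow_taylor[OF \<psi> p, where f = "\<lambda>j. Lie_word (replicate j a @ w)"])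
    fix j assume "j \<le> Q - length w"
    then show "((\<lambda>(h, u). Lie_word (replicate j a @ w) u) \<longlongrightarrow> Lie_word (replicate j a @ w) p) (germ Q p)"
      using wl by (intro Lie_word_germ p) auto
  next
    fix j u t assume "j < Q - length w" and u: "u \<in> V \<inter> Hs Q" "t \<in> {0..hs}" "\<psi> t u \<in> V \<inter> Hs Q"
    then have "length (replicate j a @ w) < Q" by simp
    from local_flow_Lie_word[OF \<psi> this u]
    show "der 0 (\<lambda>t. Lie_word (replicate j a @ w) (\<psi> t u)) (Lie_word (replicate (Suc j) a @ w) (\<psi> t u)) t {0..hs}"
      by (cases a) simp_all
  qed
  then show ?thesis by simp
qed

definition has_series :: "nat \<Rightarrow> 'a \<Rightarrow> (real \<Rightarrow> 'a \<Rightarrow> 'a) \<Rightarrow> (bool list \<Rightarrow> real) \<Rightarrow> bool" where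
  "has_series Q p \<Psi> c \<longleftrightarrow> (\<exists>C. \<forall>\<^sub>F (h, u) in germ Q p.
     norm (\<Psi> h u - (\<Sum>w\<in>words Q. (c w * h ^ length w) *\<^sub>R Lie_word w u)) \<le> C * h ^ Q)"

text \<open>Reindexing: a word with \<open>i\<close> letters \<open>a\<close> put in front
  corresponds to a longer word together with the choice of \<open>i\<close> letters from its initial
  run of \<open>a\<close>. The bound \<open>i < Q - length w\<close> says that the longer word still
  belongs to \<open>words Q\<close>.\<close>

lemma sum_words_flow_series:
  "(\<Sum>w\<in>words Q. (c w * h ^ length w) *\<^sub>R (\<Sum>i<Q - length w. (h ^ i / fact i) *\<^sub>R Lie_word (replicate i a @ w) u)) =
   (\<Sum>w\<in>words Q. (flow_series a 1 c w * h ^ length w) *\<^sub>R Lie_word w u)"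
proof -
  let ?t = "\<lambda>w i. (c w * h ^ length w * (h ^ i / fact i)) *\<^sub>R Lie_word (replicate i a @ w) u"
  have "(\<Sum>w\<in>words Q. (c w * h ^ length w) *\<^sub>R (\<Sum>i<Q - length w. (h ^ i / fact i) *\<^sub>R Lie_word (replicate i a @ w) u)) =
     (\<Sum>(w, i)\<in>(SIGMA w:words Q. {..<Q - length w}). ?t w i)"
    by (subst sum.Sigma[symmetric]) (auto simp: finite_words scaleR_sum_right)
  also have "\<dots> = (\<Sum>(w, i)\<in>(SIGMA w:words Q. {..run a w}).
      (1 ^ i / fact i * c (drop i w) * h ^ length w) *\<^sub>R Lie_word w u)"
  proof (rule sum.reindex_bij_witness[where i = "\<lambda>(w, i). (drop i w, i)" and j = "\<lambda>(w, i). (replicate i a @ w, i)"])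
    fix z assume z: "z \<in> (SIGMA w:words Q. {..<Q - length w})"
    obtain w i where wi: "z = (w, i)" by (cases z)
    show "(case (case z of (w, i) \<Rightarrow> (replicate i a @ w, i)) of (w, i) \<Rightarrow> (drop i w, i)) = z" by (simp add: wi)
    show "(case z of (w, i) \<Rightarrow> (replicate i a @ w, i)) \<in> (SIGMA w:words Q. {..run a w})"
      using z by (auto simp: wi words_def run_eq_replicate)
    show "(case case z of (w, i) \<Rightarrow> (replicate i a @ w, i) of (w, i) \<Rightarrow> (1 ^ i / fact i * c (drop i w) * h ^ length w) *\<^sub>R Lie_word w u) =
        (case z of (w, i) \<Rightarrow> ?t w i)"
      by (simp add: wi power_add mult_ac)
  next
    fix z assume z: "z \<in> (SIGMA w:words Q. {..run a w})"
    obtain w i where wi: "z = (w, i)" by (cases z)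
    have "i \<le> length w" "take i w = replicate i a" using z by (auto simp: wi run_eq_replicate)
    then have eq: "replicate i a @ drop i w = w" by (metis append_take_drop_id)
    show "(case (case z of (w, i) \<Rightarrow> (drop i w, i)) of (w, i) \<Rightarrow> (replicate i a @ w, i)) = z" by (simp add: wi eq)
    show "(case z of (w, i) \<Rightarrow> (drop i w, i)) \<in> (SIGMA w:words Q. {..<Q - length w})"
      using z \<open>i \<le> length w\<close> by (auto simp: wi words_def)
  qed
  also have "\<dots> = (\<Sum>w\<in>words Q. (flow_series a 1 c w * h ^ length w) *\<^sub>R Lie_word w u)"
    by (subst sum.Sigma[symmetric])
      (auto simp: finite_words flow_series_def scaleR_left.sum sum_distrib_right)
  finally show ?thesis .
qed

text \<open>The series of \<open>\<Psi>\<close> is used at the point \<open>\<psi> h u\<close>. This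
  is admissible because the flow maps the germ at \<open>p\<close> into itself. Afterwards each
  derivation is expanded along the flow.\<close>

lemma has_series_compose:
  assumes \<psi>: "local_flow hs \<psi> (if a then 0 else 1) (if a then 1 else 0)" and p: "p \<in> V \<inter> Hs Q"
    and \<Psi>: "has_series Q p \<Psi> c"
  shows "has_series Q p (\<lambda>h u. \<Psi> h (\<psi> h u)) (flow_series a 1 c)"
proof -
  obtain C where C: "\<forall>\<^sub>F (h, u) in germ Q p.
     norm (\<Psi> h u - (\<Sum>w\<in>words Q. (c w * h ^ length w) *\<^sub>R Lie_word w u)) \<le> C * h ^ Q"
    using \<Psi> unfolding has_series_def by blast
  from local_flow_germ[OF \<psi> p, unfolded filterlim_iff, rule_format, OF this]
  have 1: "\<forall>\<^sub>F z in germ Q p. norm (\<Psi> (fst z) (\<psi> (fst z) (snd z)) -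
      (\<Sum>w\<in>words Q. (c w * fst z ^ length w) *\<^sub>R Lie_word w (\<psi> (fst z) (snd z)))) \<le> C * fst z ^ Q"
    by (simp add: case_prod_unfold)
  have "\<forall>w\<in>words Q. \<exists>C. \<forall>\<^sub>F (h, u) in germ Q p. norm (Lie_word w (\<psi> h u) -
     (\<Sum>i<Q - length w. (h ^ i / fact i) *\<^sub>R Lie_word (replicate i a @ w) u)) \<le> C * h ^ (Q - length w)"
    using flow_taylor_word[OF \<psi> p] by blast
  then obtain D where D: "\<And>w. w \<in> words Q \<Longrightarrow> \<forall>\<^sub>F (h, u) in germ Q p. norm (Lie_word w (\<psi> h u) -
     (\<Sum>i<Q - length w. (h ^ i / fact i) *\<^sub>R Lie_word (replicate i a @ w) u)) \<le> D w * h ^ (Q - length w)"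
    by (auto simp: bchoice_iff dest!: bchoice)
  have 2: "\<forall>\<^sub>F z in germ Q p. \<forall>w\<in>words Q. norm (Lie_word w (\<psi> (fst z) (snd z)) -
     (\<Sum>i<Q - length w. (fst z ^ i / fact i) *\<^sub>R Lie_word (replicate i a @ w) (snd z))) \<le> D w * fst z ^ (Q - length w)"
    using D by (intro eventually_ball_finite finite_words) (auto simp: case_prod_unfold)
  define K where "K = C + (\<Sum>w\<in>words Q. \<bar>c w\<bar> * D w)"
  have "\<forall>\<^sub>F z in germ Q p. norm (\<Psi> (fst z) (\<psi> (fst z) (snd z)) -
      (\<Sum>w\<in>words Q. (flow_series a 1 c w * fst z ^ length w) *\<^sub>R Lie_word w (snd z))) \<le> K * fst z ^ Q"
    using 1 2 eventually_germ_le[OF zero_less_one]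
  proof eventually_elim
    case (elim z)
    obtain h u where z: "z = (h, u)" by (cases z)
    have h: "0 \<le> h" using elim by (simp add: z)
    let ?T = "\<lambda>w. \<Sum>i<Q - length w. (h ^ i / fact i) *\<^sub>R Lie_word (replicate i a @ w) u"
    have "norm (\<Sum>w\<in>words Q. (c w * h ^ length w) *\<^sub>R (Lie_word w (\<psi> h u) - ?T w)) \<le> (\<Sum>w\<in>words Q. \<bar>c w\<bar> * D w * h ^ Q)"
    proof (rule sum_norm_le)
      fix w assume w: "w \<in> words Q"
      have "norm ((c w * h ^ length w) *\<^sub>R (Lie_word w (\<psi> h u) - ?T w)) = \<bar>c w\<bar> * h ^ length w * norm (Lie_word w (\<psi> h u) - ?T w)"
        using h by (simp add: abs_mult)
      also have "\<dots> \<le> \<bar>c w\<bar> * h ^ length w * (D w * h ^ (Q - length w))"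
        using elim(2) w h by (intro mult_left_mono) (auto simp: z)
      also have "\<dots> = \<bar>c w\<bar> * D w * (h ^ length w * h ^ (Q - length w))" by simp
      also have "h ^ length w * h ^ (Q - length w) = h ^ Q"
        using w by (simp add: words_def flip: power_add)
      finally show "norm ((c w * h ^ length w) *\<^sub>R (Lie_word w (\<psi> h u) - ?T w)) \<le> \<bar>c w\<bar> * D w * h ^ Q" .
    qed
    moreover have "norm (\<Psi> h (\<psi> h u) - (\<Sum>w\<in>words Q. (c w * h ^ length w) *\<^sub>R Lie_word w (\<psi> h u))) \<le> C * h ^ Q"
      using elim(1) by (simp add: z)
    ultimately have "norm ((\<Psi> h (\<psi> h u) - (\<Sum>w\<in>words Q. (c w * h ^ length w) *\<^sub>R Lie_word w (\<psi> h u))) +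
        (\<Sum>w\<in>words Q. (c w * h ^ length w) *\<^sub>R (Lie_word w (\<psi> h u) - ?T w))) \<le> K * h ^ Q"
      by (intro norm_triangle_le) (simp add: K_def distrib_right sum_distrib_right)
    moreover have "(\<Psi> h (\<psi> h u) - (\<Sum>w\<in>words Q. (c w * h ^ length w) *\<^sub>R Lie_word w (\<psi> h u))) +
        (\<Sum>w\<in>words Q. (c w * h ^ length w) *\<^sub>R (Lie_word w (\<psi> h u) - ?T w)) =
        \<Psi> h (\<psi> h u) - (\<Sum>w\<in>words Q. (c w * h ^ length w) *\<^sub>R ?T w)"
      by (simp add: scaleR_diff_right sum_subtractf)
    ultimately show ?case unfolding z fst_conv snd_conv sum_words_flow_series by simp
  qed
  then show ?thesis unfolding has_series_def by (intro exI[of _ K]) (simp add: case_prod_unfold)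
qed

lemma has_series_id:
  assumes "0 < Q" shows "has_series Q p (\<lambda>h u. u) empty_word"
proof -
  have "(\<Sum>w\<in>words Q. (empty_word w * h ^ length w) *\<^sub>R Lie_word w u) = u" for h u
  proof -
    have "(\<Sum>w\<in>words Q. (empty_word w * h ^ length w) *\<^sub>R Lie_word w u) =
        (\<Sum>w\<in>{[]}. (empty_word w * h ^ length w) *\<^sub>R Lie_word w u)"
      using assms by (intro sum.mono_neutral_right finite_words) (auto simp: words_def empty_word_def)
    then show ?thesis by (simp add: empty_word_def)
  qed
  then show ?thesis unfolding has_series_def by (intro exI[of _ 0]) (simp add: case_prod_unfold)
qed

lemma has_series_rescale:
  assumes "has_series Q p \<Psi> c" "p \<in> Hs Q" "1 \<le> m"
  shows "has_series Q p (\<lambda>h. \<Psi> (h / real m)) (\<lambda>w. c w / real m ^ length w)"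
proof -
  obtain C where C: "\<forall>\<^sub>F (h, u) in germ Q p.
     norm (\<Psi> h u - (\<Sum>w\<in>words Q. (c w * h ^ length w) *\<^sub>R Lie_word w u)) \<le> C * h ^ Q"
    using assms unfolding has_series_def by blast
  have "filterlim (\<lambda>z. (fst z / real m, snd z)) (germ Q p) (germ Q p)"
  proof (rule filterlim_germ[OF snd_germ[OF assms(2)]])
    show "((\<lambda>z. fst z / real m) \<longlongrightarrow> 0) (germ Q p)"
      using tendsto_divide[OF fst_germ tendsto_const, of "real m" Q p] assms(3) by simp
    show "\<forall>\<^sub>F z in germ Q p. 0 \<le> fst z / real m"
      using eventually_germ_le[OF zero_less_one, of Q p] by (auto elim: eventually_mono)
  qed
  from this[unfolded filterlim_iff, rule_format, OF C]
  have "\<forall>\<^sub>F (h, u) in germ Q p. norm (\<Psi> (h / real m) u -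
      (\<Sum>w\<in>words Q. (c w / real m ^ length w * h ^ length w) *\<^sub>R Lie_word w u)) \<le> (C / real m ^ Q) * h ^ Q"
    by (simp add: case_prod_unfold power_divide)
  then show ?thesis unfolding has_series_def by blast
qed

lemma has_series_add:
  assumes "has_series Q p \<Psi> c" "has_series Q p \<Psi>' c'"
  shows "has_series Q p (\<lambda>h u. \<Psi> h u + \<Psi>' h u) (\<lambda>w. c w + c' w)"
proof -
  obtain C C' where "\<forall>\<^sub>F (h, u) in germ Q p.
     norm (\<Psi> h u - (\<Sum>w\<in>words Q. (c w * h ^ length w) *\<^sub>R Lie_word w u)) \<le> C * h ^ Q"
   "\<forall>\<^sub>F (h, u) in germ Q p.
     norm (\<Psi>' h u - (\<Sum>w\<in>words Q. (c' w * h ^ length w) *\<^sub>R Lie_word w u)) \<le> C' * h ^ Q"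
    using assms unfolding has_series_def by blast
  then have "\<forall>\<^sub>F (h, u) in germ Q p. norm (\<Psi> h u + \<Psi>' h u -
      (\<Sum>w\<in>words Q. ((c w + c' w) * h ^ length w) *\<^sub>R Lie_word w u)) \<le> (C + C') * h ^ Q"
  proof eventually_elim
    case (elim z)
    obtain h u where z: "z = (h, u)" by (cases z)
    show ?case using norm_triangle_mono[of _ "C * h ^ Q" _ "C' * h ^ Q"] elim
      by (force simp: z algebra_simps sum.distrib)
  qed
  then show ?thesis unfolding has_series_def by blast
qed

lemma has_series_scaleR:
  assumes "has_series Q p \<Psi> c"
  shows "has_series Q p (\<lambda>h u. g *\<^sub>R \<Psi> h u) (\<lambda>w. g * c w)"
proof -
  obtain C where C: "\<forall>\<^sub>F (h, u) in germ Q p.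
     norm (\<Psi> h u - (\<Sum>w\<in>words Q. (c w * h ^ length w) *\<^sub>R Lie_word w u)) \<le> C * h ^ Q"
    using assms unfolding has_series_def by blast
  then have "\<forall>\<^sub>F (h, u) in germ Q p. norm (g *\<^sub>R \<Psi> h u -
      (\<Sum>w\<in>words Q. (g * c w * h ^ length w) *\<^sub>R Lie_word w u)) \<le> (\<bar>g\<bar> * C) * h ^ Q"
  proof eventually_elim
    case (elim z)
    obtain h u where z: "z = (h, u)" by (cases z)
    have "g *\<^sub>R \<Psi> h u - (\<Sum>w\<in>words Q. (g * c w * h ^ length w) *\<^sub>R Lie_word w u) =
        g *\<^sub>R (\<Psi> h u - (\<Sum>w\<in>words Q. (c w * h ^ length w) *\<^sub>R Lie_word w u))"
      by (simp add: scaleR_diff_right scaleR_sum_right mult.assoc)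
    then show ?case using elim by (simp add: z mult_left_mono mult.assoc)
  qed
  then show ?thesis unfolding has_series_def by blast
qed

lemma has_series_sum:
  assumes "finite M" "\<And>m. m \<in> M \<Longrightarrow> has_series Q p (\<Psi> m) (c m)"
  shows "has_series Q p (\<lambda>h u. \<Sum>m\<in>M. g m *\<^sub>R \<Psi> m h u) (\<lambda>w. \<Sum>m\<in>M. g m * c m w)"
  using assms
proof (induction rule: finite_induct)
  case empty
  show ?case unfolding has_series_def by (intro exI[of _ 0]) (simp add: case_prod_unfold)
next
  case (insert m M)
  then show ?case using has_series_add[OF has_series_scaleR[of Q p "\<Psi> m" "c m" "g m"]] by simp
qed

text \<open>Along the full flow the time derivative is the sum of both derivations. The
  \<open>j\<close>-th derivative of the identity is therefore the sum over all words of length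
  \<open>j\<close>, and Taylor's formula gives them all the same coefficient.\<close>

lemma has_series_flow:
  assumes \<psi>: "local_flow hs \<psi> 1 1" and p: "p \<in> V \<inter> Hs Q"
  shows "has_series Q p \<psi> (\<lambda>w. 1 / fact (length w))"
proof -
  define f where "f j u = (\<Sum>w | length w = j. Lie_word w u)" for j u
  have fin: "finite {w :: bool list. length w = j}" for j
    using finite_lists_length_eq[of "UNIV :: bool set" j] by simp
  have Suc_words: "f (Suc j) u = (\<Sum>w | length w = j. Lie_word (False # w) u + Lie_word (True # w) u)" for j u
  proof -
    have "{w :: bool list. length w = Suc j} = (\<lambda>w. False # w) ` {w. length w = j} \<union> (\<lambda>w. True # w) ` {w. length w = j}"
      by (auto simp: length_Suc_conv)
    then have "f (Suc j) u = (\<Sum>w\<in>(\<lambda>w. False # w) ` {w. length w = j} \<union> (\<lambda>w. True # w) ` {w. length w = j}. Lie_word w u)"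
      by (simp add: f_def)
    also have "\<dots> = (\<Sum>w\<in>(\<lambda>w. False # w) ` {w. length w = j}. Lie_word w u) + (\<Sum>w\<in>(\<lambda>w. True # w) ` {w. length w = j}. Lie_word w u)"
      by (rule sum.union_disjoint) (use fin in auto)
    finally show ?thesis by (simp add: sum.reindex inj_on_def sum.distrib o_def)
  qed
  have "\<exists>C. \<forall>\<^sub>F (h, u) in germ Q p. norm (f 0 (\<psi> h u) - (\<Sum>i<Q. (h ^ i / fact i) *\<^sub>R f i u)) \<le> C * h ^ Q"
  proof (rule local_flow_taylor[OF \<psi> p])
    fix j assume "j \<le> Q"
    then have "((\<lambda>z. Lie_word w (snd z)) \<longlongrightarrow> Lie_word w p) (germ Q p)" if "length w = j" for w
      using Lie_word_germ[OF _ p, of w] that by (simp add: case_prod_unfold)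
    then show "((\<lambda>(h, u). f j u) \<longlongrightarrow> f j p) (germ Q p)"
      unfolding f_def case_prod_unfold by (intro tendsto_sum) auto
  next
    fix j u t assume j: "j < Q" and u: "u \<in> V \<inter> Hs Q" "t \<in> {0..hs}" "\<psi> t u \<in> V \<inter> Hs Q"
    show "der 0 (\<lambda>t. f j (\<psi> t u)) (f (Suc j) (\<psi> t u)) t {0..hs}"
      unfolding Suc_words unfolding f_def
    proof (rule der_sum)
      fix w :: "bool list" assume "w \<in> {w. length w = j}"
      then have "length w < Q" using j by simp
      from local_flow_Lie_word[OF \<psi> this u]
      show "der 0 (\<lambda>t. Lie_word w (\<psi> t u)) (Lie_word (False # w) (\<psi> t u) + Lie_word (True # w) (\<psi> t u)) t {0..hs}"
        by simp
    qed
  qed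
  moreover have "(\<Sum>w\<in>words Q. (1 / fact (length w) * h ^ length w) *\<^sub>R Lie_word w u) = (\<Sum>i<Q. (h ^ i / fact i) *\<^sub>R f i u)" for h u
  proof -
    have "(\<Sum>w\<in>words Q. (1 / fact (length w) * h ^ length w) *\<^sub>R Lie_word w u) =
        (\<Sum>i\<in>{..<Q}. \<Sum>w | w \<in> words Q \<and> length w = i. (1 / fact (length w) * h ^ length w) *\<^sub>R Lie_word w u)"
      by (rule sum.group[OF finite_words, symmetric]) (auto simp: words_def)
    also have "\<dots> = (\<Sum>i<Q. (h ^ i / fact i) *\<^sub>R f i u)"
      unfolding f_def scaleR_sum_right by (intro sum.cong) (auto simp: words_def)
    finally show ?thesis .
  qed
  moreover have "f 0 u = u" for u by (simp add: f_def)
  ultimately show ?thesis unfolding has_series_def by simp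
qed

lemma has_series_unique:
  assumes "has_series Q p \<Psi> c" "has_series Q p \<Psi>' c'" "\<And>w. w \<in> words Q \<Longrightarrow> c w = c' w"
  shows "\<exists>C d. d > 0 \<and> (\<forall>h u. 0 \<le> h \<longrightarrow> h \<le> d \<longrightarrow> u \<in> Hs Q \<longrightarrow> N Q (u - p) < d \<longrightarrow> norm (\<Psi> h u - \<Psi>' h u) \<le> C * h ^ Q)"
proof -
  have "has_series Q p (\<lambda>h u. \<Psi> h u + (-1) *\<^sub>R \<Psi>' h u) (\<lambda>w. c w + (-1) * c' w)"
    by (intro has_series_add has_series_scaleR assms)
  then obtain C where "\<forall>\<^sub>F (h, u) in germ Q p. norm (\<Psi> h u - \<Psi>' h u) \<le> C * h ^ Q"
    unfolding has_series_def using assms(3) by auto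
  then show ?thesis unfolding eventually_germ by auto
qed

lemma has_series_split_iterate:
  assumes \<psi>: "\<And>a. local_flow hs (\<psi> a) (if a then 0 else 1) (if a then 1 else 0)"
    and p: "p \<in> V \<inter> Hs Q" and Q: "0 < Q"
  shows "has_series Q p (\<lambda>h. (\<lambda>x. \<psi> a h (\<psi> b h x)) ^^ m) ((step_series a b ^^ m) empty_word)"
proof (induction m)
  case 0
  then show ?case using has_series_id[OF Q] by simp
next
  case (Suc m)
  \<comment> \<open>The iterate is unrolled at the step that meets the data first, because
    \<open>has_series_compose\<close> composes on that side.\<close>
  have f: "F ^^ Suc m = (\<lambda>u. (F ^^ m) (F u))" for F :: "'a \<Rightarrow> 'a"
    by (rule ext) (simp add: funpow_swap1)
  from has_series_compose[OF \<psi> p has_series_compose[OF \<psi> p Suc, of a], of b]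
  show ?case unfolding f by (simp add: step_series_def)
qed

end

section \<open>Mild flows\<close>

definition locally_lipschitz :: "('a::real_normed_vector \<Rightarrow> 'a) \<Rightarrow> bool" where
  "locally_lipschitz F \<longleftrightarrow>
     (\<forall>x. \<exists>d>0. \<exists>L\<ge>0. \<forall>y\<in>ball x d. \<forall>z\<in>ball x d. norm (F y - F z) \<le> L * norm (y - z))"

lemma locally_lipschitz_isCont:
  assumes "locally_lipschitz F" shows "isCont F x"
proof -
  obtain d L where d: "d > 0" "\<And>y. y \<in> ball x d \<Longrightarrow> norm (F y - F x) \<le> L * norm (y - x)"
    using assms unfolding locally_lipschitz_def by (metis centre_in_ball)
  have "((\<lambda>y. F y - F x) \<longlongrightarrow> 0) (at x)"
  proof (rule Lim_null_comparison)
    show "\<forall>\<^sub>F y in at x. norm (F y - F x) \<le> L * norm (y - x)"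
      unfolding eventually_at using d by (auto simp: dist_commute intro!: exI[of _ d])
    have "((\<lambda>y. L * norm (y - x)) \<longlongrightarrow> L * norm (x - x)) (at x)" by (intro tendsto_intros)
    then show "((\<lambda>y. L * norm (y - x)) \<longlongrightarrow> 0) (at x)" by simp
  qed
  then show ?thesis unfolding isCont_def using LIM_zero_iff by blast
qed

text \<open>Near \<open>x\<close> the first derivative equals its value at \<open>x\<close>, plus
  the second derivative at \<open>x\<close> applied to the displacement, plus a small remainder. It
  is therefore bounded on a ball, and the mean value theorem applies.\<close>

lemma smooth_map_locally_lipschitz:
  fixes F :: "'a::real_normed_vector \<Rightarrow> 'a"
  assumes "smooth_map F" shows "locally_lipschitz F"
  unfolding locally_lipschitz_def
proof
  fix x :: 'a
  obtain D :: "nat \<Rightarrow> 'a \<Rightarrow> 'a list \<Rightarrow> 'a" where D0: "\<And>u. D 0 u [] = F u"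
    and Dm: "\<And>i u. bounded_multilinear i (D i u)"
    and Dd: "\<And>i u e. e > 0 \<Longrightarrow> \<exists>d>0. \<forall>w vs. norm w < d \<longrightarrow> length vs = i \<longrightarrow>
        norm (D i (u + w) vs - D i u vs - D (Suc i) u (w # vs)) \<le> e * norm w * (\<Prod>v\<leftarrow>vs. norm v)"
    using assms unfolding smooth_map_def by metis
  have bl: "bounded_linear (\<lambda>v. D 1 u [v])" for u
  proof -
    have "linear (\<lambda>x. D 1 u ([0][0 := x]))" and "\<exists>K. \<forall>vs. length vs = 1 \<longrightarrow> norm (D 1 u vs) \<le> K * (\<Prod>v\<leftarrow>vs. norm v)"
      using Dm[of 1 u] unfolding bounded_multilinear_def by (auto simp del: list_update.simps)
    then obtain K where lin: "linear (\<lambda>x. D 1 u [x])"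
      and "\<And>vs. length vs = 1 \<Longrightarrow> norm (D 1 u vs) \<le> K * (\<Prod>v\<leftarrow>vs. norm v)"
      by auto
    from this(2)[of "[_]"] have "norm (D 1 u [v]) \<le> K * norm v" for v by simp
    with lin show ?thesis
      by (intro bounded_linear.intro bounded_linear_axioms.intro exI[of _ K]) (auto simp: mult.commute)
  qed
  have der: "(F has_derivative (\<lambda>v. D 1 u [v])) (at u within S)" for u S
  proof (rule has_derivative_at_withinI, unfold has_derivative_at_alt, intro conjI bl allI impI)
    fix e :: real assume "e > 0"
    then obtain d where d: "d > 0" "\<And>w. norm w < d \<Longrightarrow> norm (D 0 (u + w) [] - D 0 u [] - D (Suc 0) u [w]) \<le> e * norm w"
      using Dd[of e 0 u] by force
    show "\<exists>d>0. \<forall>y. norm (y - u) < d \<longrightarrow> norm (F y - F u - D 1 u [y - u]) \<le> e * norm (y - u)"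
      using d(1) d(2)[of "y - u" for y] D0 by (intro exI[of _ d]) auto
  qed
  obtain K1 where K1: "\<And>v. norm (D 1 x [v]) \<le> norm v * K1" "K1 > 0"
    using bounded_linear.pos_bounded[OF bl[of x]] by blast
  obtain K2 where "\<And>vs. length vs = 2 \<Longrightarrow> norm (D 2 x vs) \<le> K2 * (\<Prod>v\<leftarrow>vs. norm v)"
    using Dm[of 2 x] unfolding bounded_multilinear_def by blast
  from this[of "[_, _]"] have K2: "\<And>w v. norm (D 2 x [w, v]) \<le> K2 * (norm w * norm v)" by simp
  obtain d where d: "d > 0" and dd: "\<And>w vs. norm w < d \<Longrightarrow> length vs = 1 \<Longrightarrow>
      norm (D 1 (x + w) vs - D 1 x vs - D (Suc 1) x (w # vs)) \<le> 1 * norm w * (\<Prod>v\<leftarrow>vs. norm v)"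
    using Dd[of 1 1 x] zero_less_one by blast
  have d2: "norm (D 1 (x + w) [v] - D 1 x [v] - D 2 x [w, v]) \<le> norm w * norm v"
    if "norm w < d" for w v
    using dd[OF that, of "[v]"] by (simp add: numeral_2_eq_2)
  \<comment> \<open>Over the ball of radius \<open>d\<close> the three terms bound the derivative at
    \<open>x\<close>, the second derivative, and the remainder taken with tolerance 1.\<close>
  define L where "L = K1 + \<bar>K2\<bar> * d + d"
  have L: "L \<ge> 0" using K1 d by (simp add: L_def)
  have bound: "norm (D 1 u [v]) \<le> L * norm v" if "u \<in> ball x d" for u v
  proof -
    define w where "w = u - x"
    have w: "norm w < d" using that by (simp add: w_def dist_norm norm_minus_commute)
    have "norm (D 1 (x + w) [v]) \<le> norm (D 1 (x + w) [v] - D 1 x [v] - D 2 x [w, v]) + norm (D 1 x [v]) + norm (D 2 x [w, v])"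
      by norm
    also have "\<dots> \<le> norm w * norm v + norm v * K1 + K2 * (norm w * norm v)"
      by (intro add_mono d2 w K1 K2)
    also have "\<dots> \<le> d * norm v + K1 * norm v + \<bar>K2\<bar> * (d * norm v)"
    proof (intro add_mono)
      show "K2 * (norm w * norm v) \<le> \<bar>K2\<bar> * (d * norm v)"
        using w d by (intro mult_mono) auto
    qed (use w in \<open>auto intro: mult_right_mono\<close>)
    finally show ?thesis by (simp add: L_def w_def algebra_simps)
  qed
  show "\<exists>d>0. \<exists>L\<ge>0. \<forall>y\<in>ball x d. \<forall>z\<in>ball x d. norm (F y - F z) \<le> L * norm (y - z)"
  proof (intro exI conjI ballI)
    fix y z assume yz: "y \<in> ball x d" "z \<in> ball x d"
    show "norm (F y - F z) \<le> L * norm (y - z)"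
    proof (rule differentiable_bound[OF convex_ball der _ yz])
      fix u assume "u \<in> ball x d"
      then show "onorm (\<lambda>v. D 1 u [v]) \<le> L" using bound by (intro onorm_bound[OF L]) blast
    qed
  qed (use d L in auto)
qed

text \<open>Around a time where the curves meet, the local Lipschitz constant at the common value
  works; where they are apart, \<open>norm (u t - v t)\<close> is bounded below and any bound on the
  numerator does. Bisection makes the constant uniform on \<open>{0..T}\<close>.\<close>

lemma lipschitz_along_curves:
  fixes u v :: "real \<Rightarrow> 'a::real_normed_vector"
  assumes F: "locally_lipschitz F" and "0 \<le> T" and u: "continuous_on {0..T} u" and v: "continuous_on {0..T} v"
  obtains L where "L \<ge> 0" "\<And>t. t \<in> {0..T} \<Longrightarrow> norm (F (u t) - F (v t)) \<le> L * norm (u t - v t)"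
proof -
  define P where "P a b \<longleftrightarrow> (\<exists>L\<ge>0. \<forall>t\<in>{a..b} \<inter> {0..T}. norm (F (u t) - F (v t)) \<le> L * norm (u t - v t))"
    for a b
  have "P 0 T" using \<open>0 \<le> T\<close>
  proof (induction rule: Bolzano)
    case (trans a b c)
    then obtain L1 L2 where L: "L1 \<ge> 0" "L2 \<ge> 0"
      "\<forall>t\<in>{a..b} \<inter> {0..T}. norm (F (u t) - F (v t)) \<le> L1 * norm (u t - v t)"
      "\<forall>t\<in>{b..c} \<inter> {0..T}. norm (F (u t) - F (v t)) \<le> L2 * norm (u t - v t)"
      unfolding P_def by metis
    have "norm (F (u t) - F (v t)) \<le> max L1 L2 * norm (u t - v t)" if "t \<in> {a..c} \<inter> {0..T}" for t
    proof -
      have "norm (F (u t) - F (v t)) \<le> L1 * norm (u t - v t) \<or> norm (F (u t) - F (v t)) \<le> L2 * norm (u t - v t)"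
        using L that by (cases "t \<le> b") auto
      then show ?thesis
        by (meson max.cobounded1 max.cobounded2 mult_right_mono norm_ge_zero order_trans)
    qed
    then show ?case unfolding P_def using L by (intro exI[of _ "max L1 L2"]) auto
  next
    case (local t)
    have tu: "(u \<longlongrightarrow> u t) (at t within {0..T})" and tv: "(v \<longlongrightarrow> v t) (at t within {0..T})"
      using u v local by (auto simp: continuous_on_def)
    have "\<exists>L\<ge>0. \<forall>\<^sub>F s in at t within {0..T}. norm (F (u s) - F (v s)) \<le> L * norm (u s - v s)"
    proof (cases "u t = v t")
      case True
      obtain d L where d: "d > 0" "L \<ge> 0"
        "\<And>y z. y \<in> ball (u t) d \<Longrightarrow> z \<in> ball (u t) d \<Longrightarrow> norm (F y - F z) \<le> L * norm (y - z)"
        using F unfolding locally_lipschitz_def by metis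
      have "\<forall>\<^sub>F s in at t within {0..T}. u s \<in> ball (u t) d" "\<forall>\<^sub>F s in at t within {0..T}. v s \<in> ball (u t) d"
        using tendstoD[OF tu d(1)] tendstoD[OF tv d(1)] True by (auto simp: dist_commute)
      then have "\<forall>\<^sub>F s in at t within {0..T}. norm (F (u s) - F (v s)) \<le> L * norm (u s - v s)"
        by eventually_elim (use d in auto)
      then show ?thesis using d by blast
    next
      case False
      have cF: "((\<lambda>s. norm (F (u s) - F (v s))) \<longlongrightarrow> norm (F (u t) - F (v t))) (at t within {0..T})"
        by (intro tendsto_intros isCont_tendsto_compose[OF locally_lipschitz_isCont[OF F]] tu tv)
      have cn: "((\<lambda>s. norm (u s - v s)) \<longlongrightarrow> norm (u t - v t)) (at t within {0..T})"
        by (intro tendsto_intros tu tv)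
      define a where "a = norm (u t - v t)"
      define b where "b = norm (F (u t) - F (v t)) + 1"
      have ab: "a > 0" "b > 0" using False by (auto simp: a_def b_def add_nonneg_pos)
      have "\<forall>\<^sub>F s in at t within {0..T}. norm (F (u s) - F (v s)) < b"
        using order_tendstoD(2)[OF cF, of b] by (simp add: b_def)
      moreover have "\<forall>\<^sub>F s in at t within {0..T}. a / 2 < norm (u s - v s)"
        using order_tendstoD(1)[OF cn, of "a / 2"] ab by (simp add: a_def)
      ultimately have "\<forall>\<^sub>F s in at t within {0..T}. norm (F (u s) - F (v s)) \<le> (2 * b / a) * norm (u s - v s)"
      proof eventually_elim
        case (elim s)
        have "b = (2 * b / a) * (a / 2)" using ab by simp
        also have "\<dots> \<le> (2 * b / a) * norm (u s - v s)"
          using elim ab by (intro mult_left_mono) auto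
        finally show ?case using elim by simp
      qed
      then show ?thesis using ab by (intro exI[of _ "2 * b / a"]) auto
    qed
    then obtain L where L: "L \<ge> 0" "\<forall>\<^sub>F s in at t within {0..T}. norm (F (u s) - F (v s)) \<le> L * norm (u s - v s)"
      by blast
    then obtain d where d: "d > 0" "\<And>s. s \<in> {0..T} \<Longrightarrow> s \<noteq> t \<Longrightarrow> dist s t < d \<Longrightarrow>
        norm (F (u s) - F (v s)) \<le> L * norm (u s - v s)"
      by (auto simp: eventually_at)
    \<comment> \<open>The filter \<open>at t within {0..T}\<close> leaves out \<open>t\<close>, so
      the quotient at \<open>t\<close> is added by hand; if the curves meet there, division by zero
      makes it 0.\<close>
    define L' where "L' = max L (norm (F (u t) - F (v t)) / norm (u t - v t))"
    have L': "L \<le> L'" by (simp add: L'_def)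
    have at_t: "norm (F (u t) - F (v t)) \<le> L' * norm (u t - v t)"
      by (cases "u t = v t") (auto simp: L'_def field_simps max_def)
    have "norm (F (u s) - F (v s)) \<le> L' * norm (u s - v s)" if "s \<in> {0..T}" "dist s t < d" for s
    proof (cases "s = t")
      case False
      then show ?thesis using d(2)[OF that(1) False that(2)] L'
        by (meson mult_right_mono norm_ge_zero order_trans)
    qed (use at_t in simp)
    then show ?case
      unfolding P_def using d(1) L(1) L'
      by (intro exI[of _ d]) (fastforce simp: dist_real_def intro!: exI[of _ L'])
  qed
  then show ?thesis using that unfolding P_def by auto
qed

text \<open>Compare the maximum of \<open>exp (- \<lambda> t) * norm (u t - v t)\<close> with itself through
  the Duhamel formula.\<close>

lemma mild_solution_unique:
  fixes u v :: "real \<Rightarrow> 'a::banach"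
  assumes S: "C0_semigroup S" "quasicontraction \<kappa> S" and F: "locally_lipschitz F"
    and u: "mild_solution S F u0 T u" and v: "mild_solution S F u0 T v" and t: "t \<in> {0..T}"
  shows "u t = v t"
proof -
  have T: "0 \<le> T" using t by simp
  have cu: "continuous_on {0..T} u" and cv: "continuous_on {0..T} v"
    using u v by (auto simp: mild_solution_def)
  obtain L where L: "L \<ge> 0" "\<And>t. t \<in> {0..T} \<Longrightarrow> norm (F (u t) - F (v t)) \<le> L * norm (u t - v t)"
    using lipschitz_along_curves[OF F T cu cv] by blast
  define M where "M = exp (\<bar>\<kappa>\<bar> * T)"
  define c where "c = M * L + 1"
  \<comment> \<open>With \<open>l = 2 * c\<close> the Duhamel integral of the weight
    \<open>exp (l * s)\<close> returns at most half of the maximum \<open>m\<close>, which forces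
    \<open>m = 0\<close>. The summand 1 in \<open>c\<close> keeps \<open>c\<close> positive.\<close>
  define l where "l = 2 * c"
  have M: "M > 0" and c: "c > 0" and l: "l > 0" using L by (auto simp: M_def c_def l_def add_nonneg_pos)
  have "continuous_on {0..T} (\<lambda>t. exp (- l * t) * norm (u t - v t))"
    by (intro continuous_intros cu cv)
  then obtain r where r: "r \<in> {0..T}" "\<And>t. t \<in> {0..T} \<Longrightarrow> exp (- l * t) * norm (u t - v t) \<le> exp (- l * r) * norm (u r - v r)"
    using continuous_attains_sup[of "{0..T}" "\<lambda>t. exp (- l * t) * norm (u t - v t)"] T by auto
  define m where "m = exp (- l * r) * norm (u r - v r)"
  have m: "norm (u s - v s) \<le> m * exp (l * s)" if "s \<in> {0..T}" for s
    using mult_left_mono[OF r(2)[OF that], of "exp (l * s)"]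
    by (simp add: m_def mult.commute mult.left_commute flip: mult.assoc exp_add)
  have "((\<lambda>s. S (r - s) (F (u s)) - S (r - s) (F (v s))) has_integral ((u r - S r u0) - (v r - S r u0))) {0..r}"
    using u v r(1) by (intro has_integral_diff) (auto simp: mild_solution_def)
  then have I: "((\<lambda>s. S (r - s) (F (u s)) - S (r - s) (F (v s))) has_integral (u r - v r)) {0..r}" by simp
  have J: "((\<lambda>s. c * m * exp (l * s)) has_integral (c * m * exp (l * r) / l - c * m * exp (l * 0) / l)) {0..r}"
    using r(1) l by (intro fundamental_theorem_of_calculus)
      (auto intro!: derivative_eq_intros simp flip: has_real_derivative_iff_has_vector_derivative)
  have le: "norm (S (r - s) (F (u s)) - S (r - s) (F (v s))) \<le> c * m * exp (l * s)" if s: "s \<in> {0..r}" for s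
  proof -
    have rs: "r - s \<ge> 0" "r - s \<le> T" using s r by auto
    have "bounded_linear (S (r - s))" using S rs by (simp add: C0_semigroup_def)
    then have "S (r - s) (F (u s)) - S (r - s) (F (v s)) = S (r - s) (F (u s) - F (v s))"
      by (simp add: linear_diff bounded_linear.linear)
    also have "norm \<dots> \<le> exp (\<kappa> * (r - s)) * norm (F (u s) - F (v s))"
      using S rs by (simp add: quasicontraction_def)
    also have "\<dots> \<le> M * (L * (m * exp (l * s)))"
    proof (intro mult_mono order_trans[OF L(2)] mult_left_mono m L)
      have "\<kappa> * (r - s) \<le> \<bar>\<kappa>\<bar> * T" using rs by (intro mult_mono) auto
      then show "exp (\<kappa> * (r - s)) \<le> M" by (simp add: M_def)
    qed (use s r M in auto)
    also have "\<dots> \<le> c * m * exp (l * s)"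
    proof -
      have "0 \<le> m" by (simp add: m_def)
      then show ?thesis by (simp add: c_def algebra_simps)
    qed
    finally show ?thesis .
  qed
  have "norm (u r - v r) \<le> c * m * exp (l * r) / l - c * m * exp (l * 0) / l"
    using integral_norm_bound_integral[of _ "{0..r}" "\<lambda>s. c * m * exp (l * s)"] I J le
    by (metis (no_types, lifting) has_integral_integrable has_integral_integrable_integral integral_unique)
  also have "\<dots> \<le> m * exp (l * r) / 2"
  proof -
    have "0 \<le> m" by (simp add: m_def)
    then show ?thesis using c by (simp add: l_def)
  qed
  finally have "norm (u r - v r) \<le> m * exp (l * r) / 2" .
  moreover have "m * exp (l * r) = norm (u r - v r)"
    by (simp add: m_def exp_minus)
  ultimately have "norm (u r - v r) = 0" using norm_ge_zero[of "u r - v r"] by linarith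
  then have "m = 0" by (simp add: m_def)
  then have "norm (u t - v t) \<le> 0" using m[OF t] by simp
  then show ?thesis by simp
qed

text \<open>Factoring out the semigroup at the smaller time leaves an increment that starts at time
  0. Strong continuity at 0 thus passes to all times in \<open>{0..T}\<close> with one
  constant.\<close>

lemma C0_semigroup_Lipschitz_time:
  assumes S: "C0_semigroup S" "quasicontraction \<kappa> S" and st: "0 \<le> s" "s \<le> T" "0 \<le> t" "t \<le> T"
  shows "norm (S t u - S s u) \<le> exp (\<bar>\<kappa>\<bar> * T) * norm (S \<bar>t - s\<bar> u - u)"
  using st
proof (induction s t rule: linorder_wlog)
  case (le s t)
  have "S t u = S s (S (t - s) u)"
    using S le unfolding C0_semigroup_def by (metis add.commute diff_add_cancel diff_ge_0_iff_ge)
  then have "S t u - S s u = S s (S (t - s) u - u)"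
    using S le by (simp add: C0_semigroup_def linear_diff bounded_linear.linear)
  then have "norm (S t u - S s u) \<le> exp (\<kappa> * s) * norm (S (t - s) u - u)"
    using S le by (simp add: quasicontraction_def)
  also have "\<dots> \<le> exp (\<bar>\<kappa>\<bar> * T) * norm (S (t - s) u - u)"
  proof (intro mult_right_mono)
    have "\<kappa> * s \<le> \<bar>\<kappa>\<bar> * T" using le by (intro mult_mono) auto
    then show "exp (\<kappa> * s) \<le> exp (\<bar>\<kappa>\<bar> * T)" by simp
  qed simp
  finally show ?case using le by simp
next
  case (sym s t)
  then show ?case by (simp add: norm_minus_commute abs_minus_commute)
qed

lemma C0_semigroup_continuous:
  assumes S: "C0_semigroup S" "quasicontraction \<kappa> S"
  shows "continuous_on {0..T} (\<lambda>t. S t u)"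
  unfolding continuous_on_iff
proof (intro ballI allI impI)
  fix t e :: real assume t: "t \<in> {0..T}" and e: "e > 0"
  define M where "M = exp (\<bar>\<kappa>\<bar> * T)"
  have M: "M > 0" by (simp add: M_def)
  have "((\<lambda>t. S t u) \<longlongrightarrow> u) (at_right 0)" using S by (simp add: C0_semigroup_def)
  then have "\<forall>\<^sub>F t in at_right 0. dist (S t u) u < e / M" using e M by (intro tendstoD) auto
  then obtain d where d: "d > 0" "\<And>h. 0 < h \<Longrightarrow> h < d \<Longrightarrow> norm (S h u - u) < e / M"
    unfolding eventually_at_right_field by (auto simp: dist_norm)
  have S0: "S 0 u = u" using S by (simp add: C0_semigroup_def)
  show "\<exists>d>0. \<forall>s\<in>{0..T}. dist s t < d \<longrightarrow> dist (S s u) (S t u) < e"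
  proof (intro exI conjI ballI impI)
    fix s assume s: "s \<in> {0..T}" "dist s t < d"
    have "norm (S \<bar>s - t\<bar> u - u) < e / M"
      using d(2)[of "\<bar>s - t\<bar>"] s(2) e M S0 by (cases "s = t") (auto simp: dist_real_def)
    then have "M * norm (S \<bar>s - t\<bar> u - u) < e" using M by (simp add: less_divide_eq mult.commute)
    moreover have "norm (S s u - S t u) \<le> M * norm (S \<bar>s - t\<bar> u - u)"
      unfolding M_def using s t by (intro C0_semigroup_Lipschitz_time[OF S]) auto
    ultimately show "dist (S s u) (S t u) < e" by (simp add: dist_norm)
  qed (rule d)
qed

lemma C0_semigroup_id: "C0_semigroup (\<lambda>_ u. u)"
  by (simp add: C0_semigroup_def bounded_linear_ident)

lemma quasicontraction_id: "quasicontraction 0 (\<lambda>_ u. u)"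
  by (simp add: quasicontraction_def)

lemma mild_solution_restrict:
  "mild_solution S F u0 T u \<Longrightarrow> t \<le> T \<Longrightarrow> mild_solution S F u0 t u"
  unfolding mild_solution_def by (auto elim: continuous_on_subset)

lemma continuous_on_at_0E:
  fixes f :: "real \<Rightarrow> 'a::real_normed_vector"
  assumes "continuous_on {0..T} f" "0 \<le> T" "0 < e"
  obtains d where "d > 0" "\<And>s. 0 \<le> s \<Longrightarrow> s \<le> T \<Longrightarrow> s < d \<Longrightarrow> norm (f s - f 0) < e"
proof -
  have "(0::real) \<in> {0..T}" using assms(2) by simp
  then obtain d where "d > 0" "\<forall>s\<in>{0..T}. dist s 0 < d \<longrightarrow> dist (f s) (f 0) < e"
    using assms(1,3) unfolding continuous_on_iff by blast
  then show ?thesis by (intro that[of d]) (auto simp: dist_norm)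
qed

section \<open>The mild flow\<close>

locale mild =
  fixes S :: "real \<Rightarrow> 'a::banach \<Rightarrow> 'a" and F :: "'a \<Rightarrow> 'a" and \<kappa> :: real
  assumes S: "C0_semigroup S" "quasicontraction \<kappa> S" and F: "locally_lipschitz F"
begin

text \<open>Uniqueness of mild solutions makes the description operator in \<open>mild_flow\<close>
  pick the endpoint of any solution at hand.\<close>

lemma mild_flow_eq:
  assumes "mild_solution S F u0 T u" "t \<in> {0..T}"
  shows "mild_flow S F t u0 = Some (u t)"
proof -
  have sol: "mild_solution S F u0 t u" using assms by (auto intro: mild_solution_restrict)
  have "(THE x. \<exists>u. mild_solution S F u0 t u \<and> u t = x) = u t"
  proof (rule the_equality)
    fix x assume "\<exists>u. mild_solution S F u0 t u \<and> u t = x"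
    then show "x = u t" using mild_solution_unique[OF S F _ sol, of _ t] assms(2) by auto
  qed (use sol in blast)
  then show ?thesis using sol assms(2) by (auto simp: mild_flow_def)
qed

lemma mild_flow_SomeE:
  assumes "mild_flow S F T u0 = Some x"
  obtains u where "0 \<le> T" "mild_solution S F u0 T u" "u T = x"
    "\<And>t. t \<in> {0..T} \<Longrightarrow> mild_flow S F t u0 = Some (u t)"
proof -
  obtain u where u: "0 \<le> T" "mild_solution S F u0 T u"
    using assms by (auto simp: mild_flow_def split: if_splits)
  moreover have "u T = x" using mild_flow_eq[OF u(2), of T] u(1) assms by simp
  ultimately show ?thesis using that mild_flow_eq by blast
qed

lemma mild_solution_0: "mild_solution S F u0 0 (\<lambda>_. u0)"
  using S by (auto simp: mild_solution_def C0_semigroup_def)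

lemma mild_flow_0: "mild_flow S F 0 u0 = Some u0"
  using mild_flow_eq[OF mild_solution_0] by simp

text \<open>Apply \<open>S r\<close> to the Duhamel formula at time \<open>t\<close> and subtract
  the result from the formula at time \<open>t + r\<close>. What remains is the formula that starts
  from \<open>u t\<close>; the semigroup law of the flow follows.\<close>

lemma mild_solution_shift:
  assumes u: "mild_solution S F u0 T u" and t: "t \<in> {0..T}"
  shows "mild_solution S F (u t) (T - t) (\<lambda>s. u (s + t))"
  unfolding mild_solution_def
proof (intro conjI ballI)
  have "continuous_on {0..T} u" using u by (simp add: mild_solution_def)
  then show "continuous_on {0..T - t} (\<lambda>s. u (s + t))"
    by (rule continuous_on_compose2) (use t in \<open>auto intro!: continuous_intros\<close>)
next
  fix r assume r: "r \<in> {0..T - t}"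
  let ?f = "\<lambda>s. S (t + r - s) (F (u s))"
  have bl: "bounded_linear (S r)" using S r by (simp add: C0_semigroup_def)
  have Sr: "S r (S p v) = S (r + p) v" if "0 \<le> p" for p v
    using S r that by (simp add: C0_semigroup_def)
  have "((\<lambda>s. S (t - s) (F (u s))) has_integral (u t - S t u0)) {0..t}"
    using u t by (simp add: mild_solution_def)
  from has_integral_linear[OF this bl]
  have A: "(?f has_integral (S r (u t) - S (r + t) u0)) {0..t}"
  proof (subst (asm) has_integral_cong)
    fix s assume "s \<in> {0..t}"
    then show "(S r \<circ> (\<lambda>s. S (t - s) (F (u s)))) s = ?f s"
      by (simp add: Sr algebra_simps)
  qed (use Sr[of t u0] t bl in \<open>simp add: linear_diff bounded_linear.linear\<close>)
  have B: "(?f has_integral (u (t + r) - S (t + r) u0)) {0..t + r}"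
    using u t r by (simp add: mild_solution_def)
  have "?f integrable_on {t..t + r}"
    using B r t by (intro integrable_subinterval_real[OF has_integral_integrable[OF B]]) auto
  then obtain I where I: "(?f has_integral I) {t..t + r}" by blast
  have "(?f has_integral ((S r (u t) - S (r + t) u0) + I)) {0..t + r}"
    using t r by (intro has_integral_combine[OF _ _ A I]) auto
  then have "(S r (u t) - S (r + t) u0) + I = u (t + r) - S (t + r) u0"
    using B has_integral_unique by blast
  then have "I = u (r + t) - S r (u t)" by (simp add: algebra_simps)
  with has_integral_shift_real_ivl[OF I, of t]
  show "((\<lambda>s. S (r - s) (F (u (s + t)))) has_integral u (r + t) - S r (u t)) {0..r}"
    by (simp add: algebra_simps)
qed

lemma mild_flow_add:
  assumes "mild_flow S F (t + s) u0 = Some z" "0 \<le> t" "0 \<le> s"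
  obtains y where "mild_flow S F t u0 = Some y" "mild_flow S F s y = Some z"
proof -
  obtain u where u: "mild_solution S F u0 (t + s) u" "u (t + s) = z"
    using assms(1) by (rule mild_flow_SomeE)
  have "mild_flow S F t u0 = Some (u t)" using assms by (intro mild_flow_eq[OF u(1)]) auto
  moreover have "mild_flow S F s (u t) = Some (u (s + t))"
    using mild_flow_eq[OF mild_solution_shift[OF u(1), of t], of s] assms by simp
  ultimately show ?thesis using that u(2) by (simp add: add.commute)
qed

lemma mild_flow_zero:
  assumes "F 0 = 0" "0 \<le> t" shows "mild_flow S F t 0 = Some 0"
proof -
  have "S p 0 = 0" if "0 \<le> p" for p
    using S that by (simp add: C0_semigroup_def linear_0 bounded_linear.linear)
  then have "mild_solution S F 0 t (\<lambda>_. 0)"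
    using assms by (auto simp: mild_solution_def intro: has_integral_is_0)
  then show ?thesis using mild_flow_eq[of 0 t "\<lambda>_. 0" t] assms by simp
qed

text \<open>Neither \<open>mild_flow S F h u0\<close> nor \<open>S h u0\<close> need be
  differentiable at \<open>h = 0\<close>, but their difference is the Duhamel integral, whose mean
  tends to \<open>F u0\<close>. This later identifies the field of the full flow as the sum of the
  fields of its parts.\<close>

lemma mild_flow_deriv:
  assumes "h0 > 0" "mild_flow S F h0 u0 \<noteq> None"
  shows "((\<lambda>h. (the (mild_flow S F h u0) - S h u0) /\<^sub>R h) \<longlongrightarrow> F u0) (at_right 0)"
proof -
  obtain u where u: "mild_solution S F u0 h0 u"
    and fl: "\<And>t. t \<in> {0..h0} \<Longrightarrow> mild_flow S F t u0 = Some (u t)"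
    using assms(2) by (metis option.exhaust mild_flow_SomeE)
  have u_0: "u 0 = u0" using fl[of 0] mild_flow_0 assms(1) by simp
  define M where "M = exp (\<bar>\<kappa>\<bar> * h0)"
  have M: "M > 0" by (simp add: M_def)
  show ?thesis
  proof (rule tendstoI)
    fix e :: real assume e: "e > 0"
    have "continuous_on UNIV F"
      by (simp add: continuous_at_imp_continuous_on locally_lipschitz_isCont[OF F])
    moreover have "continuous_on {0..h0} u" using u by (simp add: mild_solution_def)
    ultimately have "continuous_on {0..h0} (\<lambda>s. F (u s))" by (rule continuous_on_compose2) simp
    \<comment> \<open>Two errors of size \<open>e / 4\<close> enter: the variation of
      \<open>F\<close> along the solution, enlarged by at most \<open>M\<close> under the semigroup,
      and the variation of the semigroup at \<open>F u0\<close>.\<close>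
    then obtain d1 where d1: "d1 > 0" "\<And>s. 0 \<le> s \<Longrightarrow> s \<le> h0 \<Longrightarrow> s < d1 \<Longrightarrow> norm (F (u s) - F u0) < e / (4 * M)"
      by (rule continuous_on_at_0E[of h0 _ "e / (4 * M)"]) (use assms(1) e M u_0 in auto)
    have "continuous_on {0..h0} (\<lambda>s. S s (F u0))" by (rule C0_semigroup_continuous[OF S])
    then obtain d2 where d2: "d2 > 0" "\<And>s. 0 \<le> s \<Longrightarrow> s \<le> h0 \<Longrightarrow> s < d2 \<Longrightarrow> norm (S s (F u0) - F u0) < e / 4"
      by (rule continuous_on_at_0E[of h0 _ "e / 4"]) (use assms(1) e S in \<open>auto simp: C0_semigroup_def\<close>)
    define d where "d = min h0 (min d1 d2)"
    have d: "d > 0" using d1 d2 assms by (simp add: d_def)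
    have "norm ((the (mild_flow S F h u0) - S h u0) /\<^sub>R h - F u0) < e" if h: "0 < h" "h < d" for h
    proof -
      have "((\<lambda>s. S (h - s) (F (u s)) - F u0) has_integral ((u h - S h u0) - h *\<^sub>R F u0)) {0..h}"
        using u h has_integral_const_real[of "F u0" 0 h]
        by (intro has_integral_diff) (auto simp: mild_solution_def d_def)
      then have "norm ((u h - S h u0) - h *\<^sub>R F u0) \<le> (e / 2) * measure lborel {0..h}"
      proof (rule has_integral_bound_real[rotated 2])
        fix s assume s: "s \<in> {0..h} - {}"
        then have hs: "0 \<le> h - s" "h - s \<le> h0" "h - s < d2" using h by (auto simp: d_def)
        have "S (h - s) (F (u s)) - F u0 = S (h - s) (F (u s) - F u0) + (S (h - s) (F u0) - F u0)"
          using S hs by (simp add: C0_semigroup_def linear_diff bounded_linear.linear)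
        also have "norm \<dots> \<le> norm (S (h - s) (F (u s) - F u0)) + norm (S (h - s) (F u0) - F u0)"
          by (rule norm_triangle_ineq)
        also have "\<dots> \<le> M * (e / (4 * M)) + e / 4"
        proof (rule add_mono)
          have "norm (S (h - s) (F (u s) - F u0)) \<le> exp (\<kappa> * (h - s)) * norm (F (u s) - F u0)"
            using S hs by (simp add: quasicontraction_def)
          also have "\<dots> \<le> M * (e / (4 * M))"
          proof (intro mult_mono)
            have "\<kappa> * (h - s) \<le> \<bar>\<kappa>\<bar> * h0" using hs by (intro mult_mono) auto
            then show "exp (\<kappa> * (h - s)) \<le> M" by (simp add: M_def)
            show "norm (F (u s) - F u0) \<le> e / (4 * M)"
              using d1(2)[of s] s h by (auto simp: d_def)
          qed (use M in auto)
          finally show "norm (S (h - s) (F (u s) - F u0)) \<le> M * (e / (4 * M))" .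
          show "norm (S (h - s) (F u0) - F u0) \<le> e / 4" using d2(2)[OF hs] by simp
        qed
        also have "\<dots> = e / 2" using M by simp
        finally show "norm (S (h - s) (F (u s)) - F u0) \<le> e / 2" .
      qed (use e in auto)
      then have "norm ((u h - S h u0) - h *\<^sub>R F u0) \<le> (e / 2) * h" using h by simp
      moreover have "(u h - S h u0) /\<^sub>R h - F u0 = ((u h - S h u0) - h *\<^sub>R F u0) /\<^sub>R h"
        using h by (simp add: scaleR_right_diff_distrib)
      ultimately have "norm ((u h - S h u0) /\<^sub>R h - F u0) \<le> e / 2"
        using h by (simp add: inverse_eq_divide pos_divide_le_eq mult.commute)
      moreover have "the (mild_flow S F h u0) = u h" using fl[of h] h by (simp add: d_def)
      ultimately show ?thesis using e by simp
    qed
    then show "\<forall>\<^sub>F h in at_right 0. dist ((the (mild_flow S F h u0) - S h u0) /\<^sub>R h) (F u0) < e"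
      using d by (auto simp: eventually_at_right_field dist_norm)
  qed
qed

end

lemma mild_flow_linear:
  fixes S :: "real \<Rightarrow> 'a::banach \<Rightarrow> 'a"
  assumes S: "C0_semigroup S" "quasicontraction \<kappa> S" and "0 \<le> t"
  shows "mild_flow S (\<lambda>_. 0) t u = Some (S t u)"
proof -
  interpret mild S "\<lambda>_. 0" \<kappa>
  proof unfold_locales
    show "locally_lipschitz (\<lambda>_::'a. 0 :: 'a)"
      unfolding locally_lipschitz_def
      by (intro allI exI[of _ "1::real"] exI[of _ "0::real"] conjI ballI) auto
  qed (use S in auto)
  have "S p 0 = 0" if "0 \<le> p" for p
    using S that by (simp add: C0_semigroup_def linear_0 bounded_linear.linear)
  then have "mild_solution S (\<lambda>_. 0) u t (\<lambda>t. S t u)"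
    using C0_semigroup_continuous[OF S] by (auto simp: mild_solution_def intro: has_integral_is_0)
  then show ?thesis using mild_flow_eq[of u t _ t] assms(3) by simp
qed

section \<open>Stability\<close>

lemma iter_splitting_funpow:
  "iter (splitting A B h) n u = Some v \<Longrightarrow> v = ((\<lambda>x. the (A h (the (B h x)))) ^^ n) u"
proof (induction n arbitrary: v)
  case (Suc n)
  then obtain x where x: "iter (splitting A B h) n u = Some x" "splitting A B h x = Some v"
    by (auto simp: map_comp_Some_iff)
  then obtain y where "B h x = Some y" "A h y = Some v" by (auto simp: splitting_def map_comp_Some_iff)
  then show ?case using Suc.IH[OF x(1)] by simp
qed simp

text \<open>\<open>r t u\<close> is the increment of the nonlinear flow, and \<open>L * t\<close>
  its Lipschitz constant as uniform stability gives it. The exponent \<open>\<kappa>\<close> is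
  nonnegative so that the exponential factors are at least 1 and grow with time.\<close>

locale stable_splitting =
  fixes S :: "real \<Rightarrow> 'a::real_normed_vector \<Rightarrow> 'a" and \<phi>0 \<phi>1 :: "real \<Rightarrow> 'a \<rightharpoonup> 'a"
    and r :: "real \<Rightarrow> 'a \<Rightarrow> 'a" and R L h1 \<kappa> :: real
  assumes lin: "\<And>t. 0 \<le> t \<Longrightarrow> linear (S t)"
    and sem: "\<And>a b u. 0 \<le> a \<Longrightarrow> 0 \<le> b \<Longrightarrow> S (a + b) u = S a (S b u)"
    and S0: "\<And>u. S 0 u = u"
    and S_le: "\<And>t u. 0 \<le> t \<Longrightarrow> norm (S t u) \<le> exp (\<kappa> * t) * norm u"
    and \<kappa>: "0 \<le> \<kappa>" and L: "0 \<le> L"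
    and \<phi>0: "\<And>t u. 0 \<le> t \<Longrightarrow> \<phi>0 t u = Some (S t u)"
    and \<phi>1: "\<And>t u. 0 < t \<Longrightarrow> t < h1 \<Longrightarrow> u \<in> ball 0 R \<Longrightarrow> \<phi>1 t u = Some (u + r t u)"
    and r_0: "\<And>t. 0 < t \<Longrightarrow> t < h1 \<Longrightarrow> r t 0 = 0"
    and r_le: "\<And>t u v. 0 < t \<Longrightarrow> t < h1 \<Longrightarrow> u \<in> ball 0 R \<Longrightarrow> v \<in> ball 0 R \<Longrightarrow>
        norm (r t u - r t v) \<le> L * t * norm (u - v)"
begin

abbreviation (input) "K \<equiv> \<kappa> + L"

text \<open>A step is the semigroup plus a perturbation with Lipschitz constant of order
  \<open>t\<close>. The factor \<open>exp (K * t)\<close> leaves room in the ball for the value of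
  the semigroup when it acts first, and \<open>\<rho> 0 = 0\<close> turns Lipschitz bounds into
  growth bounds.\<close>

definition one_step :: "(real \<Rightarrow> 'a \<rightharpoonup> 'a) \<Rightarrow> bool" where
  "one_step \<Psi> \<longleftrightarrow> (\<forall>t. 0 < t \<longrightarrow> t < h1 \<longrightarrow> (\<exists>\<rho>. \<rho> 0 = 0 \<and>
     (\<forall>v. exp (K * t) * norm v < R \<longrightarrow> \<Psi> t v = Some (S t v + \<rho> v)) \<and>
     (\<forall>v w. exp (K * t) * norm v < R \<longrightarrow> exp (K * t) * norm w < R \<longrightarrow>
        norm (\<rho> v - \<rho> w) \<le> L * t * exp (\<kappa> * t) * norm (v - w))))"

lemma exp_bounds:
  assumes "0 \<le> t"
  shows "1 \<le> exp (\<kappa> * t)" "exp (\<kappa> * t) \<le> exp (K * t)" "1 \<le> exp (K * t)"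
    "exp (\<kappa> * t) * (1 + L * t) \<le> exp (K * t)"
proof -
  show "1 \<le> exp (\<kappa> * t)" "1 \<le> exp (K * t)" using assms \<kappa> L by simp_all
  show "exp (\<kappa> * t) \<le> exp (K * t)" using assms L by (simp add: distrib_right)
  have "exp (\<kappa> * t) * (1 + L * t) \<le> exp (\<kappa> * t) * exp (L * t)"
    by (intro mult_left_mono exp_ge_add_one_self) auto
  then show "exp (\<kappa> * t) * (1 + L * t) \<le> exp (K * t)" by (simp add: distrib_right flip: exp_add)
qed

lemma S_ball: "0 \<le> t \<Longrightarrow> exp (K * t) * norm v < R \<Longrightarrow> S t v \<in> ball 0 R \<and> v \<in> ball 0 R"
  using S_le[of t v] exp_bounds(2)[of t] exp_bounds(3)[of t]
    mult_right_mono[OF exp_bounds(2), of t "norm v"] mult_right_mono[OF exp_bounds(3), of t "norm v"]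
  by simp

lemma S_diff: "0 \<le> t \<Longrightarrow> S t (u - v) = S t u - S t v"
  using lin by (simp add: linear_diff)

lemma one_step_plus: "one_step (splitting \<phi>1 \<phi>0)"
  unfolding one_step_def
proof (intro allI impI)
  fix t assume t: "0 < t" "t < h1"
  show "\<exists>\<rho>. \<rho> 0 = 0 \<and>
     (\<forall>v. exp (K * t) * norm v < R \<longrightarrow> splitting \<phi>1 \<phi>0 t v = Some (S t v + \<rho> v)) \<and>
     (\<forall>v w. exp (K * t) * norm v < R \<longrightarrow> exp (K * t) * norm w < R \<longrightarrow>
        norm (\<rho> v - \<rho> w) \<le> L * t * exp (\<kappa> * t) * norm (v - w))"
  proof (intro exI[of _ "\<lambda>v. r t (S t v)"] conjI allI impI)
    show "r t (S t 0) = 0" using lin[of t] r_0 t by (simp add: linear_0)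
  next
    fix v :: 'a assume v: "exp (K * t) * norm v < R"
    show "splitting \<phi>1 \<phi>0 t v = Some (S t v + r t (S t v))"
      using t \<phi>0 \<phi>1 S_ball[OF _ v] by (simp add: splitting_def map_comp_simps)
  next
    fix v w :: 'a assume v: "exp (K * t) * norm v < R" and w: "exp (K * t) * norm w < R"
    have "norm (r t (S t v) - r t (S t w)) \<le> L * t * norm (S t v - S t w)"
      using t S_ball[OF _ v] S_ball[OF _ w] by (intro r_le) auto
    also have "\<dots> \<le> L * t * (exp (\<kappa> * t) * norm (v - w))"
      using t L S_le[of t "v - w"] by (intro mult_left_mono) (auto simp: S_diff)
    finally show "norm (r t (S t v) - r t (S t w)) \<le> L * t * exp (\<kappa> * t) * norm (v - w)" by simp
  qed
qed

lemma one_step_minus: "one_step (splitting \<phi>0 \<phi>1)"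
  unfolding one_step_def
proof (intro allI impI)
  fix t assume t: "0 < t" "t < h1"
  show "\<exists>\<rho>. \<rho> 0 = 0 \<and>
     (\<forall>v. exp (K * t) * norm v < R \<longrightarrow> splitting \<phi>0 \<phi>1 t v = Some (S t v + \<rho> v)) \<and>
     (\<forall>v w. exp (K * t) * norm v < R \<longrightarrow> exp (K * t) * norm w < R \<longrightarrow>
        norm (\<rho> v - \<rho> w) \<le> L * t * exp (\<kappa> * t) * norm (v - w))"
  proof (intro exI[of _ "\<lambda>v. S t (r t v)"] conjI allI impI)
    show "S t (r t 0) = 0" using lin[of t] r_0 t by (simp add: linear_0)
  next
    fix v :: 'a assume v: "exp (K * t) * norm v < R"
    show "splitting \<phi>0 \<phi>1 t v = Some (S t v + S t (r t v))"
      using t \<phi>0 \<phi>1 S_ball[OF _ v] lin[of t] by (simp add: splitting_def map_comp_simps linear_add)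
  next
    fix v w :: 'a assume v: "exp (K * t) * norm v < R" and w: "exp (K * t) * norm w < R"
    have "norm (S t (r t v) - S t (r t w)) \<le> exp (\<kappa> * t) * norm (r t v - r t w)"
      using t S_le[of t "r t v - r t w"] by (simp add: S_diff)
    also have "\<dots> \<le> exp (\<kappa> * t) * (L * t * norm (v - w))"
      using t S_ball[OF _ v] S_ball[OF _ w] by (intro mult_left_mono r_le) auto
    finally show "norm (S t (r t v) - S t (r t w)) \<le> L * t * exp (\<kappa> * t) * norm (v - w)" by (simp add: mult_ac)
  qed
qed

text \<open>The bounds are needed together: growth keeps both iterates where the next step is
  defined, the Lipschitz bound controls the new perturbation, and the deviations from the semigroup
  then add up in proportion to the elapsed time \<open>real k * t\<close>.\<close>

lemma iterate_stable:
  assumes \<Psi>: "one_step \<Psi>" and t: "0 < t" "t < h1" and k: "k \<le> m"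
    and u: "exp (K * (real m * t)) * norm u < R" and v: "exp (K * (real m * t)) * norm v < R"
  shows "\<exists>x y. iter (\<Psi> t) k u = Some x \<and> iter (\<Psi> t) k v = Some y \<and>
     norm x \<le> exp (K * (real k * t)) * norm u \<and> norm y \<le> exp (K * (real k * t)) * norm v \<and>
     norm (x - y) \<le> exp (K * (real k * t)) * norm (u - v) \<and>
     norm ((x - S (real k * t) u) - (y - S (real k * t) v)) \<le> real k * t * L * exp (K * (real k * t)) * norm (u - v)"
  using k
proof (induction k)
  case 0
  then show ?case by (simp add: S0)
next
  case (Suc k)
  then obtain x y where xy: "iter (\<Psi> t) k u = Some x" "iter (\<Psi> t) k v = Some y"
    and x: "norm x \<le> exp (K * (real k * t)) * norm u" and y: "norm y \<le> exp (K * (real k * t)) * norm v"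
    and d: "norm (x - y) \<le> exp (K * (real k * t)) * norm (u - v)"
    and w: "norm ((x - S (real k * t) u) - (y - S (real k * t) v)) \<le> real k * t * L * exp (K * (real k * t)) * norm (u - v)"
    by auto
  obtain \<rho> where \<rho>0: "\<rho> 0 = 0" and \<rho>1: "\<And>v. exp (K * t) * norm v < R \<Longrightarrow> \<Psi> t v = Some (S t v + \<rho> v)"
    and \<rho>2: "\<And>v w. exp (K * t) * norm v < R \<Longrightarrow> exp (K * t) * norm w < R \<Longrightarrow>
        norm (\<rho> v - \<rho> w) \<le> L * t * exp (\<kappa> * t) * norm (v - w)"
    using \<Psi> t unfolding one_step_def by meson
  have E: "exp (K * t) * exp (K * (real k * t)) = exp (K * (real (Suc k) * t))"
    by (simp add: algebra_simps flip: exp_add)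
  have bnd: "exp (K * t) * norm z < R" if "norm z \<le> exp (K * (real k * t)) * norm p" "exp (K * (real m * t)) * norm p < R" for z p
  proof -
    have "exp (K * t) * norm z \<le> exp (K * t) * (exp (K * (real k * t)) * norm p)"
      using that by (intro mult_left_mono) auto
    also have "\<dots> = exp (K * (real (Suc k) * t)) * norm p"
      unfolding E[symmetric] by (simp only: mult.assoc)
    also have "\<dots> \<le> exp (K * (real m * t)) * norm p"
    proof (intro mult_right_mono)
      have "real (Suc k) * t \<le> real m * t" using Suc.prems t by (intro mult_right_mono) auto
      then have "K * (real (Suc k) * t) \<le> K * (real m * t)"
        using \<kappa> L by (intro mult_left_mono add_nonneg_nonneg)
      then show "exp (K * (real (Suc k) * t)) \<le> exp (K * (real m * t))"
        by (rule exp_le_cancel_iff[THEN iffD2])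
    qed simp
    finally show ?thesis using that(2) by (rule le_less_trans)
  qed
  note xb = bnd[OF x u] and yb = bnd[OF y v]
  \<comment> \<open>The origin is an admissible argument; comparison with it turns the Lipschitz
    bound of \<open>\<rho>\<close> into a growth bound.\<close>
  have zb: "exp (K * t) * norm (0::'a) < R" using le_less_trans[OF _ xb, of 0] by simp
  have grow: "norm (S t z + \<rho> z) \<le> exp (K * (real (Suc k) * t)) * norm p"
    if z: "exp (K * t) * norm z < R" and zp: "norm z \<le> exp (K * (real k * t)) * norm p" for z p
  proof -
    have "norm (S t z + \<rho> z) \<le> exp (\<kappa> * t) * norm z + L * t * exp (\<kappa> * t) * norm z"
      using S_le[of t z] \<rho>2[OF z zb] t by (intro norm_triangle_le add_mono) (auto simp: \<rho>0)
    also have "\<dots> = exp (\<kappa> * t) * (1 + L * t) * norm z" by (simp add: algebra_simps)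
    also have "\<dots> \<le> exp (K * t) * (exp (K * (real k * t)) * norm p)"
      using exp_bounds(4)[of t] t zp by (intro mult_mono) auto
    finally show ?thesis unfolding E[symmetric] by (simp only: mult.assoc)
  qed
  have eq: "(S t x + \<rho> x) - (S t y + \<rho> y) = S t (x - y) + (\<rho> x - \<rho> y)"
    using t by (simp add: S_diff)
  have "norm (S t (x - y) + (\<rho> x - \<rho> y)) \<le> exp (\<kappa> * t) * norm (x - y) + L * t * exp (\<kappa> * t) * norm (x - y)"
    using S_le[of t "x - y"] \<rho>2[OF xb yb] t by (intro norm_triangle_le add_mono) auto
  also have "\<dots> = exp (\<kappa> * t) * (1 + L * t) * norm (x - y)" by (simp add: algebra_simps)
  also have "\<dots> \<le> exp (K * t) * (exp (K * (real k * t)) * norm (u - v))"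
    using exp_bounds(4)[of t] t d by (intro mult_mono) auto
  finally have d': "norm ((S t x + \<rho> x) - (S t y + \<rho> y)) \<le> exp (K * (real (Suc k) * t)) * norm (u - v)"
    unfolding eq E[symmetric] by (simp only: mult.assoc)
  let ?W = "(x - S (real k * t) u) - (y - S (real k * t) v)"
  have Sk: "S (real (Suc k) * t) p = S t (S (real k * t) p)" for p
    using sem[of t "real k * t" p] t by (simp add: algebra_simps)
  \<comment> \<open>The deviation from the semigroup is transported by the linear map
    \<open>S t\<close>, and only the difference of the perturbations is added.\<close>
  have eq': "((S t x + \<rho> x) - S (real (Suc k) * t) u) - ((S t y + \<rho> y) - S (real (Suc k) * t) v) =
      S t ?W + (\<rho> x - \<rho> y)"
    using t by (simp add: Sk S_diff del: of_nat_Suc)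
  have "norm (S t ?W + (\<rho> x - \<rho> y)) \<le> exp (\<kappa> * t) * norm ?W + L * t * exp (\<kappa> * t) * norm (x - y)"
    using S_le[of t ?W] \<rho>2[OF xb yb] t by (intro norm_triangle_le add_mono) auto
  also have "\<dots> \<le> exp (K * t) * (real k * t * L * exp (K * (real k * t)) * norm (u - v)) +
      L * t * exp (K * t) * (exp (K * (real k * t)) * norm (u - v))"
    using exp_bounds(2)[of t] t w d L by (intro add_mono mult_mono) auto
  also have "\<dots> = real (Suc k) * t * L * (exp (K * t) * exp (K * (real k * t))) * norm (u - v)"
    by (simp add: algebra_simps)
  finally have w': "norm (((S t x + \<rho> x) - S (real (Suc k) * t) u) - ((S t y + \<rho> y) - S (real (Suc k) * t) v))
      \<le> real (Suc k) * t * L * exp (K * (real (Suc k) * t)) * norm (u - v)"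
    unfolding eq' E .
  have "iter (\<Psi> t) (Suc k) u = Some (S t x + \<rho> x)" "iter (\<Psi> t) (Suc k) v = Some (S t y + \<rho> y)"
    using xy \<rho>1[OF xb] \<rho>1[OF yb] by (simp_all add: map_comp_simps)
  then show ?case using grow[OF xb x] grow[OF yb y] d' w' by blast
qed

text \<open>\<open>c\<close> counts the copies of the semigroup in the map: one for an iterate, two
  for the sum of both orders of composition. What is left after removing them is Lipschitz with a
  constant of order \<open>h\<close>.\<close>

definition near_semigroup :: "real \<Rightarrow> real \<Rightarrow> (real \<Rightarrow> 'a \<rightharpoonup> 'a) \<Rightarrow> bool" where
  "near_semigroup c M \<Psi> \<longleftrightarrow> (\<forall>h u v. 0 < h \<longrightarrow> h < h1 \<longrightarrow> exp (K * h) * norm u < R \<longrightarrow> exp (K * h) * norm v < R \<longrightarrow>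
     (\<exists>x y. \<Psi> h u = Some x \<and> \<Psi> h v = Some y \<and>
        norm ((x - c *\<^sub>R S h u) - (y - c *\<^sub>R S h v)) \<le> M * h * exp (K * h) * norm (u - v)))"

lemma near_semigroup_iter:
  assumes "one_step \<Psi>" "1 \<le> m"
  shows "near_semigroup 1 L (\<lambda>h. iter (\<Psi> (h / real m)) m)"
  unfolding near_semigroup_def
proof (intro allI impI)
  fix h and u v :: 'a assume h: "0 < h" "h < h1" and u: "exp (K * h) * norm u < R" "exp (K * h) * norm v < R"
  have m: "real m \<noteq> 0" "real m \<ge> 1" using assms(2) by auto
  have "h / real m \<le> h" using h m by (simp add: divide_le_eq mult_le_cancel_left1)
  then have t: "0 < h / real m" "h / real m < h1" using h m by auto
  have mh: "real m * (h / real m) = h" using m by simp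
  show "\<exists>x y. iter (\<Psi> (h / real m)) m u = Some x \<and> iter (\<Psi> (h / real m)) m v = Some y \<and>
        norm ((x - 1 *\<^sub>R S h u) - (y - 1 *\<^sub>R S h v)) \<le> L * h * exp (K * h) * norm (u - v)"
    using iterate_stable[OF assms(1) t order_refl, of m u v] u unfolding mh
    by (auto simp: mult.commute[of h L])
qed

lemma near_semigroup_add:
  assumes "near_semigroup 1 L \<Psi>" "near_semigroup 1 L \<Psi>'"
  shows "near_semigroup 2 (2 * L) (\<lambda>h. partial_add (\<Psi> h) (\<Psi>' h))"
  unfolding near_semigroup_def
proof (intro allI impI)
  fix h and u v :: 'a assume h: "0 < h" "h < h1" and u: "exp (K * h) * norm u < R" "exp (K * h) * norm v < R"
  obtain x y where xy: "\<Psi> h u = Some x" "\<Psi> h v = Some y"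
    "norm ((x - 1 *\<^sub>R S h u) - (y - 1 *\<^sub>R S h v)) \<le> L * h * exp (K * h) * norm (u - v)"
    using assms(1) h u unfolding near_semigroup_def by meson
  obtain x' y' where xy': "\<Psi>' h u = Some x'" "\<Psi>' h v = Some y'"
    "norm ((x' - 1 *\<^sub>R S h u) - (y' - 1 *\<^sub>R S h v)) \<le> L * h * exp (K * h) * norm (u - v)"
    using assms(2) h u unfolding near_semigroup_def by meson
  have eq: "(x + x' - 2 *\<^sub>R S h u) - (y + y' - 2 *\<^sub>R S h v) =
      ((x - 1 *\<^sub>R S h u) - (y - 1 *\<^sub>R S h v)) + ((x' - 1 *\<^sub>R S h u) - (y' - 1 *\<^sub>R S h v))"
    by (simp add: scaleR_2)
  have "norm ((x + x' - 2 *\<^sub>R S h u) - (y + y' - 2 *\<^sub>R S h v)) \<le>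
      L * h * exp (K * h) * norm (u - v) + L * h * exp (K * h) * norm (u - v)"
    unfolding eq by (rule norm_triangle_mono[OF xy(3) xy'(3)])
  then have "norm ((x + x' - 2 *\<^sub>R S h u) - (y + y' - 2 *\<^sub>R S h v)) \<le> 2 * L * h * exp (K * h) * norm (u - v)"
    by (simp add: mult_ac)
  then show "\<exists>x y. partial_add (\<Psi> h) (\<Psi>' h) u = Some x \<and> partial_add (\<Psi> h) (\<Psi>' h) v = Some y \<and>
        norm ((x - 2 *\<^sub>R S h u) - (y - 2 *\<^sub>R S h v)) \<le> 2 * L * h * exp (K * h) * norm (u - v)"
    using xy xy' by (intro exI[of _ "x + x'"] exI[of _ "y + y'"]) (simp add: partial_add_def)
qed

text \<open>Since \<open>c\<close> times the sum of the weights is 1, the copies of the semigroup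
  recombine to a single \<open>S h\<close> with growth \<open>exp (\<kappa> * h)\<close>. The
  absolute values of the weights enter only through the term of order \<open>h\<close>.\<close>

lemma combination_stable:
  assumes F: "\<And>m. m \<in> {1..s} \<Longrightarrow> near_semigroup c M (\<lambda>h. F h m)" and \<gamma>: "c * (\<Sum>m=1..s. \<gamma> m) = 1" and M: "0 \<le> M"
    and R': "0 < R'" "R' < R" and h1: "0 < h1"
  shows "\<exists>h2>0. \<exists>\<mu>>0. \<forall>h u v. 0 < h \<longrightarrow> h < h2 \<longrightarrow> u \<in> ball 0 R' \<longrightarrow> v \<in> ball 0 R' \<longrightarrow>
      (\<exists>x y. partial_combination s \<gamma> (F h) u = Some x \<and> partial_combination s \<gamma> (F h) v = Some y \<and>
        norm (x - y) \<le> exp (\<mu> * h) * norm (u - v))"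
proof -
  have "((\<lambda>h. exp (K * h) * R') \<longlongrightarrow> exp (K * 0) * R') (at_right 0)" by (intro tendsto_intros)
  then have "\<forall>\<^sub>F h in at_right 0. exp (K * h) * R' < R" by (rule order_tendstoD(2)) (use R' in simp)
  then obtain h0 where h0: "0 < h0" "\<And>h. 0 < h \<Longrightarrow> h < h0 \<Longrightarrow> exp (K * h) * R' < R"
    unfolding eventually_at_right_field by blast
  define h2 where "h2 = min 1 (min h0 h1)"
  define G where "G = (\<Sum>m=1..s. \<bar>\<gamma> m\<bar>)"
  \<comment> \<open>\<open>b\<close> collects the perturbations; \<open>h < 1\<close> allows
    \<open>exp K\<close> in place of \<open>exp (K * h)\<close>. It passes into the exponent by
    \<open>1 + b * h \<le> exp (b * h)\<close>, and the summand 1 in \<open>\<mu>\<close> makes the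
    rate positive.\<close>
  define b where "b = G * M * exp K"
  define \<mu> where "\<mu> = \<kappa> + b + 1"
  have G: "0 \<le> G" by (simp add: G_def sum_nonneg)
  have b: "0 \<le> b" using G M by (simp add: b_def)
  have main: "\<exists>x y. partial_combination s \<gamma> (F h) u = Some x \<and> partial_combination s \<gamma> (F h) v = Some y \<and>
        norm (x - y) \<le> exp (\<mu> * h) * norm (u - v)"
    if h: "0 < h" "h < h2" and uv: "u \<in> ball 0 R'" "v \<in> ball 0 R'" for h and u v :: 'a
  proof -
    have in_ball: "exp (K * h) * norm p < R" if "p \<in> ball 0 R'" for p :: 'a
    proof -
      have "exp (K * h) * norm p \<le> exp (K * h) * R'" using that by (intro mult_left_mono) auto
      also have "\<dots> < R" using h0(2)[of h] h by (simp add: h2_def)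
      finally show ?thesis .
    qed
    have hh: "h < h1" "h < 1" using h by (auto simp: h2_def)
    have "\<forall>m\<in>{1..s}. \<exists>x y. F h m u = Some x \<and> F h m v = Some y \<and>
        norm ((x - c *\<^sub>R S h u) - (y - c *\<^sub>R S h v)) \<le> M * h * exp (K * h) * norm (u - v)"
    proof
      fix m assume "m \<in> {1..s}"
      from F[OF this, unfolded near_semigroup_def, rule_format, OF h(1) hh(1) in_ball[OF uv(1)] in_ball[OF uv(2)]]
      show "\<exists>x y. F h m u = Some x \<and> F h m v = Some y \<and>
        norm ((x - c *\<^sub>R S h u) - (y - c *\<^sub>R S h v)) \<le> M * h * exp (K * h) * norm (u - v)" .
    qed
    then obtain x y where xy: "\<And>m. m \<in> {1..s} \<Longrightarrow> F h m u = Some (x m)" "\<And>m. m \<in> {1..s} \<Longrightarrow> F h m v = Some (y m)"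
      "\<And>m. m \<in> {1..s} \<Longrightarrow> norm ((x m - c *\<^sub>R S h u) - (y m - c *\<^sub>R S h v)) \<le> M * h * exp (K * h) * norm (u - v)"
      by metis
    have pu: "partial_combination s \<gamma> (F h) u = Some (\<Sum>m=1..s. \<gamma> m *\<^sub>R x m)"
      and pv: "partial_combination s \<gamma> (F h) v = Some (\<Sum>m=1..s. \<gamma> m *\<^sub>R y m)"
      using xy by (auto simp: partial_combination_def intro!: sum.cong)
    let ?d = "\<lambda>m. (x m - c *\<^sub>R S h u) - (y m - c *\<^sub>R S h v)"
    have "(\<Sum>m=1..s. \<gamma> m *\<^sub>R c *\<^sub>R S h (u - v)) = (c * (\<Sum>m=1..s. \<gamma> m)) *\<^sub>R S h (u - v)"
      by (simp add: sum_distrib_left scaleR_left.sum mult.commute)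
    then have e: "(\<Sum>m=1..s. \<gamma> m *\<^sub>R c *\<^sub>R S h (u - v)) = S h (u - v)"
      by (simp only: \<gamma> scaleR_one)
    have "(\<Sum>m=1..s. \<gamma> m *\<^sub>R x m) - (\<Sum>m=1..s. \<gamma> m *\<^sub>R y m) =
        (\<Sum>m=1..s. \<gamma> m *\<^sub>R ?d m) + (\<Sum>m=1..s. \<gamma> m *\<^sub>R c *\<^sub>R S h (u - v))"
      unfolding sum.distrib[symmetric] sum_subtractf[symmetric]
      using h by (intro sum.cong refl) (simp add: S_diff algebra_simps)
    also have "\<dots> = (\<Sum>m=1..s. \<gamma> m *\<^sub>R ?d m) + S h (u - v)" unfolding e ..
    also have "norm \<dots> \<le> b * h * norm (u - v) + exp (\<kappa> * h) * norm (u - v)"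
    proof (intro norm_triangle_le add_mono S_le)
      have "norm (\<Sum>m=1..s. \<gamma> m *\<^sub>R ?d m) \<le> (\<Sum>m=1..s. \<bar>\<gamma> m\<bar> * (M * h * exp (K * h) * norm (u - v)))"
        using xy(3) by (intro sum_norm_le) (auto intro!: mult_left_mono)
      also have "\<dots> = G * (M * h * exp (K * h) * norm (u - v))"
        by (simp only: G_def sum_distrib_right)
      also have "\<dots> = G * M * exp (K * h) * h * norm (u - v)" by simp
      also have "\<dots> \<le> b * h * norm (u - v)"
      proof -
        have "K * h \<le> K" using \<kappa> L h hh by (simp add: mult_left_le)
        then have "G * M * exp (K * h) \<le> b" unfolding b_def using G M by (intro mult_left_mono) auto
        then show ?thesis using h by (intro mult_right_mono) auto
      qed
      finally show "norm (\<Sum>m=1..s. \<gamma> m *\<^sub>R ?d m) \<le> b * h * norm (u - v)" .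
    qed (use h in auto)
    also have "\<dots> = (exp (\<kappa> * h) + b * h) * norm (u - v)" by (simp add: algebra_simps)
    also have "\<dots> \<le> exp (\<mu> * h) * norm (u - v)"
    proof (intro mult_right_mono)
      have "exp (\<kappa> * h) + b * h \<le> exp (\<kappa> * h) * (1 + b * h)"
        using exp_bounds(1)[of h] h b mult_right_mono[of 1 "exp (\<kappa> * h)" "b * h"] by (simp add: distrib_left)
      also have "\<dots> \<le> exp (\<kappa> * h) * exp (b * h)" by (intro mult_left_mono exp_ge_add_one_self) auto
      also have "\<dots> \<le> exp (\<mu> * h)" using h by (simp add: \<mu>_def distrib_right flip: exp_add)
      finally show "exp (\<kappa> * h) + b * h \<le> exp (\<mu> * h)" .
    qed simp
    finally have "norm ((\<Sum>m=1..s. \<gamma> m *\<^sub>R x m) - (\<Sum>m=1..s. \<gamma> m *\<^sub>R y m)) \<le> exp (\<mu> * h) * norm (u - v)" .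
    then show ?thesis using pu pv by blast
  qed
  have "0 < h2" "0 < \<mu>" using h0 h1 \<kappa> b by (simp_all add: h2_def \<mu>_def)
  then show ?thesis using main by blast
qed

end

lemma uniformly_stableD:
  fixes \<phi> :: "real \<Rightarrow> 'a::real_normed_vector \<rightharpoonup> 'a"
  assumes "uniformly_stable R \<phi>"
  obtains h1 L where "h1 > 0" "L \<ge> 0"
    "\<And>h u v. 0 < h \<Longrightarrow> h < h1 \<Longrightarrow> u \<in> ball 0 R \<Longrightarrow> v \<in> ball 0 R \<Longrightarrow>
       norm ((the (\<phi> h u) - u) - (the (\<phi> h v) - v)) \<le> L * h * norm (u - v)"
proof -
  let ?A = "{(u, v). u \<in> ball 0 R \<and> v \<in> ball 0 R \<and> u \<noteq> v}"
  let ?q = "\<lambda>h. SUP (u, u')\<in>?A. ereal (norm ((the (\<phi> h u) - u) - (the (\<phi> h u') - u')) / norm (u - u'))"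
  have "Limsup (at_right 0) (\<lambda>h. ereal (1 / h) * ?q h) < \<infinity>"
    using assms unfolding uniformly_stable_def .
  then have "Limsup (at_right 0) (\<lambda>h. ereal (1 / h) * ?q h) \<noteq> \<infinity>" by (rule less_imp_neq)
  then obtain L where "Limsup (at_right 0) (\<lambda>h. ereal (1 / h) * ?q h) < ereal L"
    unfolding less_PInf_Ex_of_nat by blast
  then have "\<forall>\<^sub>F h in at_right 0. ereal (1 / h) * ?q h < ereal L" by (rule Limsup_lessD)
  then obtain h1 where h1: "h1 > 0" "\<And>h. 0 < h \<Longrightarrow> h < h1 \<Longrightarrow> ereal (1 / h) * ?q h < ereal L"
    unfolding eventually_at_right_field by blast
  show ?thesis
  proof (rule that[of h1 "\<bar>L\<bar>"])
    fix h and u v :: 'a assume h: "0 < h" "h < h1" and uv: "u \<in> ball 0 R" "v \<in> ball 0 R"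
    show "norm ((the (\<phi> h u) - u) - (the (\<phi> h v) - v)) \<le> \<bar>L\<bar> * h * norm (u - v)"
    proof (cases "u = v")
      case False
      define x where "x = norm ((the (\<phi> h u) - u) - (the (\<phi> h v) - v))"
      have n: "norm (u - v) > 0" using False by simp
      have "ereal (x / norm (u - v)) \<le> ?q h"
        unfolding x_def using uv False by (intro SUP_upper2[of "(u, v)"]) auto
      then have "ereal (1 / h) * ereal (x / norm (u - v)) \<le> ereal (1 / h) * ?q h"
        using h by (intro ereal_mult_left_mono) auto
      also have "\<dots> < ereal L" using h1 h by blast
      finally have "1 / h * (x / norm (u - v)) < L" using n by simp
      then have "x < L * (h * norm (u - v))" using h n by (simp add: field_simps)
      also have "\<dots> \<le> \<bar>L\<bar> * (h * norm (u - v))" using h by (intro mult_right_mono) auto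
      finally show ?thesis by (simp add: x_def)
    qed simp
  qed (use h1 in auto)
qed

lemma partial_combination_SomeD:
  assumes "partial_combination s \<gamma> F u = Some v"
  shows "v = (\<Sum>m=1..s. \<gamma> m *\<^sub>R the (F m u))" "m \<in> {1..s} \<Longrightarrow> F m u \<noteq> None"
  using assms by (auto simp: partial_combination_def split: if_splits)

section \<open>Convergence\<close>

locale splitting_problem = scale_of_spaces Hs ip
  for Hs :: "nat \<Rightarrow> 'a::{real_inner, banach} set" and ip +
  fixes S :: "real \<Rightarrow> 'a \<Rightarrow> 'a" and A1 :: "'a \<Rightarrow> 'a" and \<kappa>0 :: real
  assumes S: "C0_semigroup S" "quasicontraction \<kappa>0 S"
    and A1: "locally_lipschitz A1" "A1 0 = 0"
    and compat: "\<forall>R>0. \<exists>hs>0. \<forall>\<psi>\<in>{mild_flow S A1, mild_flow S (\<lambda>_. 0), mild_flow (\<lambda>_ u. u) A1}.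
                   defined_in_scale Hs hs R \<psi> \<and> compatible Hs ip hs R \<psi>"
    and stable1: "\<forall>R>0. uniformly_stable R (mild_flow (\<lambda>_ u. u) A1)"
begin

definition flow :: "real \<Rightarrow> 'a \<rightharpoonup> 'a" where "flow = mild_flow S A1"
definition part :: "bool \<Rightarrow> real \<Rightarrow> 'a \<rightharpoonup> 'a" where
  "part a = (if a then mild_flow (\<lambda>_ u. u) A1 else mild_flow S (\<lambda>_. 0))"

sublocale full: mild S A1 \<kappa>0
  by unfold_locales (use S A1 in auto)

sublocale nonlin: mild "\<lambda>_ u. u" A1 0
  by unfold_locales (use A1 C0_semigroup_id quasicontraction_id in auto)

sublocale lin: mild S "\<lambda>_. 0" \<kappa>0
proof unfold_locales
  show "locally_lipschitz (\<lambda>_::'a. 0 :: 'a)"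
    unfolding locally_lipschitz_def
    by (intro allI exI[of _ "1::real"] exI[of _ "0::real"] conjI ballI) auto
qed (use S in auto)

lemma part_lin: "0 \<le> t \<Longrightarrow> part False t u = Some (S t u)"
  using mild_flow_linear[OF S] by (simp add: part_def)

definition horizon :: "real \<Rightarrow> real \<Rightarrow> bool" where
  "horizon R hs \<longleftrightarrow> hs > 0 \<and>
     (\<forall>\<psi>\<in>{flow, part False, part True}. defined_in_scale Hs hs R \<psi> \<and> compatible Hs ip hs R \<psi>)"

lemma ex_horizon:
  assumes "R > 0" obtains hs where "horizon R hs"
  using compat[rule_format, OF assms] unfolding horizon_def flow_def part_def if_True if_False by blast

lemma horizon_pos: "horizon R hs \<Longrightarrow> 0 < hs"
  by (simp add: horizon_def)

lemma horizon_defined: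
  assumes "horizon R hs" "\<psi> \<in> {flow, part False, part True}" "u \<in> ball 0 R \<inter> Hs k" "t \<in> {0..hs}"
  shows "\<exists>v\<in>Hs k. \<psi> t u = Some v"
proof -
  have "defined_in_scale Hs hs R \<psi>" using assms(1,2) unfolding horizon_def by blast
  then show ?thesis using assms(3,4) unfolding defined_in_scale_def by blast
qed

lemma horizon_C0:
  assumes "horizon R hs" "\<psi> \<in> {flow, part False, part True}"
  shows "class_C_inf 0 (X l) (X l) {0..hs} (ball 0 R \<inter> Hs l) (\<lambda>h u. the (\<psi> h u))"
proof -
  have C: "compatible Hs ip hs R \<psi>" using assms unfolding horizon_def by blast
  from C[unfolded compatible_def, rule_format, of 0 l] show ?thesis by simp
qed

lemma horizon_C1:
  assumes "horizon R hs" "\<psi> \<in> {flow, part False, part True}"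
  shows "class_C_inf 1 (X (Suc l)) (X l) {0..hs} (ball 0 R \<inter> Hs (Suc l)) (\<lambda>h u. the (\<psi> h u))"
proof -
  have C: "compatible Hs ip hs R \<psi>" using assms unfolding horizon_def by blast
  from C[unfolded compatible_def, rule_format, of 1 l] show ?thesis by simp
qed

text \<open>By the flow property the right derivative at \<open>t\<close> is the right derivative at
  0 of the flow that starts from \<open>\<psi> t u\<close>. Differentiability at \<open>t\<close> is
  known, so this value is the full derivative. Halving the interval keeps \<open>t < hs\<close>, so
  that there are times to the right of \<open>t\<close>.\<close>

lemma flow_derivative:
  assumes "mild S' F \<kappa>'" and \<psi>: "\<psi> = mild_flow S' F" and hs: "hs > 0"
    and def: "\<And>k u t. u \<in> ball 0 R \<inter> Hs k \<Longrightarrow> t \<in> {0..hs} \<Longrightarrow> \<exists>v\<in>Hs k. \<psi> t u = Some v"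
    and d0: "\<And>u. u \<in> ball 0 R \<inter> Hs (Suc l) \<Longrightarrow> der l (\<lambda>h. the (\<psi> h u)) (A u) 0 {0..hs}"
    and d: "\<And>u t. u \<in> ball 0 R \<inter> Hs (Suc l) \<Longrightarrow> t \<in> {0..hs} \<Longrightarrow> \<exists>d. der l (\<lambda>h. the (\<psi> h u)) d t {0..hs}"
    and u: "u \<in> ball 0 R \<inter> Hs (Suc l)" and t: "t \<in> {0..hs / 2}" and v: "the (\<psi> t u) \<in> ball 0 R"
  shows "der l (\<lambda>t. the (\<psi> t u)) (A (the (\<psi> t u))) t {0..hs / 2}"
proof -
  interpret mild S' F \<kappa>' by fact
  have t': "t \<in> {0..hs}" "t < hs" using t hs by auto
  let ?v = "the (\<psi> t u)"
  have vH: "?v \<in> ball 0 R \<inter> Hs (Suc l)" using def[OF u t'(1)] v by auto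
  obtain D where D: "der l (\<lambda>h. the (\<psi> h u)) D t {0..hs}" using d[OF u t'(1)] by blast
  have F: "filterlim (\<lambda>s. s - t) (at 0 within {0..hs}) (at t within {t..hs})"
    unfolding filterlim_at
  proof
    show "((\<lambda>s. s - t) \<longlongrightarrow> 0) (at t within {t..hs})"
      using tendsto_diff[OF tendsto_ident_at[of t "{t..hs}"] tendsto_const[of t]] by simp
    show "\<forall>\<^sub>F s in at t within {t..hs}. s - t \<in> {0..hs} \<and> s - t \<noteq> 0"
      using t by (auto simp: eventually_at_filter)
  qed
  have add: "the (\<psi> s u) = the (\<psi> (s - t) ?v)" if s: "s \<in> {t..hs}" for s
  proof -
    have "\<exists>z\<in>Hs 0. \<psi> s u = Some z" using u s t by (intro def) auto
    then obtain z where z: "mild_flow S' F (t + (s - t)) u = Some z" by (auto simp: \<psi>)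
    obtain y where "mild_flow S' F t u = Some y" "mild_flow S' F (s - t) y = Some z"
      by (rule mild_flow_add[OF z]) (use s t in auto)
    then show ?thesis using z by (simp add: \<psi>)
  qed
  have "cv l (\<lambda>s. (the (\<psi> (s - t) ?v) - the (\<psi> 0 ?v)) /\<^sub>R ((s - t) - 0)) (A ?v) (at t within {t..hs})"
    using cv_compose[OF d0[OF vH, unfolded der_def] F] .
  then have "cv l (\<lambda>s. (the (\<psi> s u) - ?v) /\<^sub>R (s - t)) (A ?v) (at t within {t..hs})"
  proof (rule cv_cong[THEN iffD1, rotated], unfold eventually_at_filter, intro always_eventually allI impI)
    fix s assume "s \<noteq> t" "s \<in> {t..hs}"
    then show "(the (\<psi> (s - t) ?v) - the (\<psi> 0 ?v)) /\<^sub>R (s - t - 0) = (the (\<psi> s u) - ?v) /\<^sub>R (s - t)"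
      using add[of s] mild_flow_0[of ?v] by (simp add: \<psi>)
  qed
  moreover have "cv l (\<lambda>s. (the (\<psi> s u) - ?v) /\<^sub>R (s - t)) D (at t within {t..hs})"
    using D unfolding der_def by (rule cv_filter_mono) (use t in \<open>auto intro: at_le\<close>)
  moreover have "at t within {t..hs} \<noteq> bot" using t' by (simp add: at_within_Icc_at_right)
  ultimately have "A ?v = D" by (rule cv_unique)
  moreover have "der l (\<lambda>t. the (\<psi> t u)) D t {0..hs / 2}"
    using D unfolding der_def by (rule cv_filter_mono) (use hs in \<open>auto intro: at_le\<close>)
  ultimately show ?thesis by simp
qed

lemma local_flows:
  assumes R: "R > 0"
  obtains hs B where "vector_fields Hs ip (ball 0 R) B" "hs > 0"
    "vector_fields.local_flow Hs ip (ball 0 R) B hs (\<lambda>h u. the (flow h u)) 1 1"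
    "\<And>a. vector_fields.local_flow Hs ip (ball 0 R) B hs (\<lambda>h u. the (part a h u)) (if a then 0 else 1) (if a then 1 else 0)"
proof -
  let ?V = "ball 0 R"
  obtain hs where hor: "horizon R hs" using ex_horizon[OF R] .
  note hs = horizon_pos[OF hor] and def = horizon_defined[OF hor] and C0 = horizon_C0[OF hor] and C1 = horizon_C1[OF hor]
  have "\<exists>B. vector_field ?V B \<and>
      (\<forall>l. \<forall>u\<in>?V \<inter> Hs (Suc l). der l (\<lambda>h. the (\<psi> h u)) (B u []) 0 {0..hs}) \<and>
      (\<forall>l. \<forall>u\<in>?V \<inter> Hs (Suc l). \<forall>t\<in>{0..hs}. \<exists>d. der l (\<lambda>h. the (\<psi> h u)) d t {0..hs})"
    if "\<psi> \<in> {flow, part False, part True}" for \<psi>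
    by (rule class_C1_vector_field[OF hs open_ball convex_ball C1[OF that]]) blast
  then obtain Bf where Bf: "\<And>\<psi>. \<psi> \<in> {flow, part False, part True} \<Longrightarrow> vector_field ?V (Bf \<psi>)"
    and d0: "\<And>\<psi> l u. \<psi> \<in> {flow, part False, part True} \<Longrightarrow> u \<in> ?V \<inter> Hs (Suc l) \<Longrightarrow>
        der l (\<lambda>h. the (\<psi> h u)) (Bf \<psi> u []) 0 {0..hs}"
    and d: "\<And>\<psi> l u t. \<psi> \<in> {flow, part False, part True} \<Longrightarrow> u \<in> ?V \<inter> Hs (Suc l) \<Longrightarrow> t \<in> {0..hs} \<Longrightarrow>
        \<exists>d. der l (\<lambda>h. the (\<psi> h u)) d t {0..hs}"
    by metis
  define B where "B a = Bf (part a)" for a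
  have part_in: "part a \<in> {flow, part False, part True}" for a by (cases a) auto
  interpret VF: vector_fields Hs ip ?V B
    by unfold_locales (use Bf[OF part_in] in \<open>auto simp: B_def\<close>)
  have right: "at 0 within {0..hs} = at_right (0::real)" using hs by (simp add: at_within_Icc_at_right)
  have ident: "\<psi> 0 u = Some u" if "\<psi> \<in> {flow, part False, part True}" for \<psi> u
    using that full.mild_flow_0 lin.mild_flow_0 nonlin.mild_flow_0 by (auto simp: flow_def part_def)
  have lim: "((\<lambda>h. (the (\<psi> h u) - u) /\<^sub>R h) \<longlongrightarrow> Bf \<psi> u []) (at_right 0)"
    if "\<psi> \<in> {flow, part False, part True}" "u \<in> ?V \<inter> Hs 1" for \<psi> u
    using d0[OF that(1), of u 0] that(2) ident[OF that(1)] by (simp add: der_def right cv_0)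
  \<comment> \<open>The difference of the full flow and the semigroup, and likewise the increment of
    the nonlinear flow, have derivative \<open>A1 u\<close> at 0. Adding the increment of the
    semigroup gives the sum of the two fields.\<close>
  have sum: "Bf flow u [] = B False u [] + B True u []" if u: "u \<in> ?V \<inter> Hs 1" for u
  proof -
    have ex: "flow hs u \<noteq> None" "part True hs u \<noteq> None"
      using def[of _ u 0 hs] u hs by force+
    have N: "((\<lambda>h. (the (part True h u) - u) /\<^sub>R h) \<longlongrightarrow> A1 u) (at_right 0)"
      using nonlin.mild_flow_deriv[OF hs, of u] ex by (simp add: part_def)
    have "((\<lambda>h. (the (flow h u) - S h u) /\<^sub>R h) \<longlongrightarrow> A1 u) (at_right 0)"
      using full.mild_flow_deriv[OF hs, of u] ex by (simp add: flow_def)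
    moreover have "((\<lambda>h. (the (part False h u) - u) /\<^sub>R h) \<longlongrightarrow> B False u []) (at_right 0)"
      using lim[OF part_in u, of False] by (simp add: B_def)
    ultimately have "((\<lambda>h. (the (part False h u) - u) /\<^sub>R h + (the (flow h u) - S h u) /\<^sub>R h) \<longlongrightarrow> B False u [] + A1 u) (at_right 0)"
      by (intro tendsto_add)
    then have "((\<lambda>h. (the (flow h u) - u) /\<^sub>R h) \<longlongrightarrow> B False u [] + A1 u) (at_right 0)"
      by (rule Lim_transform_eventually)
        (auto simp: part_lin eventually_at_right_field algebra_simps intro!: exI[of _ 1])
    then have "Bf flow u [] = B False u [] + A1 u"
      using lim[OF _ u, of flow] tendsto_unique[OF trivial_limit_at_right_real] by blast
    moreover have "B True u [] = A1 u"
      using lim[OF part_in u, of True] N tendsto_unique[OF trivial_limit_at_right_real] unfolding B_def by blast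
    ultimately show ?thesis by simp
  qed
  have flow: "VF.local_flow (hs / 2) (\<lambda>h u. the (\<psi> h u)) x y"
    if \<psi>: "\<psi> \<in> {flow, part False, part True}" and m: "mild S' F \<kappa>'" "\<psi> = mild_flow S' F"
      and A: "\<And>u. u \<in> ?V \<inter> Hs 1 \<Longrightarrow> Bf \<psi> u [] = x *\<^sub>R B False u [] + y *\<^sub>R B True u []"
    for \<psi> x y S' F \<kappa>'
    unfolding VF.local_flow_def
  proof (intro conjI allI ballI impI)
    show "0 < hs / 2" using hs by simp
    show "the (\<psi> 0 u) = u" for u using ident[OF \<psi>] by simp
  next
    fix k p assume p: "p \<in> ?V \<inter> Hs k"
    have "cv k (\<lambda>z. the (\<psi> (fst z) (snd z))) (the (\<psi> 0 p)) (germ k p)"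
    proof (rule class_C0_cont[OF C0[OF \<psi>] open_ball])
      show "\<forall>\<^sub>F z in germ k p. fst z \<in> {0..hs}"
        using eventually_germ_le[OF hs, of k p] by (auto elim: eventually_mono)
    qed (use p hs in \<open>auto intro: fst_germ snd_germ\<close>)
    then show "cv k (\<lambda>(h, u). the (\<psi> h u)) p (germ k p)"
      using ident[OF \<psi>] by (simp add: case_prod_unfold)
  next
    fix l u t assume u: "u \<in> ?V \<inter> Hs (Suc l)" and t: "t \<in> {0..hs / 2}" and v: "the (\<psi> t u) \<in> ?V"
    have "der l (\<lambda>t. the (\<psi> t u)) (Bf \<psi> (the (\<psi> t u)) []) t {0..hs / 2}"
      by (rule flow_derivative[OF m hs def[OF \<psi>] d0[OF \<psi>] d[OF \<psi>] u t v])
    moreover have "the (\<psi> t u) \<in> Hs 1"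
      using def[OF \<psi> u, of t] t hs Hs_antimono[of 1 "Suc l"] by auto
    ultimately show "der l (\<lambda>t. the (\<psi> t u)) (x *\<^sub>R B False (the (\<psi> t u)) [] + y *\<^sub>R B True (the (\<psi> t u)) []) t {0..hs / 2}"
      using A[of "the (\<psi> t u)"] v by simp
  qed
  show ?thesis
  proof (rule that[of B "hs / 2"])
    show "vector_fields Hs ip ?V B" by (rule VF.vector_fields_axioms)
    show "0 < hs / 2" using hs by simp
    show "VF.local_flow (hs / 2) (\<lambda>h u. the (flow h u)) 1 1"
      by (rule flow[OF _ full.mild_axioms flow_def]) (auto simp: sum)
    show "VF.local_flow (hs / 2) (\<lambda>h u. the (part a h u)) (if a then 0 else 1) (if a then 1 else 0)" for a
    proof (cases a)
      case True
      have "VF.local_flow (hs / 2) (\<lambda>h u. the (part True h u)) 0 1"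
        by (rule flow[OF _ nonlin.mild_axioms]) (auto simp: B_def part_def)
      then show ?thesis using True by simp
    next
      case False
      have "VF.local_flow (hs / 2) (\<lambda>h u. the (part False h u)) 1 0"
        by (rule flow[OF _ lin.mild_axioms]) (auto simp: B_def part_def)
      then show ?thesis using False by simp
    qed
  qed
qed

definition split_iterate :: "bool \<Rightarrow> nat \<Rightarrow> real \<Rightarrow> 'a \<Rightarrow> 'a" where
  "split_iterate a m h = (\<lambda>x. the (part a h (the (part (\<not> a) h x)))) ^^ m"

text \<open>\<open>K\<close> is the set of outer flows: a singleton for the asymmetric methods, both
  Booleans for the symmetric one. This is the total counterpart of the partial method and agrees
  with it wherever that has a value.\<close>

definition combined :: "nat \<Rightarrow> (nat \<Rightarrow> real) \<Rightarrow> bool set \<Rightarrow> real \<Rightarrow> 'a \<Rightarrow> 'a" where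
  "combined s \<gamma> K h u = (\<Sum>m=1..s. \<gamma> m *\<^sub>R (\<Sum>a\<in>K. split_iterate a m (h / real m) u))"

lemma consistency:
  assumes R: "R > 0" and p: "p \<in> ball 0 R \<inter> Hs Q" and Q: "0 < Q"
    and c: "\<And>w. length w < Q \<Longrightarrow>
      (\<Sum>m=1..s. \<gamma> m * (\<Sum>a\<in>K. (step_series a (\<not> a) ^^ m) empty_word w / real m ^ length w)) = 1 / fact (length w)"
  shows "\<exists>C d. d > 0 \<and> (\<forall>h u. 0 \<le> h \<longrightarrow> h \<le> d \<longrightarrow> u \<in> Hs Q \<longrightarrow> N Q (u - p) < d \<longrightarrow>
      norm (the (flow h u) - combined s \<gamma> K h u) \<le> C * h ^ Q)"
proof -
  obtain hs B where VF: "vector_fields Hs ip (ball 0 R) B"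
    and full: "vector_fields.local_flow Hs ip (ball 0 R) B hs (\<lambda>h u. the (flow h u)) 1 1"
    and parts: "\<And>a. vector_fields.local_flow Hs ip (ball 0 R) B hs (\<lambda>h u. the (part a h u)) (if a then 0 else 1) (if a then 1 else 0)"
    using local_flows[OF R] by metis
  interpret VF: vector_fields Hs ip "ball 0 R" B by (rule VF)
  have "VF.has_series Q p (split_iterate a m) ((step_series a (\<not> a) ^^ m) empty_word)" for a m
    unfolding split_iterate_def by (rule VF.has_series_split_iterate[OF parts p Q])
  then have "VF.has_series Q p (\<lambda>h. split_iterate a m (h / real m)) (\<lambda>w. (step_series a (\<not> a) ^^ m) empty_word w / real m ^ length w)"
    if "m \<in> {1..s}" for a m
    using that p by (intro VF.has_series_rescale) auto
  then have "VF.has_series Q p (\<lambda>h u. \<Sum>a\<in>K. 1 *\<^sub>R split_iterate a m (h / real m) u)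
      (\<lambda>w. \<Sum>a\<in>K. 1 * ((step_series a (\<not> a) ^^ m) empty_word w / real m ^ length w))"
    if "m \<in> {1..s}" for m
    using that by (intro VF.has_series_sum) auto
  then have "VF.has_series Q p (\<lambda>h u. \<Sum>m=1..s. \<gamma> m *\<^sub>R (\<Sum>a\<in>K. split_iterate a m (h / real m) u))
      (\<lambda>w. \<Sum>m=1..s. \<gamma> m * (\<Sum>a\<in>K. (step_series a (\<not> a) ^^ m) empty_word w / real m ^ length w))"
    by (intro VF.has_series_sum) auto
  then have "VF.has_series Q p (combined s \<gamma> K)
      (\<lambda>w. \<Sum>m=1..s. \<gamma> m * (\<Sum>a\<in>K. (step_series a (\<not> a) ^^ m) empty_word w / real m ^ length w))"
    by (simp add: combined_def[abs_def])
  from VF.has_series_unique[OF VF.has_series_flow[OF full p] this]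
  show ?thesis using c by (simp add: VF.words_def)
qed

lemma splitting_stable:
  assumes R: "R > 0"
  obtains r L h1 where "stable_splitting S (part False) (part True) r R L h1 \<bar>\<kappa>0\<bar>" "h1 > 0"
proof -
  obtain hs where hor: "horizon R hs" using ex_horizon[OF R] .
  note hs = horizon_pos[OF hor] and def = horizon_defined[OF hor]
  obtain h0 L where h0: "h0 > 0" "L \<ge> 0"
    "\<And>h u v. 0 < h \<Longrightarrow> h < h0 \<Longrightarrow> u \<in> ball 0 R \<Longrightarrow> v \<in> ball 0 R \<Longrightarrow>
       norm ((the (part True h u) - u) - (the (part True h v) - v)) \<le> L * h * norm (u - v)"
    using uniformly_stableD[of R "part True"] stable1 R by (auto simp: part_def)
  \<comment> \<open>Uniform stability bounds the increment of the nonlinear flow, which becomes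
    \<open>r\<close>; the absolute value of \<open>\<kappa>0\<close> gives a nonnegative
    exponent.\<close>
  have "stable_splitting S (part False) (part True) (\<lambda>h u. the (part True h u) - u) R L (min h0 hs) \<bar>\<kappa>0\<bar>"
  proof (rule stable_splitting.intro)
    show "linear (S t)" if "0 \<le> t" for t
      using S that by (simp add: C0_semigroup_def bounded_linear.linear)
    show "S (a + b) u = S a (S b u)" if "0 \<le> a" "0 \<le> b" for a b u
      using S that by (simp add: C0_semigroup_def)
    show "S 0 u = u" for u using S by (simp add: C0_semigroup_def)
    show "norm (S t u) \<le> exp (\<bar>\<kappa>0\<bar> * t) * norm u" if "0 \<le> t" for t u
    proof -
      have "norm (S t u) \<le> exp (\<kappa>0 * t) * norm u" using S that by (simp add: quasicontraction_def)
      also have "\<dots> \<le> exp (\<bar>\<kappa>0\<bar> * t) * norm u"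
        using that by (intro mult_right_mono) (auto intro: mult_right_mono)
      finally show ?thesis .
    qed
    show "part False t u = Some (S t u)" if "0 \<le> t" for t u using part_lin[OF that] .
    show "part True t u = Some (u + (the (part True t u) - u))" if "0 < t" "t < min h0 hs" "u \<in> ball 0 R" for t u
      using def[of "part True" u 0 t] that by auto
    show "the (part True t 0) - 0 = 0" if "0 < t" "t < min h0 hs" for t
      using nonlin.mild_flow_zero[OF A1(2), of t] that by (simp add: part_def)
  qed (use h0 in auto)
  then show ?thesis using that hs h0 by (meson min_less_iff_conj)
qed

section \<open>Stability and consistency of the two families of methods\<close>

definition split_step :: "bool \<Rightarrow> real \<Rightarrow> 'a \<rightharpoonup> 'a" where
  "split_step a = splitting (part a) (part (\<not> a))"

definition stable_method :: "(real \<Rightarrow> 'a \<rightharpoonup> 'a) \<Rightarrow> bool" where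
  "stable_method \<Phi> \<longleftrightarrow> (\<forall>R>0. \<exists>h0>0. \<exists>\<kappa>>0. \<forall>h u v. 0 < h \<longrightarrow> h < h0 \<longrightarrow> u \<in> ball 0 R \<longrightarrow> v \<in> ball 0 R \<longrightarrow>
     (\<exists>x y. \<Phi> h u = Some x \<and> \<Phi> h v = Some y \<and> norm (x - y) \<le> exp (\<kappa> * h) * norm (u - v)))"

text \<open>Definedness is left to \<open>stable_method\<close>, which provides it on ambient balls.
  Consistency speaks only of points where \<open>\<Phi> h u\<close> has a value.\<close>

definition consistent_method :: "nat \<Rightarrow> (real \<Rightarrow> 'a \<rightharpoonup> 'a) \<Rightarrow> bool" where
  "consistent_method Q \<Phi> \<longleftrightarrow> (\<forall>p\<in>Hs Q. \<exists>C. \<exists>d>0. \<forall>h u v. 0 \<le> h \<longrightarrow> h \<le> d \<longrightarrow> u \<in> Hs Q \<longrightarrow> N Q (u - p) < d \<longrightarrow>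
     \<Phi> h u = Some v \<longrightarrow> norm (the (flow h u) - v) \<le> C * h ^ Q)"

lemma stable_combination:
  assumes F: "\<And>R r L h1 m. stable_splitting S (part False) (part True) r R L h1 \<bar>\<kappa>0\<bar> \<Longrightarrow> m \<in> {1..s} \<Longrightarrow>
      stable_splitting.near_semigroup S R L h1 \<bar>\<kappa>0\<bar> c (c * L) (\<lambda>h. F h m)"
    and c: "0 \<le> c" "c * (\<Sum>m=1..s. \<gamma> m) = 1"
  shows "stable_method (\<lambda>h. partial_combination s \<gamma> (F h))"
  unfolding stable_method_def
proof (intro allI impI)
  fix R :: real assume R: "R > 0"
  \<comment> \<open>A ball larger than the one of radius \<open>R\<close> gives the room that
    \<open>combination_stable\<close> asks for.\<close>
  then have "R + 1 > 0" by simp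
  then obtain r L h1 where st: "stable_splitting S (part False) (part True) r (R + 1) L h1 \<bar>\<kappa>0\<bar>" and h1: "h1 > 0"
    by (rule splitting_stable)
  interpret st: stable_splitting S "part False" "part True" r "R + 1" L h1 "\<bar>\<kappa>0\<bar>" by (rule st)
  have cL: "0 \<le> c * L" using c st.L by simp
  show "\<exists>h0>0. \<exists>\<kappa>>0. \<forall>h u v. 0 < h \<longrightarrow> h < h0 \<longrightarrow> u \<in> ball 0 R \<longrightarrow> v \<in> ball 0 R \<longrightarrow>
     (\<exists>x y. partial_combination s \<gamma> (F h) u = Some x \<and> partial_combination s \<gamma> (F h) v = Some y \<and>
        norm (x - y) \<le> exp (\<kappa> * h) * norm (u - v))"
    by (rule st.combination_stable[where F = F, OF _ c(2) cL R _ h1]) (rule F[OF st], assumption, simp)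
qed

lemma consistent_combination:
  assumes F: "\<And>h m u v. m \<in> {1..s} \<Longrightarrow> F h m u = Some v \<Longrightarrow> v = (\<Sum>a\<in>K. split_iterate a m (h / real m) u)"
    and Q: "0 < Q"
    and c: "\<And>w. length w < Q \<Longrightarrow>
      (\<Sum>m=1..s. \<gamma> m * (\<Sum>a\<in>K. (step_series a (\<not> a) ^^ m) empty_word w / real m ^ length w)) = 1 / fact (length w)"
  shows "consistent_method Q (\<lambda>h. partial_combination s \<gamma> (F h))"
  unfolding consistent_method_def
proof
  fix p assume p: "p \<in> Hs Q"
  define R where "R = norm p + 1"
  have R: "R > 0" and pR: "p \<in> ball 0 R \<inter> Hs Q" using p by (auto simp: R_def add_nonneg_pos)
  obtain C d where d: "d > 0" "\<And>h u. 0 \<le> h \<Longrightarrow> h \<le> d \<Longrightarrow> u \<in> Hs Q \<Longrightarrow> N Q (u - p) < d \<Longrightarrow>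
      norm (the (flow h u) - combined s \<gamma> K h u) \<le> C * h ^ Q"
    using consistency[OF R pR Q c] by blast
  have "v = combined s \<gamma> K h u" if v: "partial_combination s \<gamma> (F h) u = Some v" for h u v
    unfolding combined_def partial_combination_SomeD(1)[OF v]
  proof (rule sum.cong[OF refl])
    fix m assume m: "m \<in> {1..s}"
    obtain x where "F h m u = Some x" using partial_combination_SomeD(2)[OF v m] by blast
    then show "\<gamma> m *\<^sub>R the (F h m u) = \<gamma> m *\<^sub>R (\<Sum>a\<in>K. split_iterate a m (h / real m) u)"
      using F[OF m] by simp
  qed
  then show "\<exists>C. \<exists>d>0. \<forall>h u v. 0 \<le> h \<longrightarrow> h \<le> d \<longrightarrow> u \<in> Hs Q \<longrightarrow> N Q (u - p) < d \<longrightarrow>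
     partial_combination s \<gamma> (F h) u = Some v \<longrightarrow> norm (the (flow h u) - v) \<le> C * h ^ Q"
    using d by blast
qed

lemma one_step_split_step:
  assumes "stable_splitting S (part False) (part True) r R L h1 \<bar>\<kappa>0\<bar>"
  shows "stable_splitting.one_step S R L h1 \<bar>\<kappa>0\<bar> (split_step a)"
  using stable_splitting.one_step_plus[OF assms] stable_splitting.one_step_minus[OF assms]
  by (cases a) (simp_all add: split_step_def)

lemma iter_split_step: "iter (split_step a h) m u = Some v \<Longrightarrow> v = split_iterate a m h u"
  unfolding split_step_def split_iterate_def by (rule iter_splitting_funpow)

lemma asymmetric_method_facts:
  assumes "asymmetric_conditions q s \<gamma>"
  shows "stable_method (asymmetric_method s \<gamma> (split_step a))"
    and "consistent_method (q + 1) (asymmetric_method s \<gamma> (split_step a))"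
proof -
  have eq: "asymmetric_method s \<gamma> (split_step a) =
      (\<lambda>h. partial_combination s \<gamma> ((\<lambda>h m. iter (split_step a (h / real m)) m) h))"
    by (rule ext) (simp add: asymmetric_method_def)
  show "stable_method (asymmetric_method s \<gamma> (split_step a))"
    unfolding eq
  proof (rule stable_combination[where c = 1])
    fix R r L h1 m assume st: "stable_splitting S (part False) (part True) r R L h1 \<bar>\<kappa>0\<bar>" and m: "m \<in> {1..s}"
    show "stable_splitting.near_semigroup S R L h1 \<bar>\<kappa>0\<bar> 1 (1 * L) (\<lambda>h. iter (split_step a (h / real m)) m)"
      using stable_splitting.near_semigroup_iter[OF st one_step_split_step[OF st], of m a] m by simp
  qed (use assms in \<open>auto simp: asymmetric_conditions_def\<close>)
  show "consistent_method (q + 1) (asymmetric_method s \<gamma> (split_step a))"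
    unfolding eq
  proof (rule consistent_combination[where K = "{a}"])
    fix h m u v assume "iter (split_step a (h / real m)) m u = Some v"
    then show "v = (\<Sum>a\<in>{a}. split_iterate a m (h / real m) u)" by (simp add: iter_split_step)
  next
    fix w :: "bool list" assume "length w < q + 1"
    then show "(\<Sum>m=1..s. \<gamma> m * (\<Sum>a\<in>{a}. (step_series a (\<not> a) ^^ m) empty_word w / real m ^ length w)) = 1 / fact (length w)"
      using asymmetric_series[of a "\<not> a" q s \<gamma> w] assms by simp
  qed simp
qed

lemma symmetric_method_facts:
  assumes "symmetric_conditions n s \<gamma>"
  shows "stable_method (symmetric_method s \<gamma> (split_step True) (split_step False))"
    and "consistent_method (2 * n + 1) (symmetric_method s \<gamma> (split_step True) (split_step False))"
proof -
  have eq: "symmetric_method s \<gamma> (split_step True) (split_step False) =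
      (\<lambda>h. partial_combination s \<gamma> ((\<lambda>h m. partial_add (iter (split_step True (h / real m)) m)
        (iter (split_step False (h / real m)) m)) h))"
    by (rule ext) (simp add: symmetric_method_def)
  show "stable_method (symmetric_method s \<gamma> (split_step True) (split_step False))"
    unfolding eq
  proof (rule stable_combination[where c = 2])
    fix R r L h1 m assume st: "stable_splitting S (part False) (part True) r R L h1 \<bar>\<kappa>0\<bar>" and m: "m \<in> {1..s}"
    then have m: "1 \<le> m" by simp
    show "stable_splitting.near_semigroup S R L h1 \<bar>\<kappa>0\<bar> 2 (2 * L)
       (\<lambda>h. partial_add (iter (split_step True (h / real m)) m) (iter (split_step False (h / real m)) m))"
      by (intro stable_splitting.near_semigroup_add[OF st]
          stable_splitting.near_semigroup_iter[OF st one_step_split_step[OF st] m])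
  qed (use assms in \<open>auto simp: symmetric_conditions_def\<close>)
  show "consistent_method (2 * n + 1) (symmetric_method s \<gamma> (split_step True) (split_step False))"
    unfolding eq
  proof (rule consistent_combination[where K = "{True, False}"])
    fix h m u v assume v: "partial_add (iter (split_step True (h / real m)) m) (iter (split_step False (h / real m)) m) u = Some v"
    then obtain x y where "iter (split_step True (h / real m)) m u = Some x" "iter (split_step False (h / real m)) m u = Some y"
      by (auto simp: partial_add_def split: if_splits)
    with v show "v = (\<Sum>a\<in>{True, False}. split_iterate a m (h / real m) u)"
      using iter_split_step by (simp add: partial_add_def)
  next
    fix w :: "bool list" assume "length w < 2 * n + 1"
    then show "(\<Sum>m=1..s. \<gamma> m * (\<Sum>a\<in>{True, False}. (step_series a (\<not> a) ^^ m) empty_word w / real m ^ length w)) = 1 / fact (length w)"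
      using symmetric_series[of True False n s \<gamma> w] assms by (simp add: add_divide_distrib)
  qed simp
qed

text \<open>Regularity propagates along the solution, since the step on which the flow acts on every
  level of the scale depends only on a bound in the weakest norm.\<close>

lemma solution_in_scale:
  assumes u: "mild_solution S A1 u0 T u" and u0: "u0 \<in> Hs Q" and T: "0 \<le> T"
    and R: "\<And>t. t \<in> {0..T} \<Longrightarrow> u t \<in> ball 0 R"
  shows "(\<forall>t\<in>{0..T}. u t \<in> Hs Q) \<and> (\<forall>t\<in>{0..T}. cv Q u (u t) (at t within {0..T}))"
proof -
  have "norm (u 0) < R" using R[of 0] T by simp
  then have "R > 0" by (rule le_less_trans[OF norm_ge_zero])
  then obtain hs where hor: "horizon R hs" by (rule ex_horizon)
  note hs = horizon_pos[OF hor]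
  have fl: "flow s (u t) = Some (u (t + s))" if "t \<in> {0..T}" "0 \<le> s" "t + s \<le> T" for t s
    using full.mild_flow_eq[OF full.mild_solution_shift[OF u that(1)], of s] that
    by (simp add: flow_def add.commute)
  have step: "u (t + s) \<in> Hs Q" if "t \<in> {0..T}" "0 \<le> s" "t + s \<le> T" "s \<le> hs" "u t \<in> Hs Q" for t s
    using horizon_defined[OF hor, of flow "u t" Q s] fl[OF that(1-3)] R[OF that(1)] that by auto
  \<comment> \<open>Regularity is phrased as transport from \<open>a\<close> to the rest of
    \<open>{a..b}\<close>, so that it chains under bisection; intervals that leave
    \<open>{0..T}\<close> satisfy it vacuously.\<close>
  define P where "P a b \<longleftrightarrow> (0 \<le> a \<longrightarrow> b \<le> T \<longrightarrow> u a \<in> Hs Q \<longrightarrow> (\<forall>t\<in>{a..b}. u t \<in> Hs Q))" for a b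
  have "P 0 T" using T
  proof (induction rule: Bolzano)
    case (trans a b c)
    show ?case
      unfolding P_def
    proof (intro impI ballI)
      fix t assume a: "0 \<le> a" "c \<le> T" "u a \<in> Hs Q" and t: "t \<in> {a..c}"
      have b: "0 \<le> b" "b \<le> T" "b \<in> {a..b}" using trans(3,4) a(1,2) by auto
      have ab: "\<forall>t\<in>{a..b}. u t \<in> Hs Q" using trans(1) a(1,3) b(2) unfolding P_def by blast
      then have "u b \<in> Hs Q" using b(3) by blast
      then have bc: "\<forall>t\<in>{b..c}. u t \<in> Hs Q" using trans(2) a(2) b(1) unfolding P_def by blast
      have "t \<in> {a..b} \<or> t \<in> {b..c}" using t by auto
      then show "u t \<in> Hs Q" using ab bc by blast
    qed
  next
    case (local x)
    have "P a b" if "a \<le> x" "x \<le> b" "b - a < hs" for a b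
      unfolding P_def
    proof (intro impI ballI)
      fix t assume a: "0 \<le> a" "b \<le> T" "u a \<in> Hs Q" and t: "t \<in> {a..b}"
      have "u (a + (t - a)) \<in> Hs Q" by (rule step) (use a t that in auto)
      then show "u t \<in> Hs Q" by simp
    qed
    then show ?case using hs by blast
  qed
  moreover have "u 0 = u0" using fl[of 0 0] T full.mild_flow_eq[OF u, of 0] full.mild_flow_0 by (auto simp: flow_def)
  ultimately have in_Hs: "u t \<in> Hs Q" if "t \<in> {0..T}" for t
    using u0 T that unfolding P_def by blast
  have "cv Q u (u t) (at t within {0..T})" if t: "t \<in> {0..T}" for t
  proof -
    \<comment> \<open>Starting the flow before \<open>t\<close>, where possible, puts
      \<open>t\<close> inside the time interval of that flow, so that continuity is obtained on both
      sides of \<open>t\<close>.\<close>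
    define a where "a = max 0 (t - hs / 2)"
    have a: "a \<in> {0..T}" "0 \<le> t - a" "t - a \<le> hs / 2" using t hs by (auto simp: a_def max_def)
    let ?F = "at t within {0..T}"
    have "\<forall>\<^sub>F s in ?F. dist s t < hs / 2" unfolding eventually_at using hs by (intro exI[of _ "hs / 2"]) auto
    moreover have "\<forall>\<^sub>F s in ?F. s \<in> {0..T}" by (simp add: eventually_at_filter)
    ultimately have ev: "\<forall>\<^sub>F s in ?F. s - a \<in> {0..hs} \<and> s \<in> {0..T}"
    proof eventually_elim
      case (elim s)
      then have "\<bar>s - t\<bar> < hs / 2" "0 \<le> s" "s \<le> T" by (auto simp: dist_real_def)
      then have "t - hs / 2 < s" "s < t + hs / 2" "0 \<le> s" "s \<le> T" by linarith+
      moreover have "t - hs / 2 \<le> a" "a = 0 \<or> a = t - hs / 2" by (auto simp: a_def max_def)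
      ultimately have "a \<le> s" "s - a \<le> hs" by linarith+
      then show ?case using elim(2) by simp
    qed
    have "cv Q (\<lambda>s. the (flow (s - a) (u a))) (the (flow (t - a) (u a))) ?F"
    proof (rule class_C0_cont[OF horizon_C0[OF hor] open_ball])
      show "((\<lambda>s. s - a) \<longlongrightarrow> t - a) ?F" by (intro tendsto_intros)
      show "\<forall>\<^sub>F s in ?F. s - a \<in> {0..hs}" using ev by (rule eventually_mono) simp
    qed (use R[OF a(1)] in_Hs[OF a(1)] a hs in auto)
    moreover have "the (flow (t - a) (u a)) = u t" using fl[OF a(1), of "t - a"] a t by simp
    ultimately have "cv Q (\<lambda>s. the (flow (s - a) (u a))) (u t) ?F" by simp
    moreover have "\<forall>\<^sub>F s in ?F. the (flow (s - a) (u a)) = u s"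
      using ev
    proof (rule eventually_mono)
      fix s assume "s - a \<in> {0..hs} \<and> s \<in> {0..T}"
      then show "the (flow (s - a) (u a)) = u s" using fl[OF a(1), of "s - a"] by simp
    qed
    ultimately show ?thesis by (rule cv_cong[THEN iffD1, rotated])
  qed
  then show ?thesis using in_Hs by blast
qed

text \<open>Consistency gives a constant and a step size near each point of the curve, in the norm
  of \<open>Hs Q\<close>. Continuity of the curve in that norm turns the neighbourhood into a time
  interval, and bisection of \<open>{0..T}\<close> makes both constants uniform.\<close>

lemma local_error_along_solution:
  fixes u :: "real \<Rightarrow> 'a"
  assumes \<Phi>: "consistent_method Q \<Phi>" and T: "0 \<le> T"
    and u: "\<forall>t\<in>{0..T}. u t \<in> Hs Q" "\<forall>t\<in>{0..T}. cv Q u (u t) (at t within {0..T})"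
  shows "\<exists>C>0. \<exists>d>0. \<forall>h t v. 0 \<le> h \<longrightarrow> h \<le> d \<longrightarrow> t \<in> {0..T} \<longrightarrow> \<Phi> h (u t) = Some v \<longrightarrow>
     norm (the (flow h (u t)) - v) \<le> C * h ^ Q"
proof -
  define P where "P a b \<longleftrightarrow> (\<exists>C>0. \<exists>d>0. \<forall>h t v. 0 \<le> h \<longrightarrow> h \<le> d \<longrightarrow> t \<in> {a..b} \<inter> {0..T} \<longrightarrow> \<Phi> h (u t) = Some v \<longrightarrow>
     norm (the (flow h (u t)) - v) \<le> C * h ^ Q)" for a b
  have "P 0 T" using T
  proof (induction rule: Bolzano)
    case (trans a b c)
    obtain C1 d1 where 1: "C1 > 0" "d1 > 0" "\<And>h t v. 0 \<le> h \<Longrightarrow> h \<le> d1 \<Longrightarrow> t \<in> {a..b} \<inter> {0..T} \<Longrightarrow> \<Phi> h (u t) = Some v \<Longrightarrow>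
       norm (the (flow h (u t)) - v) \<le> C1 * h ^ Q"
      using trans(1) unfolding P_def by blast
    obtain C2 d2 where 2: "C2 > 0" "d2 > 0" "\<And>h t v. 0 \<le> h \<Longrightarrow> h \<le> d2 \<Longrightarrow> t \<in> {b..c} \<inter> {0..T} \<Longrightarrow> \<Phi> h (u t) = Some v \<Longrightarrow>
       norm (the (flow h (u t)) - v) \<le> C2 * h ^ Q"
      using trans(2) unfolding P_def by blast
    have "norm (the (flow h (u t)) - v) \<le> (C1 + C2) * h ^ Q"
      if "0 \<le> h" "h \<le> min d1 d2" "t \<in> {a..c} \<inter> {0..T}" "\<Phi> h (u t) = Some v" for h t v
    proof -
      have "0 \<le> C1 * h ^ Q" "0 \<le> C2 * h ^ Q" using 1(1) 2(1) that(1) by auto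
      then show ?thesis
        using 1(3)[of h t v] 2(3)[of h t v] that by (cases "t \<le> b") (auto simp: distrib_right)
    qed
    moreover have "0 < C1 + C2" "0 < min d1 d2" using 1(1,2) 2(1,2) by auto
    ultimately show ?case unfolding P_def by blast
  next
    case (local x)
    then have x: "x \<in> {0..T}" by simp
    then obtain C d where d: "d > 0" "\<And>h w v. 0 \<le> h \<Longrightarrow> h \<le> d \<Longrightarrow> w \<in> Hs Q \<Longrightarrow> N Q (w - u x) < d \<Longrightarrow>
        \<Phi> h w = Some v \<Longrightarrow> norm (the (flow h w) - v) \<le> C * h ^ Q"
      using \<Phi> u(1) unfolding consistent_method_def by meson
    have "\<forall>\<^sub>F t in at x within {0..T}. N Q (u t - u x) < d"
    proof (rule order_tendstoD(2)[OF _ d(1)])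
      show "((\<lambda>t. N Q (u t - u x)) \<longlongrightarrow> 0) (at x within {0..T})"
        using bspec[OF u(2) x] by (simp add: cv_def)
    qed
    then obtain e where e: "e > 0" "\<And>t. t \<in> {0..T} \<Longrightarrow> t \<noteq> x \<Longrightarrow> dist t x < e \<Longrightarrow> N Q (u t - u x) < d"
      unfolding eventually_at by blast
    have near: "N Q (u t - u x) < d" if "t \<in> {0..T}" "dist t x < e" for t
      using e(2)[OF that(1) _ that(2)] d(1) by (cases "t = x") auto
    have "P a b" if ab: "a \<le> x" "x \<le> b" "b - a < e" for a b
      unfolding P_def
    proof (rule exI[of _ "\<bar>C\<bar> + 1"], rule conjI, simp, rule exI[of _ d], rule conjI, rule d(1), intro allI impI)
      fix h t v assume h: "0 \<le> h" "h \<le> d" and t: "t \<in> {a..b} \<inter> {0..T}" and v: "\<Phi> h (u t) = Some v"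
      have "dist t x < e" using t ab by (auto simp: dist_real_def)
      then have "norm (the (flow h (u t)) - v) \<le> C * h ^ Q" using d(2) h t u(1) near v by auto
      also have "\<dots> \<le> (\<bar>C\<bar> + 1) * h ^ Q" using h by (intro mult_right_mono) auto
      finally show "norm (the (flow h (u t)) - v) \<le> (\<bar>C\<bar> + 1) * h ^ Q" .
    qed
    then show ?case using e(1) by blast
  qed
  then show ?thesis unfolding P_def by simp
qed

text \<open>The local error is made at \<open>u (real n * h)\<close>, which is regular, and
  stability of one step compares the result with the numerical value. The latter has to stay in the
  ball of radius \<open>R\<close>, which the error bound itself ensures.\<close>

lemma convergence:
  assumes stab: "stable_method \<Phi>" and cons: "consistent_method (q + 1) \<Phi>" and q: "1 \<le> q"
    and u0: "u0 \<in> Hs (q + 1)" and T: "0 < T" "flow T u0 \<noteq> None"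
  shows "\<exists>hs>0. \<exists>\<delta>>0. \<exists>\<kappa>>0. \<exists>C>0. \<forall>U0\<in>Hs (q + 1). norm (u0 - U0) < \<delta> \<longrightarrow>
     (\<forall>h. 0 < h \<and> h < hs \<longrightarrow> (\<forall>n::nat. int n \<le> \<lfloor>T / h\<rfloor> \<longrightarrow>
        (\<exists>u U. flow (real n * h) u0 = Some u \<and> iter (\<Phi> h) n U0 = Some U \<and>
           norm (u - U) \<le> exp (\<kappa> * real n * h) * norm (u0 - U0)
             + C * ((exp (\<kappa> * real n * h) - 1) / \<kappa>) * h ^ q)))"
proof -
  obtain u where u: "mild_solution S A1 u0 T u" and fl0: "\<And>t. t \<in> {0..T} \<Longrightarrow> flow t u0 = Some (u t)"
  proof -
    obtain z where "mild_flow S A1 T u0 = Some z" using T by (auto simp: flow_def)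
    then show ?thesis by (rule full.mild_flow_SomeE) (rule that, auto simp: flow_def)
  qed
  have T0: "0 \<le> T" using T by simp
  have "continuous_on {0..T} u" using u by (simp add: mild_solution_def)
  then have "bounded (u ` {0..T})" by (intro compact_imp_bounded compact_continuous_image) auto
  then obtain b where b: "b > 0" "\<And>t. t \<in> {0..T} \<Longrightarrow> norm (u t) \<le> b"
    unfolding bounded_pos by auto
  \<comment> \<open>The ball of radius \<open>b + 1\<close> contains a tube of radius 1 around the
    solution.\<close>
  define R where "R = b + 1"
  have R: "R > 0" using b(1) by (simp add: R_def)
  have uR: "u t \<in> ball 0 R" if "t \<in> {0..T}" for t using b(2)[OF that] by (simp add: R_def)
  note reg = solution_in_scale[OF u u0 T0 uR]
  obtain C d where d: "d > 0" and C: "C > 0" and err: "\<And>h t v. 0 \<le> h \<Longrightarrow> h \<le> d \<Longrightarrow> t \<in> {0..T} \<Longrightarrow> \<Phi> h (u t) = Some v \<Longrightarrow>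
     norm (the (flow h (u t)) - v) \<le> C * h ^ (q + 1)"
    using local_error_along_solution[OF cons T0 conjunct1[OF reg] conjunct2[OF reg]] by blast
  obtain h0 \<kappa> where h0: "h0 > 0" and \<kappa>: "\<kappa> > 0" and stab': "\<And>h x y. 0 < h \<Longrightarrow> h < h0 \<Longrightarrow> x \<in> ball 0 R \<Longrightarrow> y \<in> ball 0 R \<Longrightarrow>
     \<exists>x' y'. \<Phi> h x = Some x' \<and> \<Phi> h y = Some y' \<and> norm (x' - y') \<le> exp (\<kappa> * h) * norm (x - y)"
    using stab[unfolded stable_method_def, rule_format, OF R] by blast
  define M where "M = exp (\<kappa> * T)"
  have M: "M > 0" by (simp add: M_def)
  \<comment> \<open>\<open>\<delta>\<close> and \<open>hs\<close> make each of the two terms of the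
    error bound less than \<open>1 / 2\<close> up to time \<open>T\<close>, so the numerical
    solution stays in the tube.\<close>
  define \<delta> where "\<delta> = 1 / (2 * M)"
  define hs where "hs = min (min 1 h0) (min d (\<kappa> / (2 * C * M)))"
  have pos: "\<delta> > 0" "hs > 0" using M h0 d \<kappa> C by (auto simp: \<delta>_def hs_def)
  define E where "E e h n = exp (\<kappa> * real n * h) * e + C * ((exp (\<kappa> * real n * h) - 1) / \<kappa>) * h ^ q" for e h and n :: nat
  have E_less: "E e h n < 1" if e: "0 \<le> e" "e < \<delta>" and h: "0 < h" "h < hs" and n: "real n * h \<le> T" for e h n
  proof -
    have "\<kappa> * real n * h \<le> \<kappa> * T" using n \<kappa> by (simp add: mult.assoc)
    then have eM: "exp (\<kappa> * real n * h) \<le> M" by (simp add: M_def)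
    have "exp (\<kappa> * real n * h) * e \<le> M * e" using eM e by (intro mult_right_mono)
    also have "\<dots> < M * \<delta>" using e M by simp
    also have "\<dots> = 1 / 2" using M by (simp add: \<delta>_def)
    finally have 1: "exp (\<kappa> * real n * h) * e < 1 / 2" .
    have "h ^ q \<le> h" using power_decreasing[OF q, of h] h by (simp add: hs_def)
    then have "C * ((exp (\<kappa> * real n * h) - 1) / \<kappa>) * h ^ q \<le> C * (M / \<kappa>) * h"
      using eM C M \<kappa> h by (intro mult_mono mult_nonneg_nonneg divide_right_mono divide_nonneg_pos) auto
    also have "\<dots> < C * (M / \<kappa>) * (\<kappa> / (2 * C * M))"
      using h C M \<kappa> by (intro mult_strict_left_mono) (auto simp: hs_def)
    also have "\<dots> = 1 / 2" using C M \<kappa> by simp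
    finally show ?thesis using 1 unfolding E_def by linarith
  qed
  have main: "\<exists>U. iter (\<Phi> h) n U0 = Some U \<and> norm (u (real n * h) - U) \<le> E (norm (u0 - U0)) h n"
    if U0: "norm (u0 - U0) < \<delta>" and h: "0 < h" "h < hs" and n: "real n * h \<le> T" for U0 h n
    using n
  proof (induction n)
    case 0
    have "u 0 = u0" using fl0[of 0] T0 full.mild_flow_0 by (simp add: flow_def)
    then show ?case by (simp add: E_def)
  next
    case (Suc n)
    have hh: "h < h0" "h \<le> d" using h by (auto simp: hs_def)
    have n: "real n * h \<le> T" and nh: "real n * h \<in> {0..T}" and nS: "real n * h + h \<le> T"
      using Suc.prems h by (auto simp: algebra_simps)
    obtain U where U: "iter (\<Phi> h) n U0 = Some U" "norm (u (real n * h) - U) \<le> E (norm (u0 - U0)) h n"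
      using Suc.IH[OF n] by blast
    have "norm (u (real n * h) - U) < 1" using U(2) E_less[OF _ U0 h n] by simp
    moreover have "norm U \<le> norm (u (real n * h)) + norm (u (real n * h) - U)"
      using norm_triangle_ineq4[of "u (real n * h)" "u (real n * h) - U"] by simp
    ultimately have UR: "U \<in> ball 0 R" using b(2)[OF nh] by (simp add: R_def)
    obtain x y where xy: "\<Phi> h (u (real n * h)) = Some x" "\<Phi> h U = Some y"
      "norm (x - y) \<le> exp (\<kappa> * h) * norm (u (real n * h) - U)"
      using stab'[OF h(1) hh(1) uR[OF nh] UR] by blast
    have "flow h (u (real n * h)) = Some (u (real (Suc n) * h))"
      using full.mild_flow_eq[OF full.mild_solution_shift[OF u nh], of h] nS h
      by (simp add: flow_def algebra_simps)
    then have le: "norm (u (real (Suc n) * h) - x) \<le> C * h ^ (q + 1)"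
      using err[OF _ hh(2) nh xy(1)] h by simp
    have "norm (u (real (Suc n) * h) - y) \<le> C * h ^ (q + 1) + exp (\<kappa> * h) * norm (u (real n * h) - U)"
      using norm_triangle_le_diff norm_triangle_mono[OF le xy(3)] by simp
    also have "\<dots> \<le> C * h ^ (q + 1) + exp (\<kappa> * h) * E (norm (u0 - U0)) h n"
      using U(2) by simp
    \<comment> \<open>The bound \<open>E\<close> satisfies its own recursion with increment
      \<open>C * h ^ q * ((exp (\<kappa> * h) - 1) / \<kappa>)\<close>. This dominates the local
      error \<open>C * h ^ (q + 1)\<close> because
      \<open>\<kappa> * h \<le> exp (\<kappa> * h) - 1\<close>.\<close>
    also have "\<dots> \<le> E (norm (u0 - U0)) h (Suc n)"
    proof -
      define a where "a = exp (\<kappa> * real n * h)"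
      define c where "c = exp (\<kappa> * h)"
      have ac: "exp (\<kappa> * real (Suc n) * h) = c * a"
        by (simp add: a_def c_def algebra_simps flip: exp_add)
      have "\<kappa> * h \<le> c - 1" using exp_ge_add_one_self[of "\<kappa> * h"] unfolding c_def by linarith
      then have "h \<le> (c - 1) / \<kappa>" using \<kappa> by (simp add: le_divide_eq mult.commute)
      then have "C * h ^ q * h \<le> C * h ^ q * ((c - 1) / \<kappa>)" using C h by (intro mult_left_mono) auto
      moreover have "E (norm (u0 - U0)) h (Suc n) =
          c * E (norm (u0 - U0)) h n + C * h ^ q * ((c - 1) / \<kappa>)"
        unfolding E_def ac a_def[symmetric] using \<kappa> by (simp add: divide_simps) (simp add: algebra_simps)
      ultimately show ?thesis by (simp add: c_def mult_ac)
    qed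
    finally show ?case using U(1) xy(2) by (auto simp: map_comp_simps)
  qed
  show ?thesis
  proof (rule exI[of _ hs], rule conjI, rule pos(2), rule exI[of _ \<delta>], rule conjI, rule pos(1),
      rule exI[of _ \<kappa>], rule conjI, rule \<kappa>, rule exI[of _ C], rule conjI, rule C, intro ballI allI impI)
    fix U0 h and n :: nat
    assume U0: "norm (u0 - U0) < \<delta>" and h: "0 < h \<and> h < hs" and "int n \<le> \<lfloor>T / h\<rfloor>"
    then have "real n \<le> T / h" by (simp add: le_floor_iff)
    then have n: "real n * h \<le> T" using h by (simp add: le_divide_eq)
    then have "flow (real n * h) u0 = Some (u (real n * h))" using h by (intro fl0) auto
    then show "\<exists>u U. flow (real n * h) u0 = Some u \<and> iter (\<Phi> h) n U0 = Some U \<and>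
           norm (u - U) \<le> exp (\<kappa> * real n * h) * norm (u0 - U0)
             + C * ((exp (\<kappa> * real n * h) - 1) / \<kappa>) * h ^ q"
      using main[OF U0 _ _ n] h unfolding E_def by auto
  qed
qed

end

theorem corollary3p12:
  fixes D0 :: "'a::{real_inner, banach} set" and A0 A1 :: "'a \<Rightarrow> 'a"
    and S :: "real \<Rightarrow> 'a \<Rightarrow> 'a"
    and \<phi> \<phi>0 \<phi>1 \<Phi>p \<Phi>m \<Phi> :: "real \<Rightarrow> 'a \<rightharpoonup> 'a"
    and Hs :: "nat \<Rightarrow> 'a set" and ip :: "nat \<Rightarrow> 'a \<Rightarrow> 'a \<Rightarrow> real"
    and \<kappa>0 T :: real and \<gamma> :: "nat \<Rightarrow> real" and s q :: nat and u0 :: 'a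
  assumes A0: "closed_densely_defined_operator D0 A0" "generates D0 A0 S"
    and A1: "smooth_map A1" "A1 0 = 0"
    and flows: "\<phi> = mild_flow S A1" "\<phi>0 = mild_flow S (\<lambda>_. 0)" "\<phi>1 = mild_flow (\<lambda>_ u. u) A1"
    and scale: "hilbert_scale Hs ip"
    and compat: "\<forall>R>0. \<exists>hs>0. \<forall>\<psi>\<in>{\<phi>, \<phi>0, \<phi>1}.
                   defined_in_scale Hs hs R \<psi> \<and> compatible Hs ip hs R \<psi>"
    and stable0: "quasicontraction \<kappa>0 S"
    and stable1: "\<forall>R>0. uniformly_stable R \<phi>1"
    and Phi_pm: "\<Phi>p = splitting \<phi>1 \<phi>0" "\<Phi>m = splitting \<phi>0 \<phi>1"
    and meth:
      "(q \<ge> 1 \<and> asymmetric_conditions q s \<gamma> \<and>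
          (\<Phi> = asymmetric_method s \<gamma> \<Phi>p \<or> \<Phi> = asymmetric_method s \<gamma> \<Phi>m)) \<or>
       (\<exists>n\<ge>1. q = 2 * n \<and> symmetric_conditions n s \<gamma> \<and> \<Phi> = symmetric_method s \<gamma> \<Phi>p \<Phi>m)"
    and u0: "u0 \<in> Hs (q + 1)"
    and T: "0 < T" "ereal T < existence_time \<phi> u0"
  shows "\<exists>hs>0. \<exists>\<delta>>0. \<exists>\<kappa>>0. \<exists>C>0.
           \<forall>U0\<in>Hs (q + 1). norm (u0 - U0) < \<delta> \<longrightarrow>
             (\<forall>h. 0 < h \<and> h < hs \<longrightarrow>
               (\<forall>n::nat. int n \<le> \<lfloor>T / h\<rfloor> \<longrightarrow>
                 (\<exists>u U. \<phi> (real n * h) u0 = Some u \<and> iter (\<Phi> h) n U0 = Some U \<and>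
                    norm (u - U) \<le> exp (\<kappa> * real n * h) * norm (u0 - U0)
                      + C * ((exp (\<kappa> * real n * h) - 1) / \<kappa>) * h ^ q)))"
proof -
  have C0: "C0_semigroup S" using A0(2) by (simp add: generates_def)
  interpret problem: splitting_problem Hs ip S A1 \<kappa>0
    by unfold_locales
      (use scale C0 stable0 A1 smooth_map_locally_lipschitz[OF A1(1)] compat stable1 in \<open>simp_all add: flows\<close>)
  have flow: "\<phi> = problem.flow" by (simp add: flows problem.flow_def)
  have step: "\<Phi>p = problem.split_step True" "\<Phi>m = problem.split_step False"
    by (simp_all add: Phi_pm flows problem.split_step_def problem.part_def)
  have "problem.stable_method \<Phi> \<and> problem.consistent_method (q + 1) \<Phi> \<and> 1 \<le> q"
    using meth
  proof (elim disjE conjE exE)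
    fix n assume "1 \<le> n" "q = 2 * n" "symmetric_conditions n s \<gamma>" "\<Phi> = symmetric_method s \<gamma> \<Phi>p \<Phi>m"
    then show ?thesis using problem.symmetric_method_facts[of n s \<gamma>] by (simp add: step)
  qed (use problem.asymmetric_method_facts[of q s \<gamma>] in \<open>simp_all add: step\<close>)
  moreover have "problem.flow T u0 \<noteq> None"
  proof -
    \<comment> \<open>\<open>T\<close> lies strictly below a supremum of times of existence, so a
      solution exists beyond \<open>T\<close>, and its restriction gives the value at
      \<open>T\<close>.\<close>
    obtain t where t: "\<phi> t u0 \<noteq> None" "T < t"
      using T(2) unfolding existence_time_def less_SUP_iff by auto
    then obtain z where "mild_flow S A1 t u0 = Some z" by (auto simp: flows)
    then obtain u where "\<And>r. r \<in> {0..t} \<Longrightarrow> mild_flow S A1 r u0 = Some (u r)"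
      by (rule problem.full.mild_flow_SomeE) blast
    then show ?thesis using T(1) t(2) by (simp add: problem.flow_def)
  qed
  ultimately show ?thesis unfolding flow using problem.convergence u0 T(1) by blast
qed

end
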